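(* Let $z_0\in\mathbf{C}^{\times}$ be arbitrary and let $\varepsilon>0$ be such that $\varepsilon\le |z_0|$. There exists $N_0(z_0,\varepsilon)$, which can be bounded explicitly, such that $$\mu_N\bigl(\{g\in U(N)\,\mid\, |\det(1-g)-z_0|<\varepsilon\}\bigr)\ \gg\ \Bigl(\frac{\varepsilon}{|z_0|}\Bigr)^2\frac{1}{\log N}$$ provided $N\ge N_0$, where the implied constant is absolute.
   Context: $U(N)\subset GL(N,\mathbf{C})$ is the unitary group and $\mu_N$ denotes the probability Haar measure on $U(N)$. The notation $f\gg g$ means that there is a constant $c>0$ (here absolute, i.e. independent of $z_0$, $\varepsilon$ and $N$) such that $f\ge c\,g$ for all values of the parameters under consideration. *)

theory Defs
  imports "HOL-Probability.Probability" "Jordan_Normal_Form.Schur_Decomposition"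
begin

(* The size of the matrices varies inside the statement, hence carrier-based matrices. *)

definition unitary_group :: "nat \<Rightarrow> complex mat set" where
  "unitary_group N = {g \<in> carrier_mat N N. g * mat_adjoint g = 1\<^sub>m N \<and> mat_adjoint g * g = 1\<^sub>m N}"

(* Borel structure of U(N) as a subspace of C^(N x N): pulled back along the matrix entries
   from the product sigma-algebra, which is the Borel sigma-algebra of C^(N x N) because C is
   second countable. The entries are restricted to indices below N since g $$ (i, j) is
   unspecified outside the dimensions. *)
definition borel_unitary_group :: "nat \<Rightarrow> complex mat measure" where
  "borel_unitary_group N =
     vimage_algebra (unitary_group N) (\<lambda>g. \<lambda>p\<in>{..<N} \<times> {..<N}. g $$ p)
       (Pi\<^sub>M ({..<N} \<times> {..<N}) (\<lambda>_. borel))"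

(* Left invariance suffices: U(N) is compact, so there is exactly one such measure and it is
   also right invariant. *)
definition haar_probability :: "nat \<Rightarrow> complex mat measure \<Rightarrow> bool" where
  "haar_probability N \<mu> \<longleftrightarrow>
     prob_space \<mu> \<and>
     space \<mu> = unitary_group N \<and>
     sets \<mu> = sets (borel_unitary_group N) \<and>
     (\<forall>h\<in>unitary_group N. \<forall>A\<in>sets \<mu>. emeasure \<mu> ((\<lambda>g. h * g) ` A) = emeasure \<mu> A)"

(* Closed formulas in z and e: this gives a meaning to "N0(z, e) can be bounded explicitly".
   Subtraction and negation come from multiplication by the constant -1, and the modulus
   and real powers of positive quantities from exp and ln. *)
inductive closed_formula :: "(complex \<Rightarrow> real \<Rightarrow> real) \<Rightarrow> bool" where
  const: "q \<in> \<rat> \<Longrightarrow> closed_formula (\<lambda>z e. q)"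
| re: "closed_formula (\<lambda>z e. Re z)"
| im: "closed_formula (\<lambda>z e. Im z)"
| eps: "closed_formula (\<lambda>z e. e)"
| add: "closed_formula f \<Longrightarrow> closed_formula g \<Longrightarrow> closed_formula (\<lambda>z e. f z e + g z e)"
| mult: "closed_formula f \<Longrightarrow> closed_formula g \<Longrightarrow> closed_formula (\<lambda>z e. f z e * g z e)"
| divide: "closed_formula f \<Longrightarrow> closed_formula g \<Longrightarrow> closed_formula (\<lambda>z e. f z e / g z e)"
| exp: "closed_formula f \<Longrightarrow> closed_formula (\<lambda>z e. exp (f z e))"
| ln: "closed_formula f \<Longrightarrow> closed_formula (\<lambda>z e. ln (f z e))"

definition explicitly_bounded :: "(complex \<Rightarrow> real \<Rightarrow> nat) \<Rightarrow> bool" where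
  "explicitly_bounded N0 \<longleftrightarrow>
     (\<exists>F. closed_formula F \<and>
        (\<forall>z e. z \<noteq> 0 \<and> 0 < e \<and> e \<le> cmod z \<longrightarrow> real (N0 z e) \<le> F z e))"

end

theory Submission
  imports Defs "HOL-Complex_Analysis.Cauchy_Integral_Theorem" "HOL-Real_Asymp.Real_Asymp"
begin

text \<open>
  Schur elimination of the first row and column of \<open>1 - g\<close> gives
  \<open>det (1 - g) = (1 - a) det (1 - h)\<close>, where \<open>a\<close> is the corner entry of \<open>g\<close> and \<open>h\<close> is a unitary
  matrix of size \<open>N - 1\<close>. Left multiplication of \<open>g\<close> by \<open>diag(1, k)\<close> fixes \<open>a\<close> and multiplies \<open>h\<close>
  by \<open>k\<close>, so \<open>h\<close> is again Haar distributed and independent of \<open>a\<close>. Hence \<open>det (1 - g)\<close> has the law of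
  \<open>\<Prod>k\<le>N. 1 - a\<^sub>k\<close> with independent factors, where \<open>a\<^sub>k\<close> is distributed as the corner entry of a Haar
  element of \<open>U(k)\<close>: its phase is uniform and \<open>|a\<^sub>k|\<^sup>2\<close> has the moments of the Beta distribution
  with parameters \<open>1, k - 1\<close>.

  For \<open>k \<ge> 6\<close> the variable \<open>X\<^sub>k = Ln (1 - a\<^sub>k)\<close> satisfies \<open>E X\<^sub>k = E X\<^sub>k\<^sup>2 = 0\<close>, its second absolute
  moment is of order \<open>1/k\<close> and its third one is \<open>O(k\<^sup>-\<^sup>3\<^sup>/\<^sup>2)\<close>, which is summable. The characteristic
  function of \<open>\<Sum>k. X\<^sub>k\<close> is therefore so close to that of a complex Gaussian of variance of order \<open>log N\<close>
  that, testing against a difference of two Gaussians of width \<open>\<delta>\<close> lying below the indicator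
  function of a disc, one obtains probability \<open>\<ge> c \<delta>\<^sup>2 / log N\<close> for every disc of radius \<open>\<delta>\<close> whose
  centre is \<open>O(sqrt (log N))\<close>. Apply this with \<open>\<delta>\<close> of order \<open>\<epsilon> / |z\<^sub>0|\<close> near a logarithm of \<open>z\<^sub>0\<close>
  divided by the first five factors.
\<close>

section \<open>Unitary matrices and Schur complements\<close>

text \<open>\<open>Ln (1 - a)\<close> is unbounded near \<open>a = 1\<close>, so its moments need
  negative moments of \<open>1 - |a|^2\<close>, while Haar invariance supplies only the moments of
  \<open>|a|^2\<close>. Truncated geometric series bridge the gap: the \<open>j\<close>-th power of
  a truncation of \<open>1 / (1 - u)\<close> obeys a recursion with coefficient
  \<open>k - 1 - j\<close>, and the fourth moment (\<open>j = 4\<close>) makes this positive from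
  \<open>k = 6\<close> on. That decides which factors are set apart. \<open>E X = E X^2 = 0\<close>
  holds because the power series of the logarithm has only positive powers and the phase of
  \<open>a\<close> is uniform. It makes the covariance isotropic, so the limiting Gaussian depends
  on \<open>|t|\<close> alone. Frequencies are controlled only up to order \<open>N^(1/4)\<close>:
  factor \<open>k\<close> is close to Gaussian for \<open>|t|\<close> up to order
  \<open>sqrt k\<close>, and the factors with \<open>k >= sqrt N\<close> still carry a fixed share
  of the variance. Beyond this radius only the bound 1 is used, at a cost
  \<open>exp (- c delta^2 sqrt N)\<close> after Gaussian smoothing; hence the condition that
  \<open>N\<close> exceed a power of \<open>|z0| / eps\<close>.\<close>

lemma index_mat_adjoint [simp]:
  "i < dim_col A \<Longrightarrow> j < dim_row A \<Longrightarrow> mat_adjoint A $$ (i, j) = conjugate (A $$ (j, i))"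
  by (simp add: mat_adjoint_def mat_of_rows_index)

lemma dim_mat_adjoint [simp]:
  "dim_row (mat_adjoint A) = dim_col A" "dim_col (mat_adjoint A) = dim_row A"
  by (simp_all add: mat_adjoint_def)

text \<open>A right inverse of a square matrix is also a left inverse, so orthonormal rows give both
  defining equations.\<close>

lemma unitary_group_rows_iff:
  "g \<in> unitary_group N \<longleftrightarrow> g \<in> carrier_mat N N \<and>
     (\<forall>i<N. \<forall>l<N. (\<Sum>j<N. g $$ (i, j) * cnj (g $$ (l, j))) = (if i = l then 1 else 0))"
proof -
  have "g * mat_adjoint g = 1\<^sub>m N \<longleftrightarrow>
      (\<forall>i<N. \<forall>l<N. (\<Sum>j<N. g $$ (i, j) * cnj (g $$ (l, j))) = (if i = l then 1 else 0))"
    if g: "g \<in> carrier_mat N N"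
    using g by (auto simp: mat_eq_iff scalar_prod_def atLeast0LessThan)
  moreover have "mat_adjoint g * g = 1\<^sub>m N" if "g \<in> carrier_mat N N" "g * mat_adjoint g = 1\<^sub>m N"
    using that by (intro mat_mult_left_right_inverse[of g N "mat_adjoint g"]) (auto intro!: carrier_matI)
  ultimately show ?thesis
    by (auto simp: unitary_group_def)
qed

lemma unitary_group_rows:
  "g \<in> unitary_group N \<Longrightarrow> i < N \<Longrightarrow> l < N \<Longrightarrow>
     (\<Sum>j<N. g $$ (i, j) * cnj (g $$ (l, j))) = (if i = l then 1 else 0)"
  by (simp add: unitary_group_rows_iff)

lemma unitary_group_carrier: "g \<in> unitary_group N \<Longrightarrow> g \<in> carrier_mat N N"
  by (simp add: unitary_group_def)

lemma unitary_group_dim [simp]: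
  "g \<in> unitary_group N \<Longrightarrow> dim_row g = N" "g \<in> unitary_group N \<Longrightarrow> dim_col g = N"
  by (auto simp: unitary_group_def)

lemma mat_adjoint_mat_adjoint [simp]: "mat_adjoint (mat_adjoint (A::complex mat)) = A"
  by (rule eq_matI) auto

lemma mat_adjoint_mult:
  fixes A B :: "complex mat"
  assumes "dim_col A = dim_row B"
  shows "mat_adjoint (A * B) = mat_adjoint B * mat_adjoint A"
  using assms by (intro eq_matI) (auto simp: scalar_prod_def mult.commute intro!: sum.cong)

lemma unitary_group_adjoint: "g \<in> unitary_group N \<Longrightarrow> mat_adjoint g \<in> unitary_group N"
  by (auto simp: unitary_group_def intro!: carrier_matI)

lemma unitary_group_cols:
  "g \<in> unitary_group N \<Longrightarrow> i < N \<Longrightarrow> l < N \<Longrightarrow>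
     (\<Sum>j<N. g $$ (j, l) * cnj (g $$ (j, i))) = (if i = l then 1 else 0)"
  using unitary_group_rows[OF unitary_group_adjoint, of g N i l]
  by (simp add: mult.commute)

lemma unitary_group_mult:
  assumes "g \<in> unitary_group N" "h \<in> unitary_group N"
  shows "g * h \<in> unitary_group N"
proof -
  note c = assms[THEN unitary_group_carrier] assms[THEN unitary_group_adjoint, THEN unitary_group_carrier]
  have "g * h * mat_adjoint (g * h) = g * (h * mat_adjoint h) * mat_adjoint g"
    using c by (simp add: mat_adjoint_mult assoc_mult_mat[where ?n\<^sub>1=N and ?n\<^sub>2=N and ?n\<^sub>3=N and ?n\<^sub>4=N])
  moreover have "mat_adjoint (g * h) * (g * h) = mat_adjoint h * (mat_adjoint g * g) * h"
    using c by (simp add: mat_adjoint_mult assoc_mult_mat[where ?n\<^sub>1=N and ?n\<^sub>2=N and ?n\<^sub>3=N and ?n\<^sub>4=N])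
  ultimately show ?thesis
    using assms c by (simp add: unitary_group_def)
qed

lemma unitary_group_entry_le:
  assumes "g \<in> unitary_group N" "i < N" "j < N"
  shows "cmod (g $$ (i, j)) \<le> 1"
proof -
  have "complex_of_real (\<Sum>l<N. (cmod (g $$ (i, l)))\<^sup>2) = 1"
    using unitary_group_rows[OF assms(1,2,2)]
    by (simp add: complex_norm_square del: of_real_power)
  then have "(\<Sum>l<N. (cmod (g $$ (i, l)))\<^sup>2) = 1"
    using of_real_eq_1_iff by blast
  then have "(cmod (g $$ (i, j)))\<^sup>2 \<le> 1"
    using assms member_le_sum[of j "{..<N}" "\<lambda>l. (cmod (g $$ (i, l)))\<^sup>2"] by simp
  then show ?thesis
    by (simp add: power_le_one_iff)
qed

lemma unitary_group_adjoint_mult_cancel: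
  assumes "k \<in> unitary_group N" "g \<in> unitary_group N"
  shows "mat_adjoint k * (k * g) = g" "k * (mat_adjoint k * g) = g"
proof -
  have k: "mat_adjoint k * k = 1\<^sub>m N" "k * mat_adjoint k = 1\<^sub>m N"
    and c: "k \<in> carrier_mat N N" "mat_adjoint k \<in> carrier_mat N N" "g \<in> carrier_mat N N"
    using assms unitary_group_adjoint[OF assms(1)] by (auto simp: unitary_group_def)
  show "mat_adjoint k * (k * g) = g"
    using k c by (simp add: assoc_mult_mat[symmetric, where ?n\<^sub>1=N and ?n\<^sub>2=N and ?n\<^sub>3=N and ?n\<^sub>4=N])
  show "k * (mat_adjoint k * g) = g"
    using k c by (simp add: assoc_mult_mat[symmetric, where ?n\<^sub>1=N and ?n\<^sub>2=N and ?n\<^sub>3=N and ?n\<^sub>4=N])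
qed

text \<open>\<open>1 - schur_red n g\<close> is the Schur complement of the corner entry of \<open>1 - g\<close>.
  If that entry vanishes then so do the rest of its row and column, and \<open>x / 0 = 0\<close>
  gives the right value, namely the lower right block of \<open>g\<close>.\<close>

definition schur_red :: "nat \<Rightarrow> complex mat \<Rightarrow> complex mat" where
  "schur_red n g = Matrix.mat n n (\<lambda>(i, j).
     g $$ (Suc i, Suc j) + g $$ (Suc i, 0) * g $$ (0, Suc j) / (1 - g $$ (0, 0)))"

lemma schur_red_carrier [simp]: "schur_red n g \<in> carrier_mat n n"
  by (simp add: schur_red_def)

lemma schur_red_dim [simp]: "dim_row (schur_red n g) = n" "dim_col (schur_red n g) = n"
  by (simp_all add: schur_red_def)

text \<open>The first column is a unit vector, so a corner entry 1 uses up its whole norm. This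
  settles the case where \<open>schur_red\<close> divides by zero.\<close>

lemma unitary_corner_one:
  assumes g: "g \<in> unitary_group (Suc n)" and 1: "g $$ (0, 0) = 1" and i: "i < n"
  shows "g $$ (Suc i, 0) = 0"
proof -
  have "complex_of_real (\<Sum>l<Suc n. (cmod (g $$ (l, 0)))\<^sup>2) = 1"
    using unitary_group_cols[OF g, of 0 0] by (simp add: complex_norm_square del: sum.lessThan_Suc of_real_power)
  then have "(\<Sum>l<Suc n. (cmod (g $$ (l, 0)))\<^sup>2) = 1"
    using of_real_eq_1_iff by blast
  then have "(\<Sum>l<n. (cmod (g $$ (Suc l, 0)))\<^sup>2) = 0"
    by (simp add: sum.lessThan_Suc_shift 1 del: sum.lessThan_Suc)
  then show ?thesis
    using i by (simp add: sum_nonneg_eq_0_iff)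
qed

text \<open>Away from corner entry 1, feed the first output coordinate back as input: solving
  \<open>g (x0, x) = (x0, y)\<close> for \<open>x0\<close> gives \<open>y = schur_red n g x\<close>.
  Since \<open>g\<close> preserves norms, \<open>|x0|^2 + |x|^2 = |x0|^2 + |y|^2\<close>, so
  \<open>|y| = |x|\<close>. The proof verifies the corresponding Gram identity of the rows.\<close>

lemma schur_red_unitary:
  assumes g: "g \<in> unitary_group (Suc n)"
  shows "schur_red n g \<in> unitary_group n"
  unfolding unitary_group_rows_iff
proof (intro conjI allI impI)
  fix i l assume il: "i < n" "l < n"
  define c where "c = g $$ (0, 0)"
  define p q where "p = g $$ (Suc i, 0)" and "q = g $$ (Suc l, 0)"
  define D :: complex where "D = (if i = l then 1 else 0)"
  note S = sum.lessThan_Suc_shift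
  have r: "(\<Sum>j<n. g $$ (Suc i, Suc j) * cnj (g $$ (Suc l, Suc j))) = D - p * cnj q"
    using unitary_group_rows[OF g, of "Suc i" "Suc l"] il
    by (auto simp: S p_def q_def D_def eq_diff_eq add.commute simp del: sum.lessThan_Suc)
  have r1: "(\<Sum>j<n. g $$ (Suc i, Suc j) * cnj (g $$ (0, Suc j))) = - p * cnj c"
    using unitary_group_rows[OF g, of "Suc i" 0] il
    by (simp add: S p_def c_def add_eq_0_iff del: sum.lessThan_Suc)
  have r2: "(\<Sum>j<n. g $$ (0, Suc j) * cnj (g $$ (Suc l, Suc j))) = - c * cnj q"
    using unitary_group_rows[OF g, of 0 "Suc l"] il
    by (simp add: S q_def c_def add_eq_0_iff del: sum.lessThan_Suc)
  have r3: "(\<Sum>j<n. g $$ (0, Suc j) * cnj (g $$ (0, Suc j))) = 1 - c * cnj c"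
    using unitary_group_rows[OF g, of 0 0]
    by (simp add: S c_def eq_diff_eq add.commute del: sum.lessThan_Suc)
  define u w where "u = p / (1 - c)" and "w = q / (1 - c)"
  have "(\<Sum>j<n. schur_red n g $$ (i, j) * cnj (schur_red n g $$ (l, j)))
    = (\<Sum>j<n. (g $$ (Suc i, Suc j) + u * g $$ (0, Suc j)) * (cnj (g $$ (Suc l, Suc j)) + cnj w * cnj (g $$ (0, Suc j))))"
    using il by (intro sum.cong) (auto simp: schur_red_def u_def w_def p_def q_def c_def)
  also have "\<dots> = (\<Sum>j<n. g $$ (Suc i, Suc j) * cnj (g $$ (Suc l, Suc j))
     + cnj w * (g $$ (Suc i, Suc j) * cnj (g $$ (0, Suc j)))
     + u * (g $$ (0, Suc j) * cnj (g $$ (Suc l, Suc j)))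
     + u * cnj w * (g $$ (0, Suc j) * cnj (g $$ (0, Suc j))))"
    by (intro sum.cong) (auto simp: algebra_simps)
  also have "\<dots> = D - p * cnj q - cnj w * (p * cnj c) - u * (c * cnj q) + u * cnj w * (1 - c * cnj c)"
    by (simp add: sum.distrib sum_distrib_left[symmetric] r r1 r2 r3)
  also have "\<dots> = D"
  proof (cases "c = 1")
    case True
    then have "p = 0"
      using unitary_corner_one[OF g _ il(1)] by (simp add: c_def p_def)
    then show ?thesis
      by (simp add: u_def)
  next
    case False
    then have p: "p = u * (1 - c)" and q: "cnj q = cnj w * (1 - cnj c)"
      by (simp_all add: u_def w_def)
    show ?thesis
      unfolding p q by (simp add: algebra_simps)
  qed
  finally show "(\<Sum>j<n. schur_red n g $$ (i, j) * cnj (schur_red n g $$ (l, j))) = (if i = l then 1 else 0)"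
    by (simp add: D_def)
qed simp

lemma det_one_minus_schur_red:
  assumes g: "g \<in> unitary_group (Suc n)"
  shows "Determinant.det (1\<^sub>m (Suc n) - g) = (1 - g $$ (0, 0)) * Determinant.det (1\<^sub>m n - schur_red n g)"
proof -
  define b where "b = 1 - g $$ (0, 0)"
  define B where "B = Matrix.mat 1 1 (\<lambda>_. b)"
  define R where "R = Matrix.mat 1 n (\<lambda>(i, j). - g $$ (0, Suc j))"
  define C where "C = Matrix.mat n 1 (\<lambda>(i, j). g $$ (Suc i, 0) / - b)"
  define D where "D = 1\<^sub>m n - schur_red n g"
  have c [simp]: "B \<in> carrier_mat 1 1" "R \<in> carrier_mat 1 n" "C \<in> carrier_mat n 1" "D \<in> carrier_mat n n"
    by (auto simp: B_def R_def C_def D_def)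
  note [simp] = c[THEN carrier_matD(1)] c[THEN carrier_matD(2)] unitary_group_dim[OF g]
  have "1\<^sub>m (Suc n) - g = four_block_mat (1\<^sub>m 1) (0\<^sub>m 1 n) C (1\<^sub>m n) * four_block_mat B R (0\<^sub>m n 1) D"
  proof (rule eq_matI)
    fix i j assume ij: "i < dim_row (four_block_mat (1\<^sub>m 1) (0\<^sub>m 1 n) C (1\<^sub>m n) * four_block_mat B R (0\<^sub>m n 1) D)"
      "j < dim_col (four_block_mat (1\<^sub>m 1) (0\<^sub>m 1 n) C (1\<^sub>m n) * four_block_mat B R (0\<^sub>m n 1) D)"
    \<comment> \<open>If the pivot \<open>b\<close> is zero, the entries of \<open>C\<close> are
      \<open>x / 0 = 0\<close>. The block factorization survives because the column that they should
      clear is already zero.\<close>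
    have z: "g $$ (Suc i, 0) = 0" if "b = 0" "i < n" for i
      using unitary_corner_one[OF g _ that(2)] that(1) by (simp add: b_def)
    have "four_block_mat (1\<^sub>m 1) (0\<^sub>m 1 n) C (1\<^sub>m n) * four_block_mat B R (0\<^sub>m n 1) D
      = four_block_mat B R (C * B) (C * R + D)"
      by (subst mult_four_block_mat[of _ 1 1 _ n _ n _ _ 1 _ n]) auto
    then show "(1\<^sub>m (Suc n) - g) $$ (i, j) =
      (four_block_mat (1\<^sub>m 1) (0\<^sub>m 1 n) C (1\<^sub>m n) * four_block_mat B R (0\<^sub>m n 1) D) $$ (i, j)"
      using ij z
      by (cases i; cases j; cases "b = 0")
         (auto simp: scalar_prod_def B_def R_def C_def D_def schur_red_def b_def[symmetric] divide_simps, auto simp: b_def algebra_simps)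
  qed auto
  then have "Determinant.det (1\<^sub>m (Suc n) - g) = Determinant.det (four_block_mat (1\<^sub>m 1) (0\<^sub>m 1 n) C (1\<^sub>m n))
      * Determinant.det (four_block_mat B R (0\<^sub>m n 1) D)"
    by (simp only:) (rule det_mult[of _ "1 + n"], auto intro!: carrier_matI)
  also have "Determinant.det (four_block_mat (1\<^sub>m 1) (0\<^sub>m 1 n) C (1\<^sub>m n)) = 1"
    by (subst det_four_block_mat_upper_right_zero[of _ 1 _ n]) auto
  also have "Determinant.det (four_block_mat B R (0\<^sub>m n 1) D) = Determinant.det B * Determinant.det D"
    by (rule det_four_block_mat_lower_left_zero[of _ 1 _ n]) auto
  also have "Determinant.det B = b"
    by (simp add: Determinant.det_def B_def sign_id)
  finally show ?thesis
    by (simp add: D_def b_def)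
qed

definition corner_embed :: "nat \<Rightarrow> complex mat \<Rightarrow> complex mat" where
  "corner_embed n k = Matrix.mat (Suc n) (Suc n) (\<lambda>(i, j).
     if i = 0 \<or> j = 0 then (if i = j then 1 else 0) else k $$ (i - 1, j - 1))"

lemma corner_embed_unitary:
  assumes "k \<in> unitary_group n"
  shows "corner_embed n k \<in> unitary_group (Suc n)"
  unfolding unitary_group_rows_iff
proof (intro conjI allI impI)
  fix i l assume "i < Suc n" "l < Suc n"
  then show "(\<Sum>j<Suc n. corner_embed n k $$ (i, j) * cnj (corner_embed n k $$ (l, j))) = (if i = l then 1 else 0)"
    using unitary_group_rows[OF assms, of "i - 1" "l - 1"]
    by (cases i; cases l) (simp_all add: sum.lessThan_Suc_shift corner_embed_def del: sum.lessThan_Suc)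
qed (simp add: corner_embed_def)

lemma corner_embed_mult_index:
  assumes "g \<in> carrier_mat (Suc n) (Suc n)" "i < Suc n" "j < Suc n"
  shows "(corner_embed n k * g) $$ (i, j) =
    (if i = 0 then g $$ (0, j) else \<Sum>l<n. k $$ (i - 1, l) * g $$ (Suc l, j))"
  using assms
  by (auto simp: corner_embed_def scalar_prod_def atLeast0LessThan sum.lessThan_Suc_shift simp del: sum.lessThan_Suc)

lemma schur_red_corner_embed:
  assumes g: "g \<in> carrier_mat (Suc n) (Suc n)" and k: "k \<in> carrier_mat n n"
  shows "schur_red n (corner_embed n k * g) = k * schur_red n g"
proof (rule eq_matI)
  fix i j assume "i < dim_row (k * schur_red n g)" "j < dim_col (k * schur_red n g)"
  then have ij: "i < n" "j < n"
    using k by auto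
  then show "schur_red n (corner_embed n k * g) $$ (i, j) = (k * schur_red n g) $$ (i, j)"
    using g k
    by (simp add: schur_red_def corner_embed_mult_index scalar_prod_def atLeast0LessThan
        distrib_left sum.distrib sum_divide_distrib sum_distrib_right mult.assoc)
qed (use k in auto)

section \<open>Haar measures\<close>

lemma borel_measurable_cnj [measurable]: "cnj \<in> borel_measurable borel"
  by (intro borel_measurable_continuous_onI continuous_intros)

lemma space_borel_unitary_group [simp]: "space (borel_unitary_group N) = unitary_group N"
  by (simp add: borel_unitary_group_def)

lemma measurable_unitary_group_entry:
  assumes "i < N" "j < N"
  shows "(\<lambda>g. g $$ (i, j)) \<in> borel_measurable (borel_unitary_group N)"
proof -
  have "(\<lambda>g. \<lambda>p\<in>{..<N} \<times> {..<N}. g $$ p) \<in> borel_unitary_group N \<rightarrow>\<^sub>M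
      Pi\<^sub>M ({..<N} \<times> {..<N}) (\<lambda>_. borel :: complex measure)"
    unfolding borel_unitary_group_def
    by (rule measurable_vimage_algebra1) (auto simp: space_PiM)
  from measurable_compose[OF this measurable_component_singleton[of "(i, j)"]]
  show ?thesis
    using assms by simp
qed

lemma measurable_into_unitary_group:
  assumes "\<And>x. x \<in> space M \<Longrightarrow> f x \<in> unitary_group N"
    and "\<And>i j. i < N \<Longrightarrow> j < N \<Longrightarrow> (\<lambda>x. f x $$ (i, j)) \<in> borel_measurable M"
  shows "f \<in> M \<rightarrow>\<^sub>M borel_unitary_group N"
  unfolding borel_unitary_group_def
proof (rule measurable_vimage_algebra2)
  show "(\<lambda>x. \<lambda>p\<in>{..<N} \<times> {..<N}. f x $$ p) \<in> M \<rightarrow>\<^sub>M Pi\<^sub>M ({..<N} \<times> {..<N}) (\<lambda>_. borel)"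
    using assms(2) by (intro measurable_restrict) auto
qed (use assms(1) in auto)

lemma measurable_compose_entry:
  assumes "f \<in> M \<rightarrow>\<^sub>M borel_unitary_group N" "i < N" "j < N"
  shows "(\<lambda>x. f x $$ (i, j)) \<in> borel_measurable M"
  using measurable_compose[OF assms(1) measurable_unitary_group_entry[OF assms(2,3)]] .

lemma measurable_space_unitary:
  "f \<in> M \<rightarrow>\<^sub>M borel_unitary_group N \<Longrightarrow> x \<in> space M \<Longrightarrow> f x \<in> unitary_group N"
  using measurable_space[of f M "borel_unitary_group N" x] by simp

lemma measurable_unitary_mult:
  assumes f: "f \<in> M \<rightarrow>\<^sub>M borel_unitary_group N" and h: "h \<in> M \<rightarrow>\<^sub>M borel_unitary_group N"
  shows "(\<lambda>x. f x * h x) \<in> M \<rightarrow>\<^sub>M borel_unitary_group N"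
proof (rule measurable_into_unitary_group)
  fix i j assume ij: "i < N" "j < N"
  have "(\<lambda>x. \<Sum>l<N. f x $$ (i, l) * h x $$ (l, j)) \<in> borel_measurable M"
    using ij f h by (intro borel_measurable_sum borel_measurable_times measurable_compose_entry) auto
  then show "(\<lambda>x. (f x * h x) $$ (i, j)) \<in> borel_measurable M"
    using ij measurable_space_unitary[OF f, THEN unitary_group_dim(1)] measurable_space_unitary[OF f, THEN unitary_group_dim(2)]
      measurable_space_unitary[OF h, THEN unitary_group_dim(1)] measurable_space_unitary[OF h, THEN unitary_group_dim(2)]
    by (subst measurable_cong) (auto simp: scalar_prod_def atLeast0LessThan)
qed (use measurable_space_unitary[OF f] measurable_space_unitary[OF h] in \<open>auto intro: unitary_group_mult\<close>)

lemma measurable_unitary_adjoint: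
  assumes f: "f \<in> M \<rightarrow>\<^sub>M borel_unitary_group N"
  shows "(\<lambda>x. mat_adjoint (f x)) \<in> M \<rightarrow>\<^sub>M borel_unitary_group N"
proof (rule measurable_into_unitary_group)
  fix i j assume ij: "i < N" "j < N"
  have "(\<lambda>x. cnj (f x $$ (j, i))) \<in> borel_measurable M"
    using measurable_compose[OF measurable_compose_entry[OF f ij(2,1)], of cnj borel]
    by (simp add: borel_measurable_continuous_onI continuous_intros)
  then show "(\<lambda>x. mat_adjoint (f x) $$ (i, j)) \<in> borel_measurable M"
    using ij measurable_space_unitary[OF f, THEN unitary_group_dim(1)] measurable_space_unitary[OF f, THEN unitary_group_dim(2)]
    by (subst measurable_cong) auto
qed (use measurable_space_unitary[OF f] in \<open>auto intro: unitary_group_adjoint\<close>)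

lemma measurable_schur_red:
  "schur_red n \<in> borel_unitary_group (Suc n) \<rightarrow>\<^sub>M borel_unitary_group n"
proof (rule measurable_into_unitary_group)
  fix i j assume ij: "i < n" "j < n"
  note [measurable] = measurable_unitary_group_entry
  show "(\<lambda>x. schur_red n x $$ (i, j)) \<in> borel_measurable (borel_unitary_group (Suc n))"
    unfolding schur_red_def using ij by simp
qed (auto intro: schur_red_unitary)

lemma measurable_det_one_minus:
  "(\<lambda>g. Determinant.det (1\<^sub>m N - g)) \<in> borel_measurable (borel_unitary_group N)"
proof -
  have m: "(\<lambda>g. \<Sum>p\<in>{p. p permutes {0..<N}}. signof p * (\<Prod>i = 0..<N. ((if i = p i then 1 else 0) - g $$ (i, p i))))
      \<in> borel_measurable (borel_unitary_group N)"
    by (intro borel_measurable_sum borel_measurable_times borel_measurable_prod borel_measurable_diff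
         measurable_unitary_group_entry borel_measurable_const)
       (auto simp: permutes_in_image)
  have d: "Determinant.det (1\<^sub>m N - g) =
      (\<Sum>p\<in>{p. p permutes {0..<N}}. signof p * (\<Prod>i = 0..<N. ((if i = p i then 1 else 0) - g $$ (i, p i))))"
    if "g \<in> unitary_group N" for g
  proof -
    have *: "(1\<^sub>m N - g) $$ (i, p i) = (if i = p i then 1 else 0) - g $$ (i, p i)"
      if "p permutes {0..<N}" "i \<in> {0..<N}" for p i
      using that permutes_in_image[OF that(1), of i] unitary_group_dim[OF \<open>g \<in> unitary_group N\<close>] by simp
    have "1\<^sub>m N - g \<in> carrier_mat N N"
      using unitary_group_carrier[OF that] by auto
    then show ?thesis
      unfolding Determinant.det_def'[OF \<open>1\<^sub>m N - g \<in> carrier_mat N N\<close>]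
      using * by (intro sum.cong prod.cong arg_cong2[where f = "(*)"] refl) simp
  qed
  show ?thesis
    by (rule measurable_cong[THEN iffD2, OF _ m]) (rule d, simp)
qed

lemma haar_probabilityD:
  assumes "haar_probability N \<mu>"
  shows "prob_space \<mu>" "space \<mu> = unitary_group N" "sets \<mu> = sets (borel_unitary_group N)"
  using assms by (auto simp: haar_probability_def)

lemma measurable_unitary_left_mult:
  assumes "h \<in> unitary_group N"
  shows "(\<lambda>g. h * g) \<in> borel_unitary_group N \<rightarrow>\<^sub>M borel_unitary_group N"
  using assms by (intro measurable_unitary_mult) simp_all

lemma vimage_unitary_left_mult:
  assumes h: "h \<in> unitary_group N" and A: "A \<subseteq> unitary_group N"
  shows "(\<lambda>g. h * g) -` A \<inter> unitary_group N = (\<lambda>g. mat_adjoint h * g) ` A"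
proof (intro equalityI subsetI)
  fix g assume "g \<in> (\<lambda>g. h * g) -` A \<inter> unitary_group N"
  then show "g \<in> (\<lambda>g. mat_adjoint h * g) ` A"
    using unitary_group_adjoint_mult_cancel(1)[OF h, of g] by (intro image_eqI[of _ _ "h * g"]) auto
next
  fix g assume "g \<in> (\<lambda>g. mat_adjoint h * g) ` A"
  then show "g \<in> (\<lambda>g. h * g) -` A \<inter> unitary_group N"
    using A unitary_group_adjoint_mult_cancel(2)[OF h] unitary_group_mult[OF unitary_group_adjoint[OF h]] by auto
qed

text \<open>The definition speaks of images of sets, push-forwards of preimages. The preimage under
  multiplication by \<open>h\<close> is the image under multiplication by
  \<open>mat_adjoint h\<close>, and both conditions range over the whole group.\<close>

lemma haar_probability_iff_distr:
  "haar_probability N \<mu> \<longleftrightarrow> prob_space \<mu> \<and> sets \<mu> = sets (borel_unitary_group N) \<and>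
     (\<forall>h\<in>unitary_group N. distr \<mu> \<mu> (\<lambda>g. h * g) = \<mu>)"
proof safe
  assume H: "haar_probability N \<mu>"
  note H' = haar_probabilityD[OF H]
  show "prob_space \<mu>" "A \<in> sets \<mu> \<Longrightarrow> A \<in> sets (borel_unitary_group N)" "A \<in> sets (borel_unitary_group N) \<Longrightarrow> A \<in> sets \<mu>" for A
    using H' by auto
  fix h assume h: "h \<in> unitary_group N"
  have m: "(\<lambda>g. h * g) \<in> \<mu> \<rightarrow>\<^sub>M \<mu>"
    using measurable_unitary_left_mult[OF h] H'(3) measurable_cong_sets by blast
  show "distr \<mu> \<mu> (\<lambda>g. h * g) = \<mu>"
  proof (rule measure_eqI)
    fix A assume "A \<in> sets (distr \<mu> \<mu> (\<lambda>g. h * g))"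
    then have A: "A \<in> sets \<mu>" by simp
    then have "A \<subseteq> unitary_group N"
      using sets.sets_into_space H'(2) by blast
    then show "emeasure (distr \<mu> \<mu> (\<lambda>g. h * g)) A = emeasure \<mu> A"
      using H A unitary_group_adjoint[OF h] m
      by (simp add: emeasure_distr H'(2) vimage_unitary_left_mult[OF h] haar_probability_def)
  qed simp
next
  assume p: "prob_space \<mu>" and s: "sets \<mu> = sets (borel_unitary_group N)"
    and d: "\<forall>h\<in>unitary_group N. distr \<mu> \<mu> (\<lambda>g. h * g) = \<mu>"
  have sp: "space \<mu> = unitary_group N"
    using sets_eq_imp_space_eq[OF s] by simp
  have "emeasure \<mu> ((\<lambda>g. h * g) ` A) = emeasure \<mu> A" if h: "h \<in> unitary_group N" and A: "A \<in> sets \<mu>" for h A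
  proof -
    have h': "mat_adjoint h \<in> unitary_group N"
      by (rule unitary_group_adjoint[OF h])
    have m: "(\<lambda>g. mat_adjoint h * g) \<in> \<mu> \<rightarrow>\<^sub>M \<mu>"
      using measurable_unitary_left_mult[OF h'] s measurable_cong_sets by blast
    have "emeasure \<mu> A = emeasure (distr \<mu> \<mu> (\<lambda>g. mat_adjoint h * g)) A"
      using d h' by simp
    also have "\<dots> = emeasure \<mu> ((\<lambda>g. h * g) ` A)"
      using sets.sets_into_space[OF A] vimage_unitary_left_mult[OF h', of A]
      by (simp add: emeasure_distr[OF m A] sp)
    finally show ?thesis ..
  qed
  then show "haar_probability N \<mu>"
    using p s sp by (simp add: haar_probability_def)
qed

lemma haar_nn_integral_left:
  assumes H: "haar_probability N \<mu>" and h: "h \<in> unitary_group N" and f: "f \<in> borel_measurable (borel_unitary_group N)"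
  shows "(\<integral>\<^sup>+g. f (h * g) \<partial>\<mu>) = (\<integral>\<^sup>+g. f g \<partial>\<mu>)"
proof -
  note s = haar_probabilityD(3)[OF H]
  have m: "(\<lambda>g. h * g) \<in> \<mu> \<rightarrow>\<^sub>M \<mu>"
    using measurable_unitary_left_mult[OF h] s measurable_cong_sets by blast
  have f': "f \<in> borel_measurable \<mu>"
    using f s measurable_cong_sets by blast
  have "(\<integral>\<^sup>+g. f g \<partial>\<mu>) = (\<integral>\<^sup>+g. f g \<partial>distr \<mu> \<mu> (\<lambda>g. h * g))"
    using H h by (simp add: haar_probability_iff_distr)
  then show ?thesis
    using m f' by (simp add: nn_integral_distr)
qed

lemma haar_integral_left:
  fixes f :: "complex mat \<Rightarrow> 'b :: {banach, second_countable_topology}"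
  assumes H: "haar_probability N \<mu>" and h: "h \<in> unitary_group N" and f: "f \<in> borel_measurable (borel_unitary_group N)"
  shows "(\<integral>g. f (h * g) \<partial>\<mu>) = (\<integral>g. f g \<partial>\<mu>)"
proof -
  note s = haar_probabilityD(3)[OF H]
  have m: "(\<lambda>g. h * g) \<in> \<mu> \<rightarrow>\<^sub>M \<mu>"
    using measurable_unitary_left_mult[OF h] s measurable_cong_sets by blast
  have f': "f \<in> borel_measurable \<mu>"
    using f s measurable_cong_sets by blast
  have "(\<integral>g. f g \<partial>\<mu>) = (\<integral>g. f g \<partial>distr \<mu> \<mu> (\<lambda>g. h * g))"
    using H h by (simp add: haar_probability_iff_distr)
  then show ?thesis
    using m f' by (simp add: integral_distr)
qed

section \<open>Independence of the corner entry and the Schur reduction\<close>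

lemma haar_schur_red:
  assumes H: "haar_probability (Suc n) \<mu>"
  shows "haar_probability n (distr \<mu> (borel_unitary_group n) (schur_red n))"
proof -
  interpret prob_space \<mu> using haar_probabilityD[OF H] by simp
  note s = haar_probabilityD(2,3)[OF H]
  define U where "U = borel_unitary_group n"
  have m: "schur_red n \<in> \<mu> \<rightarrow>\<^sub>M U"
    using measurable_schur_red s measurable_cong_sets unfolding U_def by blast
  have "distr (distr \<mu> U (schur_red n)) (distr \<mu> U (schur_red n)) (\<lambda>g. h * g) = distr \<mu> U (schur_red n)"
    if h: "h \<in> unitary_group n" for h
  proof -
    have h': "corner_embed n h \<in> unitary_group (Suc n)"
      using h by (rule corner_embed_unitary)
    have mh: "(\<lambda>g. h * g) \<in> U \<rightarrow>\<^sub>M U" "(\<lambda>g. corner_embed n h * g) \<in> \<mu> \<rightarrow>\<^sub>M \<mu>"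
      using measurable_unitary_left_mult[OF h] measurable_unitary_left_mult[OF h'] s measurable_cong_sets
      unfolding U_def by blast+
    have "distr \<mu> U (schur_red n) = distr (distr \<mu> \<mu> (\<lambda>g. corner_embed n h * g)) U (schur_red n)"
      using H h' by (simp add: haar_probability_iff_distr)
    also have "\<dots> = distr \<mu> U (\<lambda>g. schur_red n (corner_embed n h * g))"
      by (simp add: distr_distr m mh comp_def)
    also have "\<dots> = distr \<mu> U (\<lambda>g. h * schur_red n g)"
      using h by (intro distr_cong) (auto simp: s schur_red_corner_embed unitary_group_carrier)
    also have "\<dots> = distr (distr \<mu> U (schur_red n)) U (\<lambda>g. h * g)"
      by (simp add: distr_distr m mh comp_def)
    finally show ?thesis
      by (metis distr_cong sets_distr)
  qed
  then show ?thesis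
    using prob_space_distr[OF m] by (auto simp: haar_probability_iff_distr U_def)
qed

text \<open>Averaging \<open>1\<^sub>A(k h)\<close> over an independent copy \<open>k\<close> of \<open>h\<^sup>*\<close>
  turns the invariance of the joint law under \<open>h \<mapsto> k h\<close> into independence.\<close>

lemma emeasure_corner_schur_red:
  assumes H: "haar_probability (Suc n) \<mu>" and A: "A \<in> sets (borel_unitary_group n)" and B: "B \<in> sets (borel :: complex measure)"
  shows "emeasure \<mu> {g \<in> space \<mu>. g $$ (0, 0) \<in> B \<and> schur_red n g \<in> A} =
    emeasure \<mu> {g \<in> space \<mu>. g $$ (0, 0) \<in> B} * emeasure \<mu> {g \<in> space \<mu>. schur_red n g \<in> A}"
proof -
  interpret prob_space \<mu> using haar_probabilityD[OF H] by simp
  note one = emeasure_space_1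
  interpret pair_prob_space \<mu> \<mu> ..
  note s = haar_probabilityD(2,3)[OF H]
  define U where "U = borel_unitary_group n"
  have mX [measurable]: "(\<lambda>g. g $$ (0, 0)) \<in> borel_measurable \<mu>"
    using measurable_unitary_group_entry[of 0 "Suc n" 0] measurable_cong_sets[OF s(2) refl] by auto
  have mS [measurable]: "schur_red n \<in> \<mu> \<rightarrow>\<^sub>M U"
    using measurable_schur_red s measurable_cong_sets unfolding U_def by blast
  have [measurable]: "A \<in> sets U" "B \<in> sets borel"
    using A B by (auto simp: U_def)
  have mP [measurable]: "(\<lambda>(g', g). mat_adjoint (schur_red n g') * schur_red n g) \<in> \<mu> \<Otimes>\<^sub>M \<mu> \<rightarrow>\<^sub>M U"
    unfolding U_def split_beta
    by (intro measurable_unitary_mult measurable_unitary_adjoint) (simp_all add: U_def[symmetric])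
  define c where "c = (\<integral>\<^sup>+g'. indicator A (mat_adjoint (schur_red n g')) \<partial>\<mu>)"
  \<comment> \<open>Multiplying \<open>g'\<close> by \<open>corner_embed n (mat_adjoint h)\<close>
    turns the adjoint of \<open>schur_red n g'\<close> into that adjoint times \<open>h\<close>, so
    by invariance the average over \<open>g'\<close> does not see \<open>h\<close>.\<close>
  have inner: "(\<integral>\<^sup>+g'. indicator A (mat_adjoint (schur_red n g') * h) \<partial>\<mu>) = c" if h: "h \<in> unitary_group n" for h
  proof -
    have h': "mat_adjoint h \<in> unitary_group n" using h by (rule unitary_group_adjoint)
    have "c = (\<integral>\<^sup>+g'. indicator A (mat_adjoint (schur_red n (corner_embed n (mat_adjoint h) * g'))) \<partial>\<mu>)"
      unfolding c_def
    proof (rule haar_nn_integral_left[OF H corner_embed_unitary[OF h'], symmetric])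
      have [measurable]: "(\<lambda>g. mat_adjoint (schur_red n g)) \<in> borel_unitary_group (Suc n) \<rightarrow>\<^sub>M U"
        unfolding U_def by (rule measurable_unitary_adjoint[OF measurable_schur_red])
      show "(\<lambda>g. indicator A (mat_adjoint (schur_red n g)) :: ennreal) \<in> borel_measurable (borel_unitary_group (Suc n))"
        by measurable
    qed
    also have "\<dots> = (\<integral>\<^sup>+g'. indicator A (mat_adjoint (schur_red n g') * h) \<partial>\<mu>)"
      using h h' by (intro nn_integral_cong)
        (simp add: s schur_red_corner_embed unitary_group_carrier mat_adjoint_mult)
    finally show ?thesis ..
  qed
  have key: "emeasure \<mu> {g \<in> space \<mu>. g $$ (0, 0) \<in> B' \<and> schur_red n g \<in> A} = emeasure \<mu> {g \<in> space \<mu>. g $$ (0, 0) \<in> B'} * c"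
    if [measurable]: "B' \<in> sets borel" for B' :: "complex set"
  proof -
    let ?f = "\<lambda>g. indicator B' (g $$ (0, 0)) * indicator A (schur_red n g) :: ennreal"
    have f: "?f \<in> borel_measurable (borel_unitary_group (Suc n))"
    proof -
      have "?f \<in> borel_measurable \<mu>" by measurable
      then show ?thesis using measurable_cong_sets[OF s(2) refl] by blast
    qed
    \<comment> \<open>For a fixed \<open>g'\<close>, invariance inserts \<open>k\<close> in front of
      \<open>schur_red n g\<close> and leaves the corner entry alone; afterwards \<open>g'\<close>
      may be averaged as well.\<close>
    have 1: "(\<integral>\<^sup>+g. ?f g \<partial>\<mu>) = (\<integral>\<^sup>+g. indicator B' (g $$ (0, 0)) * indicator A (mat_adjoint (schur_red n g') * schur_red n g) \<partial>\<mu>)"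
      if g': "g' \<in> space \<mu>" for g'
    proof -
      define k where "k = mat_adjoint (schur_red n g')"
      have k: "k \<in> unitary_group n"
        using g' s unfolding k_def by (intro unitary_group_adjoint schur_red_unitary) simp
      have "(\<integral>\<^sup>+g. ?f g \<partial>\<mu>) = (\<integral>\<^sup>+g. ?f (corner_embed n k * g) \<partial>\<mu>)"
        by (rule haar_nn_integral_left[OF H corner_embed_unitary[OF k] f, symmetric])
      also have "\<dots> = (\<integral>\<^sup>+g. indicator B' (g $$ (0, 0)) * indicator A (k * schur_red n g) \<partial>\<mu>)"
        using k by (intro nn_integral_cong)
          (simp add: s schur_red_corner_embed unitary_group_carrier corner_embed_mult_index)
      finally show ?thesis by (simp add: k_def)
    qed
    have "emeasure \<mu> {g \<in> space \<mu>. g $$ (0, 0) \<in> B' \<and> schur_red n g \<in> A}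
        = (\<integral>\<^sup>+g. indicator {g \<in> space \<mu>. g $$ (0, 0) \<in> B' \<and> schur_red n g \<in> A} g \<partial>\<mu>)"
      by (intro nn_integral_indicator[symmetric]) measurable
    also have "\<dots> = (\<integral>\<^sup>+g. ?f g \<partial>\<mu>)"
      by (intro nn_integral_cong) (auto simp: indicator_def)
    also have "\<dots> = (\<integral>\<^sup>+g'. (\<integral>\<^sup>+g. ?f g \<partial>\<mu>) \<partial>\<mu>)"
      by (simp only: nn_integral_const one mult_1_right)
    also have "\<dots> = (\<integral>\<^sup>+g'. (\<integral>\<^sup>+g. indicator B' (g $$ (0, 0)) * indicator A (mat_adjoint (schur_red n g') * schur_red n g) \<partial>\<mu>) \<partial>\<mu>)"
      by (intro nn_integral_cong 1)
    also have "\<dots> = (\<integral>\<^sup>+g. (\<integral>\<^sup>+g'. indicator B' (g $$ (0, 0)) * indicator A (mat_adjoint (schur_red n g') * schur_red n g) \<partial>\<mu>) \<partial>\<mu>)"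
      by (intro Fubini') measurable
    also have "\<dots> = (\<integral>\<^sup>+g. indicator B' (g $$ (0, 0)) * c \<partial>\<mu>)"
    proof (intro nn_integral_cong)
      fix g assume g: "g \<in> space \<mu>"
      have "(\<lambda>g'. indicator A (mat_adjoint (schur_red n g') * schur_red n g) :: ennreal) \<in> borel_measurable \<mu>"
        using measurable_compose[OF measurable_Pair2'[OF g, of \<mu>] mP] by (simp add: split_beta)
      then show "(\<integral>\<^sup>+g'. indicator B' (g $$ (0, 0)) * indicator A (mat_adjoint (schur_red n g') * schur_red n g) \<partial>\<mu>) = indicator B' (g $$ (0, 0)) * c"
        using g s by (simp add: nn_integral_cmult inner schur_red_unitary)
    qed
    also have "\<dots> = (\<integral>\<^sup>+g. indicator B' (g $$ (0, 0)) \<partial>\<mu>) * c"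
      by (rule nn_integral_multc) measurable
    also have "(\<integral>\<^sup>+g. indicator B' (g $$ (0, 0)) \<partial>\<mu>) = (\<integral>\<^sup>+g. indicator {g \<in> space \<mu>. g $$ (0, 0) \<in> B'} g \<partial>\<mu>)"
      by (intro nn_integral_cong) (auto simp: indicator_def)
    also have "\<dots> = emeasure \<mu> {g \<in> space \<mu>. g $$ (0, 0) \<in> B'}"
      by (intro nn_integral_indicator) measurable
    finally show ?thesis .
  qed
  from key[of UNIV] have "emeasure \<mu> {g \<in> space \<mu>. schur_red n g \<in> A} = c"
    by (simp add: one)
  with key[OF B] show ?thesis by simp
qed

lemma haar_measurable:
  assumes "haar_probability N \<mu>" "f \<in> borel_unitary_group N \<rightarrow>\<^sub>M M"
  shows "f \<in> \<mu> \<rightarrow>\<^sub>M M"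
  using assms measurable_cong_sets[OF haar_probabilityD(3)[OF assms(1)] refl] by blast

abbreviation corner_distr :: "complex mat measure \<Rightarrow> complex measure" where
  "corner_distr \<mu> \<equiv> distr \<mu> borel (\<lambda>g. g $$ (0, 0))"

lemma distr_corner_schur_red:
  assumes H: "haar_probability (Suc n) \<mu>"
  shows "distr \<mu> (borel \<Otimes>\<^sub>M borel_unitary_group n) (\<lambda>g. (g $$ (0, 0), schur_red n g)) =
    corner_distr \<mu> \<Otimes>\<^sub>M distr \<mu> (borel_unitary_group n) (schur_red n)"
proof (rule pair_measure_eqI[symmetric])
  interpret prob_space \<mu> using haar_probabilityD[OF H] by simp
  have mX [measurable]: "(\<lambda>g. g $$ (0, 0)) \<in> borel_measurable \<mu>"
    by (rule haar_measurable[OF H measurable_unitary_group_entry]) simp_all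
  have mS [measurable]: "schur_red n \<in> \<mu> \<rightarrow>\<^sub>M borel_unitary_group n"
    by (rule haar_measurable[OF H measurable_schur_red])
  show "sigma_finite_measure (corner_distr \<mu>)"
    "sigma_finite_measure (distr \<mu> (borel_unitary_group n) (schur_red n))"
    by (intro finite_measure.axioms(1) prob_space.finite_measure prob_space_distr mX mS)+
  fix B A assume "B \<in> sets (corner_distr \<mu>)" "A \<in> sets (distr \<mu> (borel_unitary_group n) (schur_red n))"
  then have B [measurable]: "B \<in> sets borel" and A [measurable]: "A \<in> sets (borel_unitary_group n)"
    by simp_all
  show "emeasure (corner_distr \<mu>) B * emeasure (distr \<mu> (borel_unitary_group n) (schur_red n)) A =
    emeasure (distr \<mu> (borel \<Otimes>\<^sub>M borel_unitary_group n) (\<lambda>g. (g $$ (0, 0), schur_red n g))) (B \<times> A)"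
    using emeasure_corner_schur_red[OF H A B]
    by (simp add: emeasure_distr vimage_def Int_def conj_commute conj_left_commute)
qed simp

theorem distr_det_one_minus:
  assumes "haar_probability N \<mu>"
  shows "\<exists>\<nu>. (\<forall>k. prob_space (\<nu> k) \<and> sets (\<nu> k) = sets (borel :: complex measure)) \<and>
    (\<forall>k\<in>{1..N}. \<exists>\<mu>'. haar_probability k \<mu>' \<and> \<nu> k = corner_distr \<mu>') \<and>
    distr \<mu> borel (\<lambda>g. Determinant.det (1\<^sub>m N - g)) = distr (Pi\<^sub>M {1..N} \<nu>) borel (\<lambda>a. \<Prod>k\<in>{1..N}. 1 - a k)"
  using assms
proof (induction N arbitrary: \<mu>)
  case 0
  interpret prob_space \<mu> using haar_probabilityD[OF 0] by simp
  \<comment> \<open>The family is indexed by all naturals and must consist of probability measures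
    throughout; a point mass serves as filler.\<close>
  define \<nu> :: "nat \<Rightarrow> complex measure" where "\<nu> = (\<lambda>_. return borel 0)"
  have \<nu>: "prob_space (\<nu> k)" "sets (\<nu> k) = sets borel" for k
    by (simp_all add: \<nu>_def prob_space_return)
  interpret P: prob_space "Pi\<^sub>M {1..0::nat} \<nu>"
    by (rule prob_space_PiM) (rule \<nu>)
  have "distr \<mu> borel (\<lambda>g. Determinant.det (1\<^sub>m 0 - g)) = return borel (1 :: complex)"
    using haar_probabilityD[OF 0]
    by (subst distr_cong[of \<mu> \<mu> borel borel _ "\<lambda>_. 1"]) (auto simp: Determinant.det_def)
  also have "\<dots> = distr (Pi\<^sub>M {1..0} \<nu>) borel (\<lambda>a. \<Prod>k\<in>{1..0::nat}. 1 - a k)"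
    by (simp add: P.distr_const[of 1 borel, simplified])
  finally show ?case
    using \<nu> by (intro exI[of _ \<nu>]) auto
next
  case (Suc n)
  note H = Suc.prems
  note One_nat_def [simp del]
  interpret prob_space \<mu> using haar_probabilityD[OF H] by simp
  define X where "X = (\<lambda>g :: complex mat. g $$ (0, 0))"
  define U where "U = borel_unitary_group n"
  define D where "D = (\<lambda>h :: complex mat. Determinant.det (1\<^sub>m n - h))"
  have mX [measurable]: "X \<in> borel_measurable \<mu>"
    unfolding X_def by (rule haar_measurable[OF H measurable_unitary_group_entry]) simp_all
  have mS [measurable]: "schur_red n \<in> \<mu> \<rightarrow>\<^sub>M U"
    unfolding U_def by (rule haar_measurable[OF H measurable_schur_red])
  have mD [measurable]: "D \<in> borel_measurable U"
    unfolding D_def U_def by (rule measurable_det_one_minus)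
  define \<mu>' where "\<mu>' = distr \<mu> U (schur_red n)"
  have mD' [measurable]: "D \<in> borel_measurable \<mu>'"
    by (simp add: \<mu>'_def)
  interpret \<mu>': prob_space \<mu>'
    unfolding \<mu>'_def by (rule prob_space_distr[OF mS])
  from Suc.IH[OF haar_schur_red[OF H]] obtain \<nu>' where
    N: "(\<forall>k. prob_space (\<nu>' k) \<and> sets (\<nu>' k) = sets borel) \<and>
      (\<forall>k\<in>{1..n}. \<exists>\<mu>'. haar_probability k \<mu>' \<and> \<nu>' k = corner_distr \<mu>') \<and>
      distr \<mu>' borel D = distr (Pi\<^sub>M {1..n} \<nu>') borel (\<lambda>a. \<Prod>k\<in>{1..n}. 1 - a k)"
    unfolding U_def[symmetric] D_def[symmetric] \<mu>'_def[symmetric] ..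
  have \<nu>': "prob_space (\<nu>' k)" "sets (\<nu>' k) = sets borel"
      "k \<in> {1..n} \<Longrightarrow> \<exists>\<mu>'. haar_probability k \<mu>' \<and> \<nu>' k = corner_distr \<mu>'"
      "distr \<mu>' borel D = distr (Pi\<^sub>M {1..n} \<nu>') borel (\<lambda>a. \<Prod>k\<in>{1..n}. 1 - a k)" for k
    using N by blast+
  define \<nu>s where "\<nu>s = distr \<mu> borel X"
  interpret \<nu>s: prob_space \<nu>s
    unfolding \<nu>s_def by (rule prob_space_distr[OF mX])
  have [simp, measurable_cong]: "sets \<nu>s = sets borel" by (simp add: \<nu>s_def)
  have [measurable_cong]: "sets \<mu>' = sets U" by (simp add: \<mu>'_def)
  define \<nu> where "\<nu> = \<nu>'(Suc n := \<nu>s)"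
  have \<nu>: "prob_space (\<nu> k)" "sets (\<nu> k) = sets borel" for k
    using \<nu>' \<nu>s.prob_space_axioms by (auto simp: \<nu>_def)
  have PiM_eq: "Pi\<^sub>M {1..n} \<nu>' = Pi\<^sub>M {1..n} \<nu>"
    by (rule PiM_cong) (auto simp: \<nu>_def)
  define Q where "Q = (\<lambda>m (a :: nat \<Rightarrow> complex). \<Prod>k\<in>{1..m}. 1 - a k)"
  have comp: "(\<lambda>a. a k) \<in> borel_measurable (Pi\<^sub>M I \<nu>)" if "k \<in> I" for k I
    using measurable_component_singleton[OF that, of \<nu>] measurable_cong_sets[OF refl \<nu>(2)] by blast
  have mQ [measurable]: "Q m \<in> borel_measurable (Pi\<^sub>M {1..m} \<nu>)" for m
    unfolding Q_def by (intro borel_measurable_prod borel_measurable_diff comp) auto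
  interpret P: prob_space "Pi\<^sub>M {1..n} \<nu>"
    by (rule prob_space_PiM) (rule \<nu>)
  have ins: "insert (Suc n) {1..n} = {1..Suc n}" by auto
  have "distr \<mu> borel (\<lambda>g. Determinant.det (1\<^sub>m (Suc n) - g)) = distr \<mu> borel (\<lambda>g. (1 - X g) * D (schur_red n g))"
    using haar_probabilityD(2)[OF H]
    by (intro distr_cong) (auto simp: X_def D_def det_one_minus_schur_red)
  also have "\<dots> = distr (distr \<mu> (borel \<Otimes>\<^sub>M U) (\<lambda>g. (X g, schur_red n g))) borel (\<lambda>(x, h). (1 - x) * D h)"
    by (simp add: distr_distr comp_def)
  also have "\<dots> = distr (\<nu>s \<Otimes>\<^sub>M \<mu>') borel (\<lambda>(x, h). (1 - x) * D h)"
    unfolding X_def U_def distr_corner_schur_red[OF H] by (simp add: \<nu>s_def X_def U_def \<mu>'_def)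
  \<comment> \<open>The induction hypothesis knows only the law of the smaller determinant under
    \<open>\<mu>'\<close>, so the joint law is pushed to the pair (corner entry, determinant) before
    that law is replaced.\<close>
  also have "\<dots> = distr (distr (\<nu>s \<Otimes>\<^sub>M \<mu>') (borel \<Otimes>\<^sub>M borel) (\<lambda>(x, h). (x, D h))) borel (\<lambda>(x, d). (1 - x) * d)"
    by (subst distr_distr) (auto simp: comp_def split_beta')
  also have "distr (\<nu>s \<Otimes>\<^sub>M \<mu>') (borel \<Otimes>\<^sub>M borel) (\<lambda>(x, h). (x, D h)) = distr \<nu>s borel (\<lambda>x. x) \<Otimes>\<^sub>M distr \<mu>' borel D"
    by (rule pair_measure_distr[symmetric])
       (auto intro!: finite_measure.axioms(1) prob_space.finite_measure \<mu>'.prob_space_distr)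
  also have "\<dots> = distr \<nu>s borel (\<lambda>x. x) \<Otimes>\<^sub>M distr (Pi\<^sub>M {1..n} \<nu>) borel (Q n)"
    by (simp only: \<nu>'(4) PiM_eq Q_def)
  also have "\<dots> = distr (\<nu>s \<Otimes>\<^sub>M Pi\<^sub>M {1..n} \<nu>) (borel \<Otimes>\<^sub>M borel) (\<lambda>(x, a). (x, Q n a))"
    by (rule pair_measure_distr[OF _ mQ finite_measure.axioms(1)[OF prob_space.finite_measure[OF P.prob_space_distr[OF mQ]]]]) simp
  also have "distr \<dots> borel (\<lambda>(x, d). (1 - x) * d) = distr (\<nu>s \<Otimes>\<^sub>M Pi\<^sub>M {1..n} \<nu>) borel (\<lambda>(x, a). (1 - x) * Q n a)"
    by (subst distr_distr) (auto simp: comp_def split_beta')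
  also have "\<dots> = distr (\<nu> (Suc n) \<Otimes>\<^sub>M Pi\<^sub>M {1..n} \<nu>) borel (Q (Suc n) \<circ> (\<lambda>(x, a). a(Suc n := x)))"
  proof (intro distr_cong)
    show "\<nu>s \<Otimes>\<^sub>M Pi\<^sub>M {1..n} \<nu> = \<nu> (Suc n) \<Otimes>\<^sub>M Pi\<^sub>M {1..n} \<nu>"
      by (simp add: \<nu>_def)
  qed (auto simp: Q_def intro!: prod.cong)
  also have "\<dots> = distr (distr (\<nu> (Suc n) \<Otimes>\<^sub>M Pi\<^sub>M {1..n} \<nu>) (Pi\<^sub>M {1..Suc n} \<nu>) (\<lambda>(x, a). a(Suc n := x))) borel (Q (Suc n))"
  proof (rule distr_distr[OF mQ, symmetric])
    have "(\<lambda>p. (case (case p of (x, a) \<Rightarrow> (a, x)) of (a, x) \<Rightarrow> a(Suc n := x)))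
        \<in> \<nu> (Suc n) \<Otimes>\<^sub>M Pi\<^sub>M {1..n} \<nu> \<rightarrow>\<^sub>M Pi\<^sub>M (insert (Suc n) {1..n}) \<nu>"
      by (rule measurable_compose[OF measurable_pair_swap' measurable_add_dim])
    then show "(\<lambda>(x, a). a(Suc n := x)) \<in> \<nu> (Suc n) \<Otimes>\<^sub>M Pi\<^sub>M {1..n} \<nu> \<rightarrow>\<^sub>M Pi\<^sub>M {1..Suc n} \<nu>"
      by (simp add: split_beta' ins)
  qed
  also have "\<dots> = distr (Pi\<^sub>M {1..Suc n} \<nu>) borel (Q (Suc n))"
    using distr_pair_PiM_eq_PiM[of "{1..n}" \<nu> "Suc n"] \<nu>(1) by (simp only: ins)
  finally have "distr \<mu> borel (\<lambda>g. Determinant.det (1\<^sub>m (Suc n) - g)) = distr (Pi\<^sub>M {1..Suc n} \<nu>) borel (Q (Suc n))" .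
  moreover have "\<exists>\<mu>'. haar_probability k \<mu>' \<and> \<nu> k = corner_distr \<mu>'" if "k \<in> {1..Suc n}" for k
    using that H \<nu>'(3)[of k] by (cases "k = Suc n") (auto simp: \<nu>_def \<nu>s_def X_def)
  ultimately show ?case
    using \<nu> unfolding Q_def by (intro exI[of _ \<nu>]) blast
qed

section \<open>The law of the corner entry\<close>

definition diag_phase :: "nat \<Rightarrow> nat \<Rightarrow> complex \<Rightarrow> complex mat" where
  "diag_phase N i c = Matrix.mat N N (\<lambda>(a, b). if a = b then (if a = i then c else 1) else 0)"

lemma diag_phase_mult_index:
  assumes "g \<in> carrier_mat N N" "a < N" "b < N"
  shows "(diag_phase N i c * g) $$ (a, b) = (if a = i then c else 1) * g $$ (a, b)"
proof -
  have "(diag_phase N i c * g) $$ (a, b) = (\<Sum>l<N. diag_phase N i c $$ (a, l) * g $$ (l, b))"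
    using assms by (simp add: scalar_prod_def atLeast0LessThan diag_phase_def)
  also have "\<dots> = (\<Sum>l<N. (if a = l then (if a = i then c else 1) * g $$ (l, b) else 0))"
    using assms by (intro sum.cong) (auto simp: diag_phase_def)
  finally show ?thesis
    using assms by simp
qed

lemma diag_phase_unitary:
  assumes "cmod c = 1"
  shows "diag_phase N i c \<in> unitary_group N"
proof -
  have c: "c * cnj c = 1"
    using assms complex_norm_square[of c] by simp
  have "(\<Sum>j<N. diag_phase N i c $$ (a, j) * cnj (diag_phase N i c $$ (l, j)))
    = (\<Sum>j<N. if a = j then (if a = l then 1 else 0) else 0)" if "a < N" "l < N" for a l
    using that c by (intro sum.cong) (auto simp: diag_phase_def)
  then show ?thesis
    unfolding unitary_group_rows_iff by (simp add: diag_phase_def)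
qed

text \<open>A rotation of the coordinates 0 and \<open>i\<close>, provided \<open>0 < i\<close>: for
  \<open>i = 0\<close> the two deltas of a row coincide. Rows are sums of deltas so that
  \<open>sum_delta2\<close> evaluates them.\<close>

definition plane_rot :: "nat \<Rightarrow> nat \<Rightarrow> real \<Rightarrow> real \<Rightarrow> complex mat" where
  "plane_rot N i c s = Matrix.mat N N (\<lambda>(a, b).
     if a = 0 then (if b = 0 then c else 0) + (if b = i then - s else 0)
     else if a = i then (if b = 0 then s else 0) + (if b = i then c else 0)
     else if a = b then 1 else 0)"

lemma sum_delta2:
  fixes f :: "nat \<Rightarrow> complex"
  assumes "p < N" "q < N"
  shows "(\<Sum>l<N. ((if l = p then x else 0) + (if l = q then y else 0)) * f l) = x * f p + y * f q"
proof -
  have "(\<Sum>l<N. ((if l = p then x else 0) + (if l = q then y else 0)) * f l) =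
    (\<Sum>l<N. (if l = p then x * f l else 0) + (if l = q then y * f l else 0))"
    by (intro sum.cong) (auto simp: algebra_simps)
  then show ?thesis
    using assms by (simp add: sum.distrib)
qed

lemma plane_rot_row_sum:
  fixes f :: "nat \<Rightarrow> complex"
  assumes "a < N" "i < N"
  shows "(\<Sum>l<N. plane_rot N i c s $$ (a, l) * f l) =
    (if a = 0 then c * f 0 - s * f i else if a = i then s * f 0 + c * f i else f a)"
proof -
  consider "a = 0" | "a = i" "a \<noteq> 0" | "a \<noteq> 0" "a \<noteq> i" by blast
  then show ?thesis
  proof cases
    case 1
    have "(\<Sum>l<N. plane_rot N i c s $$ (a, l) * f l) =
      (\<Sum>l<N. ((if l = 0 then complex_of_real c else 0) + (if l = i then - complex_of_real s else 0)) * f l)"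
      using 1 assms by (intro sum.cong) (auto simp: plane_rot_def)
    also have "\<dots> = c * f 0 + (- complex_of_real s) * f i"
      using assms by (intro sum_delta2) auto
    finally show ?thesis using 1 by simp
  next
    case 2
    have "(\<Sum>l<N. plane_rot N i c s $$ (a, l) * f l) =
      (\<Sum>l<N. ((if l = 0 then complex_of_real s else 0) + (if l = i then complex_of_real c else 0)) * f l)"
      using 2 assms by (intro sum.cong) (auto simp: plane_rot_def)
    also have "\<dots> = s * f 0 + c * f i"
      using assms by (intro sum_delta2) auto
    finally show ?thesis using 2 by simp
  next
    case 3
    have "(\<Sum>l<N. plane_rot N i c s $$ (a, l) * f l) = (\<Sum>l<N. if a = l then f l else 0)"
      using 3 assms by (intro sum.cong) (auto simp: plane_rot_def)
    then show ?thesis using 3 assms by simp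
  qed
qed

lemma plane_rot_unitary:
  assumes "c\<^sup>2 + s\<^sup>2 = 1" "0 < i" "i < N"
  shows "plane_rot N i c s \<in> unitary_group N"
  unfolding unitary_group_rows_iff
proof (intro conjI allI impI)
  fix a l assume al: "a < N" "l < N"
  have "complex_of_real c * c + complex_of_real s * s = complex_of_real (c\<^sup>2 + s\<^sup>2)"
    by (simp add: power2_eq_square)
  then have 1: "complex_of_real c * c + complex_of_real s * s = 1"
    using assms(1) by simp
  then have 2: "complex_of_real s * s + complex_of_real c * c = 1"
    by (simp add: add.commute)
  show "(\<Sum>j<N. plane_rot N i c s $$ (a, j) * cnj (plane_rot N i c s $$ (l, j))) = (if a = l then 1 else 0)"
    using al assms(2,3) 1 2 by (subst plane_rot_row_sum) (auto simp: plane_rot_def)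
qed (simp add: plane_rot_def)

lemma plane_rot_mult_index:
  assumes "g \<in> carrier_mat N N" "a < N" "b < N" "i < N"
  shows "(plane_rot N i c s * g) $$ (a, b) = (if a = 0 then c * g $$ (0, b) - s * g $$ (i, b)
    else if a = i then s * g $$ (0, b) + c * g $$ (i, b) else g $$ (a, b))"
proof -
  have "(plane_rot N i c s * g) $$ (a, b) = (\<Sum>l<N. plane_rot N i c s $$ (a, l) * g $$ (l, b))"
    using assms by (simp add: scalar_prod_def atLeast0LessThan plane_rot_def)
  then show ?thesis
    using plane_rot_row_sum[OF assms(2,4), of c s "\<lambda>l. g $$ (l, b)"] by simp
qed

section \<open>Moments of the corner entry from invariance under rotations\<close>

definition bounded_random_poly :: "'a measure \<Rightarrow> ('a \<Rightarrow> complex poly) \<Rightarrow> bool" where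
  "bounded_random_poly M p \<longleftrightarrow> (\<forall>n. (\<lambda>x. coeff (p x) n) \<in> borel_measurable M \<and>
     (\<exists>C. \<forall>x\<in>space M. cmod (coeff (p x) n) \<le> C)) \<and> (\<exists>d. \<forall>x\<in>space M. degree (p x) \<le> d)"

lemma bounded_random_poly_mult:
  assumes "bounded_random_poly M p" "bounded_random_poly M q"
  shows "bounded_random_poly M (\<lambda>x. p x * q x)"
  unfolding bounded_random_poly_def
proof (intro conjI allI)
  fix n
  show "(\<lambda>x. coeff (p x * q x) n) \<in> borel_measurable M"
    using assms unfolding coeff_mult bounded_random_poly_def
    by (intro borel_measurable_sum borel_measurable_times) auto
  from assms obtain C D where C: "\<And>n x. x \<in> space M \<Longrightarrow> cmod (coeff (p x) n) \<le> C n"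
    and D: "\<And>n x. x \<in> space M \<Longrightarrow> cmod (coeff (q x) n) \<le> D n"
    unfolding bounded_random_poly_def by metis
  have "cmod (coeff (p x * q x) n) \<le> (\<Sum>i\<le>n. C i * D (n - i))" if "x \<in> space M" for x
    unfolding coeff_mult
    by (rule order_trans[OF norm_sum sum_mono]) 
       (auto simp: norm_mult intro!: mult_mono C D that order_trans[OF norm_ge_zero C[OF that]])
  then show "\<exists>C. \<forall>x\<in>space M. cmod (coeff (p x * q x) n) \<le> C" by blast
next
  from assms obtain d e where "\<forall>x\<in>space M. degree (p x) \<le> d" "\<forall>x\<in>space M. degree (q x) \<le> e"
    unfolding bounded_random_poly_def by blast
  then have "\<forall>x\<in>space M. degree (p x * q x) \<le> d + e"
    by (meson add_mono degree_mult_le order_trans)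
  then show "\<exists>d. \<forall>x\<in>space M. degree (p x * q x) \<le> d" by blast
qed

lemma bounded_random_poly_power:
  assumes "bounded_random_poly M p"
  shows "bounded_random_poly M (\<lambda>x. p x ^ n)"
proof (induction n)
  case 0
  show ?case
    by (auto simp: bounded_random_poly_def intro!: exI[of _ 1])
next
  case (Suc n)
  then show ?case using bounded_random_poly_mult[OF assms] by simp
qed

lemma bounded_random_poly_linear:
  assumes "a \<in> borel_measurable M" "b \<in> borel_measurable M"
    and "\<And>x. x \<in> space M \<Longrightarrow> cmod (a x) \<le> 1" "\<And>x. x \<in> space M \<Longrightarrow> cmod (b x) \<le> 1"
  shows "bounded_random_poly M (\<lambda>x. [:a x, b x:])"
proof -
  have "(\<lambda>x. coeff [:a x, b x:] n) \<in> borel_measurable M \<and> (\<exists>C. \<forall>x\<in>space M. cmod (coeff [:a x, b x:] n) \<le> C)" for n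
    using assms by (cases n; cases "n - 1") (auto simp: coeff_pCons split: nat.splits intro!: exI[of _ 1])
  then show ?thesis
    unfolding bounded_random_poly_def by (auto intro!: exI[of _ 1])
qed

text \<open>Uniform bounds on degree and coefficients allow integration coefficient by coefficient.
  The resulting polynomial \<open>R\<close> vanishes at every real number, hence is zero.\<close>

lemma integral_coeff_eq_0:
  assumes "finite_measure M" and p: "bounded_random_poly M p"
    and 0: "\<And>s::real. (\<integral>x. poly (p x) (of_real s) \<partial>M) = 0"
  shows "(\<integral>x. coeff (p x) n \<partial>M) = 0"
proof -
  interpret finite_measure M by fact
  have int: "integrable M (\<lambda>x. coeff (p x) i)" for i
    using p unfolding bounded_random_poly_def by (metis (mono_tags, lifting) AE_I2 integrable_const_bound)
  from p obtain d where d: "\<And>x. x \<in> space M \<Longrightarrow> degree (p x) \<le> d"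
    unfolding bounded_random_poly_def by blast
  define R where "R = (\<Sum>i\<le>d. Polynomial.monom (\<integral>x. coeff (p x) i \<partial>M) i)"
  have "poly R (of_real s) = 0" for s :: real
  proof -
    have "poly (p x) (of_real s) = (\<Sum>i\<le>d. coeff (p x) i * of_real s ^ i)" if "x \<in> space M" for x
    proof -
      have "poly (p x) (of_real s) = (\<Sum>i\<le>degree (p x). coeff (p x) i * of_real s ^ i)"
        by (rule poly_altdef)
      also have "\<dots> = (\<Sum>i\<le>d. coeff (p x) i * of_real s ^ i)"
        using d[OF that] by (intro sum.mono_neutral_left) (auto intro: coeff_eq_0)
      finally show ?thesis .
    qed
    then have "(\<integral>x. poly (p x) (of_real s) \<partial>M) = (\<integral>x. (\<Sum>i\<le>d. coeff (p x) i * of_real s ^ i) \<partial>M)"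
      by (intro Bochner_Integration.integral_cong) auto
    also have "\<dots> = (\<Sum>i\<le>d. (\<integral>x. coeff (p x) i \<partial>M) * of_real s ^ i)"
      using int by (subst Bochner_Integration.integral_sum) auto
    finally show ?thesis
      using 0[of s] by (simp add: R_def poly_sum poly_monom)
  qed
  then have "range complex_of_real \<subseteq> {z. poly R z = 0}" by auto
  then have "infinite {z. poly R z = 0}"
    using infinite_UNIV_char_0[where 'a = real] by (metis finite_imageD finite_subset inj_of_real)
  then have "R = 0"
    using poly_roots_finite by blast
  then have "coeff R n = 0" by simp
  then show ?thesis
  proof (cases "n \<le> d")
    case True
    then show ?thesis using \<open>coeff R n = 0\<close>
      by (simp add: R_def coeff_sum if_distrib sum.delta cong: if_cong)
  next
    case False
    then have "(\<integral>x. coeff (p x) n \<partial>M) = (\<integral>x. 0 \<partial>M)"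
      using d by (intro Bochner_Integration.integral_cong) (auto intro!: coeff_eq_0 le_less_trans[OF d])
    then show ?thesis by simp
  qed
qed

lemma coeff_1_power: "coeff (p ^ m) 1 = of_nat m * coeff p 0 ^ (m - 1) * coeff p 1"
  for p :: "'a::comm_ring_1 poly"
proof (induction m)
  case (Suc m)
  then show ?case
    by (cases m) (auto simp: coeff_mult coeff_0_power algebra_simps)
qed simp

text \<open>With \<open>v\<close> the first column and \<open>F(v) = |v\<^sub>0|\<^sup>2\<^sup>m cnj(v\<^sub>0) v\<^sub>i\<close>, the expectation of
  \<open>F(v\<^sub>0 - s v\<^sub>i, v\<^sub>i + s v\<^sub>0)\<close> is a polynomial in \<open>s\<close> that vanishes identically, because rotating
  the phase of \<open>v\<^sub>i\<close> shows that \<open>F\<close> has mean zero; the claim is that its linear coefficient is zero.\<close>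

lemma haar_column_moment:
  assumes H: "haar_probability N \<mu>" and i: "0 < i" "i < N"
  shows "(\<integral>g. (cmod (g $$ (0, 0)))^(2 * Suc m) \<partial>\<mu>) =
    real (Suc m) * (\<integral>g. (cmod (g $$ (0, 0)))^(2 * m) * (cmod (g $$ (i, 0)))\<^sup>2 \<partial>\<mu>)"
proof -
  interpret prob_space \<mu> using haar_probabilityD[OF H] by simp
  define x where "x = (\<lambda>g :: complex mat. g $$ (0, 0))"
  define y where "y = (\<lambda>g :: complex mat. g $$ (i, 0))"
  have mB [measurable]: "x \<in> borel_measurable (borel_unitary_group N)" "y \<in> borel_measurable (borel_unitary_group N)"
    using i by (auto simp: x_def y_def intro: measurable_unitary_group_entry)
  have m [measurable]: "x \<in> borel_measurable \<mu>" "y \<in> borel_measurable \<mu>"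
    using mB by (auto intro: haar_measurable[OF H])
  have sp: "space \<mu> = unitary_group N" using haar_probabilityD[OF H] by simp
  have bd: "cmod (x g) \<le> 1" "cmod (y g) \<le> 1" if "g \<in> space \<mu>" for g
    using that i by (auto simp: x_def y_def sp intro!: unitary_group_entry_le)
  have mc: "(\<lambda>g. cnj (f g)) \<in> borel_measurable M" if "f \<in> borel_measurable M" for f :: "complex mat \<Rightarrow> complex" and M
    using measurable_compose[OF that, of cnj borel] by (simp add: borel_measurable_continuous_onI continuous_intros)
  note [measurable] = mc[OF m(1)] mc[OF m(2)] mc[OF mB(1)] mc[OF mB(2)]
  define F where "F = (\<lambda>g. x g ^ m * cnj (x g) ^ Suc m * y g)"
  have mF: "F \<in> borel_measurable (borel_unitary_group N)"
    unfolding F_def by measurable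
  have phase: "(\<integral>g. f (diag_phase N i c * g) \<partial>\<mu>) = (\<integral>g. f g \<partial>\<mu>)"
    if "cmod c = 1" "f \<in> borel_measurable (borel_unitary_group N)" for c and f :: "complex mat \<Rightarrow> complex"
    by (rule haar_integral_left[OF H diag_phase_unitary[OF that(1)] that(2)])
  have px: "x (diag_phase N i c * g) = x g" "y (diag_phase N i c * g) = c * y g" if "g \<in> space \<mu>" for g c
    using that i by (auto simp: x_def y_def sp diag_phase_mult_index unitary_group_carrier)
  \<comment> \<open>Changing the sign of row \<open>i\<close> changes the sign of
    \<open>F\<close>.\<close>
  have F0: "(\<integral>g. F g \<partial>\<mu>) = 0"
  proof -
    have "(\<integral>g. F g \<partial>\<mu>) = (\<integral>g. F (diag_phase N i (-1) * g) \<partial>\<mu>)"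
      using phase[OF _ mF, of "-1"] by simp
    also have "\<dots> = (\<integral>g. - F g \<partial>\<mu>)"
      by (intro Bochner_Integration.integral_cong) (auto simp: F_def px)
    finally show ?thesis by simp
  qed
  define p where "p = (\<lambda>g. [:x g, - y g:] ^ m * [:cnj (x g), - cnj (y g):] ^ Suc m * [:y g, x g:])"
  have bp: "bounded_random_poly \<mu> p"
    unfolding p_def
    by (intro bounded_random_poly_mult bounded_random_poly_power bounded_random_poly_linear)
       (auto intro: bd)
  have p0: "(\<integral>g. poly (p g) (of_real s) \<partial>\<mu>) = 0" for s :: real
  proof -
    \<comment> \<open>The rotation has cosine \<open>1 / r\<close> and sine \<open>s / r\<close>. As
      \<open>F\<close> is homogeneous of real degree \<open>2 * m + 2\<close>, a power of
      \<open>r\<close> splits off and a polynomial in \<open>s\<close> remains.\<close>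
    define r where "r = sqrt (1 + s\<^sup>2)"
    have s2: "0 < 1 + s\<^sup>2" by (simp add: add_pos_nonneg)
    have r: "r > 0" using s2 by (simp add: r_def)
    have r2: "r * r = 1 + s\<^sup>2" using s2 by (simp add: r_def)
    have "(1 / r)\<^sup>2 + (s / r)\<^sup>2 = 1"
      using r r2 s2 by (simp add: power2_eq_square flip: add_divide_distrib)
    from haar_integral_left[OF H plane_rot_unitary[OF this i] mF]
    have "(\<integral>g. F (plane_rot N i (1 / r) (s / r) * g) \<partial>\<mu>) = 0"
      using F0 by simp
    also have "(\<integral>g. F (plane_rot N i (1 / r) (s / r) * g) \<partial>\<mu>) = (\<integral>g. poly (p g) (of_real s) / of_real r ^ (2 * m + 2) \<partial>\<mu>)"
    proof (intro Bochner_Integration.integral_cong refl)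
      fix g assume g: "g \<in> space \<mu>"
      have "x (plane_rot N i (1 / r) (s / r) * g) = (x g - of_real s * y g) / of_real r"
        "y (plane_rot N i (1 / r) (s / r) * g) = (of_real s * x g + y g) / of_real r"
        using g i by (auto simp: x_def y_def sp plane_rot_mult_index unitary_group_carrier diff_divide_distrib add_divide_distrib)
      moreover have "poly (p g) (of_real s) = (x g - of_real s * y g) ^ m * cnj (x g - of_real s * y g) ^ Suc m * (of_real s * x g + y g)"
        by (simp add: p_def poly_power algebra_simps)
      moreover have "(A / t) ^ m * (C / t) ^ Suc m * (B / t) = A ^ m * C ^ Suc m * B / t ^ (2 * m + 2)" for A B C t :: complex
        by (simp add: power_divide power_add mult_2)
      ultimately show "F (plane_rot N i (1 / r) (s / r) * g) = poly (p g) (of_real s) / of_real r ^ (2 * m + 2)"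
        by (simp only: F_def complex_cnj_divide complex_cnj_complex_of_real)
    qed
    also have "\<dots> = (\<integral>g. poly (p g) (of_real s) \<partial>\<mu>) / of_real r ^ (2 * m + 2)"
      by (rule integral_divide_zero)
    finally show ?thesis using r by simp
  qed
  define a where "a = (\<lambda>g. (cmod (x g))^(2 * Suc m))"
  define b where "b = (\<lambda>g. (cmod (x g))^(2 * m) * (cmod (y g))\<^sup>2)"
  define c where "c = (\<lambda>g. x g ^ (m - 1) * cnj (x g) ^ Suc m * (y g)\<^sup>2)"
  \<comment> \<open>The term \<open>c\<close> comes from differentiating \<open>x ^ m\<close>; for
    \<open>m = 0\<close>, where \<open>m - 1\<close> is truncated, its factor
    \<open>of_nat m\<close> vanishes. It has mean zero, since multiplying row \<open>i\<close> by
    \<open>\<i>\<close> negates the square of \<open>y\<close>.\<close>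
  have co: "coeff (p g) 1 = of_real (a g) - of_nat (Suc m) * of_real (b g) - of_nat m * c g" for g
  proof -
    have n: "complex_of_real (cmod z ^ (2 * k)) = z ^ k * cnj z ^ k" for z k
      by (simp add: power_mult complex_norm_square[symmetric] power_mult_distrib[symmetric])
    have "coeff (p g) 1 = of_nat m * x g ^ (m - 1) * (- y g) * cnj (x g) ^ Suc m * y g
       + x g ^ m * (of_nat (Suc m) * cnj (x g) ^ m * (- cnj (y g))) * y g + x g ^ m * cnj (x g) ^ Suc m * x g"
    proof -
      have m1: "coeff (q * r) 1 = coeff q 0 * coeff r 1 + coeff q 1 * coeff r 0"
        and m0: "coeff (q * r) 0 = coeff q 0 * coeff r 0" for q r :: "complex poly"
        by (simp_all add: coeff_mult)
      have c: "coeff [:u, v:] 0 = u" "coeff [:u, v:] 1 = v" for u v :: complex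
        by simp_all
      show ?thesis
        unfolding p_def m1 m0 coeff_0_power coeff_1_power c diff_Suc_1
        by (simp only: ring_distribs mult_ac add_ac)
    qed
    then show ?thesis
      unfolding a_def b_def of_real_mult n[of _ "Suc m"] n[of _ m] complex_norm_square
      by (simp add: c_def algebra_simps power2_eq_square)
  qed
  have a01: "0 \<le> a g" "a g \<le> 1" if "g \<in> space \<mu>" for g
    unfolding a_def using bd[OF that] by (auto intro!: power_le_one simp del: mult_Suc_right)
  have b01: "0 \<le> b g" "b g \<le> 1" if "g \<in> space \<mu>" for g
    unfolding b_def using bd[OF that] by (auto intro!: mult_le_one power_le_one)
  have c01: "cmod (c g) \<le> 1" if "g \<in> space \<mu>" for g
    unfolding c_def norm_mult norm_power complex_mod_cnj
    using bd[OF that] by (auto intro!: mult_le_one power_le_one simp del: power_Suc)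
  have [measurable]: "a \<in> borel_measurable \<mu>" "b \<in> borel_measurable \<mu>" "c \<in> borel_measurable \<mu>"
    unfolding a_def b_def c_def by measurable
  have ia: "integrable \<mu> (\<lambda>g. complex_of_real (a g))"
    using a01 by (intro integrable_const_bound[of _ 1] AE_I2) auto
  have ib: "integrable \<mu> (\<lambda>g. complex_of_real (b g))"
    using b01 by (intro integrable_const_bound[of _ 1] AE_I2) auto
  have ic: "integrable \<mu> c"
    using c01 by (intro integrable_const_bound[of _ 1] AE_I2) auto
  have c0: "(\<integral>g. c g \<partial>\<mu>) = 0"
  proof -
    have mc: "c \<in> borel_measurable (borel_unitary_group N)"
      unfolding c_def by measurable
    have "(\<integral>g. c g \<partial>\<mu>) = (\<integral>g. c (diag_phase N i \<i> * g) \<partial>\<mu>)"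
      using phase[OF _ mc, of \<i>] by simp
    also have "\<dots> = (\<integral>g. - c g \<partial>\<mu>)"
      by (intro Bochner_Integration.integral_cong) (auto simp: c_def px power_mult_distrib)
    finally show ?thesis by simp
  qed
  have "0 = (\<integral>g. of_real (a g) - of_nat (Suc m) * of_real (b g) - of_nat m * c g \<partial>\<mu>)"
    using integral_coeff_eq_0[OF finite_measure_axioms bp p0, of 1] by (simp only: co)
  also have "\<dots> = of_real (\<integral>g. a g \<partial>\<mu>) - of_nat (Suc m) * of_real (\<integral>g. b g \<partial>\<mu>)"
    using ia ib ic c0 by (simp add: Bochner_Integration.integral_diff del: of_nat_Suc)
  also have "\<dots> = of_real ((\<integral>g. a g \<partial>\<mu>) - real (Suc m) * (\<integral>g. b g \<partial>\<mu>))"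
    by simp
  finally have "(\<integral>g. a g \<partial>\<mu>) - real (Suc m) * (\<integral>g. b g \<partial>\<mu>) = 0"
    by (metis of_real_eq_0_iff)
  then show ?thesis
    by (simp add: a_def b_def x_def y_def)
qed

text \<open>Insert \<open>1 = sum of |v_i|^2\<close> over the first column: the term
  \<open>i = 0\<close> is the next moment, and by \<open>haar_column_moment\<close> each of the
  \<open>N - 1\<close> others is that moment divided by \<open>m + 1\<close>.\<close>

lemma haar_corner_moment:
  assumes H: "haar_probability N \<mu>" and N: "0 < N"
  shows "real (m + N) * (\<integral>g. (cmod (g $$ (0, 0)))^(2 * Suc m) \<partial>\<mu>) =
    real (Suc m) * (\<integral>g. (cmod (g $$ (0, 0)))^(2 * m) \<partial>\<mu>)"
proof -
  interpret prob_space \<mu> using haar_probabilityD[OF H] by simp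
  have sp: "space \<mu> = unitary_group N" using haar_probabilityD[OF H] by simp
  have m [measurable]: "(\<lambda>g. g $$ (i, 0)) \<in> borel_measurable \<mu>" if "i < N" for i
    using that N by (auto intro!: haar_measurable[OF H] measurable_unitary_group_entry)
  have int: "integrable \<mu> (\<lambda>g. (cmod (g $$ (0, 0)))^(2 * m) * (cmod (g $$ (i, 0)))\<^sup>2)" if "i < N" for i
    using N that m[OF that] m[OF N] unitary_group_entry_le[of _ N _ 0]
    by (intro integrable_const_bound[of _ 1]) (auto simp: sp power_le_one mult_le_one)
  define E where "E = (\<integral>g. (cmod (g $$ (0, 0)))^(2 * Suc m) \<partial>\<mu>)"
  have "(\<integral>g. (cmod (g $$ (0, 0)))^(2 * m) \<partial>\<mu>) =
     (\<integral>g. (\<Sum>i<N. (cmod (g $$ (0, 0)))^(2 * m) * (cmod (g $$ (i, 0)))\<^sup>2) \<partial>\<mu>)"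
  proof (intro Bochner_Integration.integral_cong refl)
    fix g assume "g \<in> space \<mu>"
    then have "complex_of_real (\<Sum>l<N. (cmod (g $$ (l, 0)))\<^sup>2) = 1"
      using unitary_group_cols[of g N 0 0] N by (simp add: sp complex_norm_square del: of_real_power)
    then have "(\<Sum>l<N. (cmod (g $$ (l, 0)))\<^sup>2) = 1"
      using of_real_eq_1_iff by blast
    then show "(cmod (g $$ (0, 0)))^(2 * m) = (\<Sum>i<N. (cmod (g $$ (0, 0)))^(2 * m) * (cmod (g $$ (i, 0)))\<^sup>2)"
      by (simp flip: sum_distrib_left)
  qed
  also have "\<dots> = (\<Sum>i<N. (\<integral>g. (cmod (g $$ (0, 0)))^(2 * m) * (cmod (g $$ (i, 0)))\<^sup>2 \<partial>\<mu>))"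
    using int by (intro Bochner_Integration.integral_sum) auto
  also have "\<dots> = (\<Sum>i\<in>insert 0 {1..<N}. (\<integral>g. (cmod (g $$ (0, 0)))^(2 * m) * (cmod (g $$ (i, 0)))\<^sup>2 \<partial>\<mu>))"
    using N by (intro sum.cong) auto
  also have "\<dots> = E + (\<Sum>i\<in>{1..<N}. E / real (Suc m))"
  proof (subst sum.insert)
    show "(\<integral>g. (cmod (g $$ (0, 0)))^(2 * m) * (cmod (g $$ (0, 0)))\<^sup>2 \<partial>\<mu>)
        + (\<Sum>i\<in>{1..<N}. (\<integral>g. (cmod (g $$ (0, 0)))^(2 * m) * (cmod (g $$ (i, 0)))\<^sup>2 \<partial>\<mu>)) = E + (\<Sum>i\<in>{1..<N}. E / real (Suc m))"
    proof (intro arg_cong2[where f = "(+)"] sum.cong refl)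
      fix i assume "i \<in> {1..<N}"
      then show "(\<integral>g. (cmod (g $$ (0, 0)))^(2 * m) * (cmod (g $$ (i, 0)))\<^sup>2 \<partial>\<mu>) = E / real (Suc m)"
        using haar_column_moment[OF H, of i m] by (simp add: E_def del: of_nat_Suc mult_Suc_right)
    qed (simp add: E_def power2_eq_square mult_ac)
  qed auto
  also have "\<dots> = E + real (N - 1) * (E / real (Suc m))"
    by simp
  finally have "real (Suc m) * (\<integral>g. (cmod (g $$ (0, 0)))^(2 * m) \<partial>\<mu>) = real (m + N) * E"
    using N by (simp add: of_nat_diff field_simps)
  then show ?thesis
    by (simp only: E_def)
qed

lemma haar_corner_rotation:
  assumes H: "haar_probability N \<mu>" and N: "0 < N" and c: "cmod c = 1"
  shows "distr (corner_distr \<mu>) borel (\<lambda>z. c * z) = corner_distr \<mu>"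
proof -
  have sp: "space \<mu> = unitary_group N" using haar_probabilityD[OF H] by simp
  have m [measurable]: "(\<lambda>g. g $$ (0, 0)) \<in> borel_measurable \<mu>"
    using N by (auto intro!: haar_measurable[OF H] measurable_unitary_group_entry)
  note k = diag_phase_unitary[OF c, of N 0]
  have mk: "(\<lambda>g. diag_phase N 0 c * g) \<in> \<mu> \<rightarrow>\<^sub>M \<mu>"
    using measurable_unitary_left_mult[OF k] haar_probabilityD(3)[OF H] measurable_cong_sets by blast
  have "distr (corner_distr \<mu>) borel (\<lambda>z. c * z) = distr \<mu> borel (\<lambda>g. c * g $$ (0, 0))"
    by (subst distr_distr) (auto simp: comp_def)
  also have "\<dots> = distr \<mu> borel (\<lambda>g. (diag_phase N 0 c * g) $$ (0, 0))"
    using N by (intro distr_cong) (auto simp: sp diag_phase_mult_index unitary_group_carrier)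
  also have "\<dots> = distr (distr \<mu> \<mu> (\<lambda>g. diag_phase N 0 c * g)) borel (\<lambda>g. g $$ (0, 0))"
    by (simp add: distr_distr[OF m mk] comp_def)
  also have "distr \<mu> \<mu> (\<lambda>g. diag_phase N 0 c * g) = \<mu>"
    using H k by (simp add: haar_probability_iff_distr)
  finally show ?thesis .
qed

section \<open>Moments of the logarithm of a factor\<close>

text \<open>The recursion forces \<open>E |z|^(2m) = m! (k-1)! / (m+k-1)!\<close>, the Beta moments.
  The estimates for a single factor are derived from these properties, without a density.\<close>

locale corner_law = prob_space \<nu> for \<nu> :: "complex measure" and k :: nat +
  assumes sets_law [simp, measurable_cong]: "sets \<nu> = sets borel"
    and norm_le_1: "AE z in \<nu>. cmod z \<le> 1"
    and rotation: "cmod c = 1 \<Longrightarrow> distr \<nu> borel (\<lambda>z. c * z) = \<nu>"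
    and moment: "real (m + k) * (\<integral>z. cmod z ^ (2 * Suc m) \<partial>\<nu>) = real (Suc m) * (\<integral>z. cmod z ^ (2 * m) \<partial>\<nu>)"
begin

lemma space_law [simp]: "space \<nu> = UNIV"
  using sets_eq_imp_space_eq[OF sets_law] by simp

lemma integrable_continuous_law:
  fixes f :: "complex \<Rightarrow> 'b::{banach, second_countable_topology}"
  assumes "continuous_on UNIV f"
  shows "integrable \<nu> f"
proof -
  have "compact (f ` cball 0 1)"
    using assms by (intro compact_continuous_image continuous_on_subset[OF assms]) auto
  then obtain B where "\<And>z. cmod z \<le> 1 \<Longrightarrow> norm (f z) \<le> B"
    using bounded_iff compact_imp_bounded by (metis image_eqI mem_cball_0)
  moreover have "f \<in> borel_measurable \<nu>"
    using borel_measurable_continuous_onI[OF assms] by simp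
  ultimately show ?thesis
    using norm_le_1 by (intro integrable_const_bound[of _ B]) auto
qed

lemma integral_rotation:
  fixes f :: "complex \<Rightarrow> 'b::{banach, second_countable_topology}"
  assumes "cmod c = 1" and [measurable]: "f \<in> borel_measurable borel"
  shows "(\<integral>z. f (c * z) \<partial>\<nu>) = (\<integral>z. f z \<partial>\<nu>)"
proof -
  have "(\<integral>z. f z \<partial>\<nu>) = (\<integral>z. f z \<partial>distr \<nu> borel (\<lambda>z. c * z))"
    by (simp add: rotation[OF assms(1)])
  then show ?thesis
    by (simp add: integral_distr)
qed

lemma integral_power_eq_0:
  assumes "0 < m"
  shows "(\<integral>z. z ^ m \<partial>\<nu>) = 0"
proof -
  define c where "c = cis (pi / real m)"
  have c: "c ^ m = -1"
    using assms by (simp add: c_def Complex.DeMoivre)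
  have "(\<integral>z. z ^ m \<partial>\<nu>) = (\<integral>z. (c * z) ^ m \<partial>\<nu>)"
    by (rule integral_rotation[symmetric]) (simp_all add: c_def)
  also have "\<dots> = - (\<integral>z. z ^ m \<partial>\<nu>)"
    by (simp add: power_mult_distrib c)
  finally show ?thesis by simp
qed

text \<open>The law is symmetric under \<open>z -> -z\<close> and the two closed half planes cover
  everything. On this one \<open>|1 - z| >= 1\<close>, which keeps the first five factors away from
  zero.\<close>

lemma prob_Re_le_0: "prob {z. Re z \<le> 0} \<ge> 1 / 2"
proof -
  have [measurable]: "{z. Re z \<le> 0} \<in> sets borel" "{z. Re z \<ge> 0} \<in> sets borel"
    by measurable
  have "prob {z. Re z \<le> 0} = measure (distr \<nu> borel (\<lambda>z. -1 * z)) {z. Re z \<le> 0}"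
    by (subst rotation) auto
  also have "\<dots> = prob {z. Re z \<ge> 0}"
    by (subst measure_distr) (auto simp: vimage_def)
  finally have "prob {z. Re z \<le> 0} = prob {z. Re z \<ge> 0}" .
  moreover have "1 = prob ({z. Re z \<le> 0} \<union> {z. Re z \<ge> 0})"
    using prob_space by (simp add: Un_def linear)
  moreover have "prob ({z. Re z \<le> 0} \<union> {z. Re z \<ge> 0}) \<le> prob {z. Re z \<le> 0} + prob {z. Re z \<ge> 0}"
    by (rule measure_Un_le) auto
  ultimately show ?thesis by linarith
qed

lemma moment_le: "2 \<le> k \<Longrightarrow> (\<integral>z. cmod z ^ (2 * m) \<partial>\<nu>) \<le> 1 / (real m + 1)"
proof (induction m)
  case 0
  then show ?case by (simp add: prob_space)
next
  case (Suc m)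
  have "real (m + k) * (\<integral>z. cmod z ^ (2 * Suc m) \<partial>\<nu>) \<le> 1"
    using Suc unfolding moment by (simp add: field_simps)
  moreover have "real (Suc m + 1) * (\<integral>z. cmod z ^ (2 * Suc m) \<partial>\<nu>) \<le> real (m + k) * (\<integral>z. cmod z ^ (2 * Suc m) \<partial>\<nu>)"
    using Suc.prems by (intro mult_right_mono) auto
  ultimately show ?case by (simp add: field_simps)
qed

text \<open>The mass of the unit circle is below every even moment, and these tend to zero. For
  \<open>k = 1\<close> the law lives on the circle, hence the hypothesis.\<close>

lemma norm_less_1:
  assumes "2 \<le> k"
  shows "AE z in \<nu>. cmod z < 1"
proof -
  have [measurable]: "{z. cmod z = 1} \<in> sets borel" by measurable
  have "prob {z. cmod z = 1} \<le> 1 / (real m + 1)" for m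
  proof -
    have "prob {z. cmod z = 1} = (\<integral>z. indicator {z. cmod z = 1} z \<partial>\<nu>)"
      by simp
    also have "\<dots> \<le> (\<integral>z. cmod z ^ (2 * m) \<partial>\<nu>)"
    proof (rule integral_mono)
      show "integrable \<nu> (\<lambda>z. cmod z ^ (2 * m))"
        by (intro integrable_continuous_law continuous_intros)
      show "integrable \<nu> (indicator {z. cmod z = 1} :: complex \<Rightarrow> real)"
        by (intro integrable_const_bound[of _ 1]) auto
    qed (auto simp: indicator_def)
    finally show ?thesis using moment_le[OF assms, of m] by simp
  qed
  moreover have "(\<lambda>m. 1 / (real m + 1)) \<longlonglongrightarrow> 0"
    using LIMSEQ_inverse_real_of_nat by (simp add: inverse_eq_divide add.commute)
  ultimately have "prob {z. cmod z = 1} \<le> 0"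
    by (intro LIMSEQ_le_const[of _ 0]) auto
  then have "prob {z. cmod z = 1} = 0"
    by (simp add: measure_le_0_iff)
  then have "AE z in \<nu>. z \<notin> {z. cmod z = 1}"
    by (subst (asm) prob_eq_0) auto
  with norm_le_1 show ?thesis by eventually_elim auto
qed

text \<open>Integration by parts for the Beta distribution of \<open>\<bar>z\<bar>\<^sup>2\<close>, read off from the moments.\<close>

lemma integral_poly_pderiv:
  fixes p :: "real poly"
  shows "(real k - 1) * ((\<integral>z. poly p ((cmod z)\<^sup>2) \<partial>\<nu>) - poly p 0) =
    (\<integral>z. (1 - (cmod z)\<^sup>2) * poly (pderiv p) ((cmod z)\<^sup>2) \<partial>\<nu>)"
proof -
  have int: "integrable \<nu> (\<lambda>z. poly q ((cmod z)\<^sup>2))" "integrable \<nu> (\<lambda>z. (1 - (cmod z)\<^sup>2) * poly q ((cmod z)\<^sup>2))" for q :: "real poly"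
    by (intro integrable_continuous_law continuous_intros)+
  have "(real k - 1) * ((\<integral>z. poly (\<Sum>i\<in>A. Polynomial.monom (c i) i) ((cmod z)\<^sup>2) \<partial>\<nu>) - poly (\<Sum>i\<in>A. Polynomial.monom (c i) i) 0) =
    (\<integral>z. (1 - (cmod z)\<^sup>2) * poly (pderiv (\<Sum>i\<in>A. Polynomial.monom (c i) i)) ((cmod z)\<^sup>2) \<partial>\<nu>)"
    if "finite A" for A and c :: "nat \<Rightarrow> real"
    using that
  proof (induction A)
    case (insert i A)
    have "(real k - 1) * ((\<integral>z. poly (Polynomial.monom (c i) i) ((cmod z)\<^sup>2) \<partial>\<nu>) - poly (Polynomial.monom (c i) i) 0) =
      (\<integral>z. (1 - (cmod z)\<^sup>2) * poly (pderiv (Polynomial.monom (c i) i)) ((cmod z)\<^sup>2) \<partial>\<nu>)"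
    proof (cases i)
      case 0
      then show ?thesis using prob_space by (simp add: monom_0)
    next
      case (Suc m)
      define M where "M = (\<lambda>n. \<integral>z. cmod z ^ (2 * n) \<partial>\<nu>)"
      have i: "integrable \<nu> (\<lambda>z. cmod z ^ (2 * n))" for n
        by (intro integrable_continuous_law continuous_intros)
      have "(\<integral>z. (1 - (cmod z)\<^sup>2) * poly (pderiv (Polynomial.monom (c i) i)) ((cmod z)\<^sup>2) \<partial>\<nu>)
        = (\<integral>z. real (Suc m) * c i * cmod z ^ (2 * m) - real (Suc m) * c i * cmod z ^ (2 * Suc m) \<partial>\<nu>)"
        by (intro Bochner_Integration.integral_cong)
           (auto simp: Suc pderiv_monom poly_monom power_mult algebra_simps power2_eq_square)
      also have "\<dots> = real (Suc m) * c i * M m - real (Suc m) * c i * M (Suc m)"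
        using i[of m] i[of "Suc m"] unfolding M_def by (simp del: of_nat_Suc mult_Suc_right)
      also have "\<dots> = c i * (real (m + k) * M (Suc m)) - real (Suc m) * c i * M (Suc m)"
        unfolding M_def moment by simp
      also have "\<dots> = (real k - 1) * (c i * M (Suc m))"
        by (simp add: algebra_simps)
      also have "c i * M (Suc m) = (\<integral>z. poly (Polynomial.monom (c i) i) ((cmod z)\<^sup>2) \<partial>\<nu>)"
        by (simp add: M_def Suc poly_monom power_mult)
      finally show ?thesis by (simp add: Suc poly_monom)
    qed
    moreover have "(\<integral>z. poly (p + q) ((cmod z)\<^sup>2) \<partial>\<nu>) = (\<integral>z. poly p ((cmod z)\<^sup>2) \<partial>\<nu>) + (\<integral>z. poly q ((cmod z)\<^sup>2) \<partial>\<nu>)"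
      "(\<integral>z. (1 - (cmod z)\<^sup>2) * poly (pderiv (p + q)) ((cmod z)\<^sup>2) \<partial>\<nu>) =
       (\<integral>z. (1 - (cmod z)\<^sup>2) * poly (pderiv p) ((cmod z)\<^sup>2) \<partial>\<nu>) + (\<integral>z. (1 - (cmod z)\<^sup>2) * poly (pderiv q) ((cmod z)\<^sup>2) \<partial>\<nu>)"
      "poly (p + q) 0 = poly p 0 + poly q 0" for p q :: "real poly"
      using int by (simp_all add: pderiv_add distrib_left)
    ultimately show ?case
      using insert.IH unfolding sum.insert[OF insert.hyps] by (simp only: right_diff_distrib distrib_left)
  qed (simp add: prob_space)
  from this[of "{..degree p}" "coeff p"] show ?thesis
    by (simp add: poly_as_sum_of_monoms)
qed

text \<open>Truncations of \<open>1 / (1 - u)\<close>: polynomials, so that their expectations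
  are controlled by the moments alone.\<close>

definition geo :: "nat \<Rightarrow> real poly" where
  "geo n = (\<Sum>i<n. Polynomial.monom 1 i)"

lemma poly_geo: "poly (geo n) u = (\<Sum>i<n. u ^ i)"
  by (simp add: geo_def poly_sum poly_monom)

lemma geo_mult: "(1 - u) * poly (geo n) u = 1 - u ^ n"
  by (simp add: poly_geo one_diff_power_eq)

lemma poly_geo_nonneg: "0 \<le> u \<Longrightarrow> 0 \<le> poly (geo n) u"
  by (simp add: poly_geo sum_nonneg)

text \<open>The full series \<open>G = 1 / (1 - u)\<close> satisfies \<open>(1 - u) G' = G\<close>.
  For the truncation, differentiating \<open>(1 - u) G = 1 - u^n\<close> gives
  \<open>(1 - u) G' = G - n u^(n-1)\<close>, which leaves an inequality.\<close>

lemma geo_pderiv_le: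
  assumes "0 \<le> u"
  shows "(1 - u) * poly (pderiv (geo n)) u \<le> poly (geo n) u"
proof -
  have "pderiv ([:1, -1:] * geo n) = pderiv (1 - Polynomial.monom 1 n)"
    by (rule arg_cong[where f = pderiv]) (simp add: poly_eq_poly_eq_iff[symmetric] fun_eq_iff geo_mult[symmetric] poly_monom algebra_simps)
  then have "poly (pderiv ([:1, -1:] * geo n)) u = poly (pderiv (1 - Polynomial.monom 1 n)) u"
    by simp
  also have "poly (pderiv ([:1, -1:] * geo n)) u = (1 - u) * poly (pderiv (geo n)) u - poly (geo n) u"
    by (simp only: pderiv_mult poly_add poly_mult) (simp add: pderiv_pCons)
  finally have "(1 - u) * poly (pderiv (geo n)) u - poly (geo n) u = - (real n * u ^ (n - 1))"
    by (simp add: pderiv_diff pderiv_monom poly_monom)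
  moreover have "0 \<le> real n * u ^ (n - 1)"
    using assms by simp
  ultimately show ?thesis by linarith
qed

lemma integrable_geo: "integrable \<nu> (\<lambda>z. ((cmod z)\<^sup>2) ^ r * poly (geo n) ((cmod z)\<^sup>2) ^ j)"
  by (intro integrable_continuous_law continuous_intros)

text \<open>Integrate \<open>p = u^r G^j\<close> by parts, where \<open>p(0) = 0\<close> because
  \<open>0 < r\<close>. The bounds \<open>(1 - u) G <= 1\<close> and \<open>(1 - u) G' <= G\<close>
  give \<open>(1 - u) p' <= r u^(r-1) G^(j-1) + j p\<close>, and moving \<open>j p\<close> to the
  left turns \<open>k - 1\<close> into \<open>k - 1 - j\<close>.\<close>

lemma geo_moment_step:
  assumes "0 < r" "0 < j"
  shows "(real k - 1 - real j) * (\<integral>z. ((cmod z)\<^sup>2) ^ r * poly (geo n) ((cmod z)\<^sup>2) ^ j \<partial>\<nu>)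
    \<le> real r * (\<integral>z. ((cmod z)\<^sup>2) ^ (r - 1) * poly (geo n) ((cmod z)\<^sup>2) ^ (j - 1) \<partial>\<nu>)"
proof -
  define p where "p = Polynomial.monom 1 r * geo n ^ j"
  have pp: "poly p u = u ^ r * poly (geo n) u ^ j" for u
    by (simp add: p_def poly_monom poly_power)
  have "(1 - (cmod z)\<^sup>2) * poly (pderiv p) ((cmod z)\<^sup>2) \<le>
      real r * (((cmod z)\<^sup>2) ^ (r - 1) * poly (geo n) ((cmod z)\<^sup>2) ^ (j - 1)) +
      real j * (((cmod z)\<^sup>2) ^ r * poly (geo n) ((cmod z)\<^sup>2) ^ j)"
    if "cmod z \<le> 1" for z
  proof -
    define u where "u = (cmod z)\<^sup>2"
    have u: "0 \<le> u" "u \<le> 1" using that by (auto simp: u_def power_le_one)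
    define q where "q = poly (geo n) u"
    define d where "d = poly (pderiv (geo n)) u"
    have q: "0 \<le> q" "(1 - u) * q \<le> 1"
      using u by (simp_all add: q_def poly_geo_nonneg geo_mult)
    have d: "(1 - u) * d \<le> q"
      using geo_pderiv_le[OF u(1)] by (simp add: d_def q_def)
    have j: "q ^ j = q ^ (j - 1) * q"
      using assms by (metis power_minus_mult)
    have "(1 - u) * poly (pderiv p) u = real r * u ^ (r - 1) * q ^ (j - 1) * ((1 - u) * q) + real j * u ^ r * q ^ (j - 1) * ((1 - u) * d)"
      by (simp add: p_def pderiv_mult pderiv_monom pderiv_power poly_monom poly_power q_def[symmetric] d_def[symmetric] j algebra_simps)
    also have "\<dots> \<le> real r * u ^ (r - 1) * q ^ (j - 1) * 1 + real j * u ^ r * q ^ (j - 1) * q"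
      using u q d by (intro add_mono mult_left_mono) auto
    also have "\<dots> = real r * (u ^ (r - 1) * q ^ (j - 1)) + real j * (u ^ r * q ^ j)"
      by (simp add: j)
    finally show ?thesis by (simp add: u_def q_def)
  qed
  then have "(\<integral>z. (1 - (cmod z)\<^sup>2) * poly (pderiv p) ((cmod z)\<^sup>2) \<partial>\<nu>) \<le>
      (\<integral>z. real r * (((cmod z)\<^sup>2) ^ (r - 1) * poly (geo n) ((cmod z)\<^sup>2) ^ (j - 1)) +
      real j * (((cmod z)\<^sup>2) ^ r * poly (geo n) ((cmod z)\<^sup>2) ^ j) \<partial>\<nu>)"
    using norm_le_1 by (intro integral_mono_AE integrable_continuous_law continuous_intros) auto
  also have "\<dots> = real r * (\<integral>z. ((cmod z)\<^sup>2) ^ (r - 1) * poly (geo n) ((cmod z)\<^sup>2) ^ (j - 1) \<partial>\<nu>)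
     + real j * (\<integral>z. ((cmod z)\<^sup>2) ^ r * poly (geo n) ((cmod z)\<^sup>2) ^ j \<partial>\<nu>)"
    using integrable_geo[of "r - 1" n "j - 1"] integrable_geo[of r n j] by simp
  also have "(\<integral>z. (1 - (cmod z)\<^sup>2) * poly (pderiv p) ((cmod z)\<^sup>2) \<partial>\<nu>) = (real k - 1) * (\<integral>z. ((cmod z)\<^sup>2) ^ r * poly (geo n) ((cmod z)\<^sup>2) ^ j \<partial>\<nu>)"
    using assms by (subst integral_poly_pderiv[symmetric]) (simp add: pp)
  finally show ?thesis by (simp add: algebra_simps)
qed

text \<open>The case \<open>r = 0\<close> of the same integration by parts: now
  \<open>p(0) = 1\<close>, and this boundary value produces the right-hand side.\<close>

lemma geo_moment_base:
  assumes "0 < j" "0 < n"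
  shows "(real k - 1 - real j) * (\<integral>z. poly (geo n) ((cmod z)\<^sup>2) ^ j \<partial>\<nu>) \<le> real k - 1"
proof -
  define p where "p = geo n ^ j"
  have pp: "poly p u = poly (geo n) u ^ j" for u
    by (simp add: p_def poly_power)
  have "poly (geo n) 0 = 1"
    using assms geo_mult[of 0 n] by simp
  then have p0: "poly p 0 = 1" by (simp add: pp)
  have "(1 - (cmod z)\<^sup>2) * poly (pderiv p) ((cmod z)\<^sup>2) \<le> real j * poly (geo n) ((cmod z)\<^sup>2) ^ j" for z
  proof -
    define u where "u = (cmod z)\<^sup>2"
    define q where "q = poly (geo n) u"
    define d where "d = poly (pderiv (geo n)) u"
    have u: "0 \<le> u" by (simp add: u_def)
    have q: "0 \<le> q" using u by (simp add: q_def poly_geo_nonneg)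
    have d: "(1 - u) * d \<le> q"
      using geo_pderiv_le[OF u] by (simp add: d_def q_def)
    have j: "q ^ j = q ^ (j - 1) * q"
      using assms by (metis power_minus_mult)
    have "(1 - u) * poly (pderiv p) u = real j * q ^ (j - 1) * ((1 - u) * d)"
      by (simp add: p_def pderiv_power poly_power q_def[symmetric] d_def[symmetric] algebra_simps)
    also have "\<dots> \<le> real j * q ^ (j - 1) * q"
      using q d by (intro mult_left_mono) auto
    finally show ?thesis by (simp add: u_def q_def j[unfolded u_def q_def])
  qed
  then have "(\<integral>z. (1 - (cmod z)\<^sup>2) * poly (pderiv p) ((cmod z)\<^sup>2) \<partial>\<nu>) \<le> (\<integral>z. real j * poly (geo n) ((cmod z)\<^sup>2) ^ j \<partial>\<nu>)"
    by (intro integral_mono integrable_continuous_law continuous_intros) auto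
  then have "(real k - 1) * ((\<integral>z. poly (geo n) ((cmod z)\<^sup>2) ^ j \<partial>\<nu>) - 1) \<le> real j * (\<integral>z. poly (geo n) ((cmod z)\<^sup>2) ^ j \<partial>\<nu>)"
    using integral_poly_pderiv[of p] unfolding p0 unfolding pp by simp
  then show ?thesis by (simp add: algebra_simps)
qed

text \<open>The exponents \<open>(r, j)\<close> descend from \<open>(2, 4)\<close> over
  \<open>(1, 3)\<close> to \<open>(0, 2)\<close>, and each of the two steps gains a factor
  \<open>1 / k\<close>. The constant uses \<open>k - 5 >= k / 6\<close>,
  \<open>k - 4 >= k / 3\<close> and \<open>(k - 1) / (k - 3) <= 5 / 3\<close>.\<close>

lemma geo_moment_4:
  assumes k: "6 \<le> k" and n: "0 < n"
  shows "(\<integral>z. ((cmod z)\<^sup>2) ^ 2 * poly (geo n) ((cmod z)\<^sup>2) ^ 4 \<partial>\<nu>) \<le> 60 / (real k)\<^sup>2"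
proof -
  define K where "K = real k"
  have K: "6 \<le> K" using k by (simp add: K_def)
  define a b c where "a = (\<integral>z. ((cmod z)\<^sup>2) ^ 2 * poly (geo n) ((cmod z)\<^sup>2) ^ 4 \<partial>\<nu>)"
    and "b = (\<integral>z. ((cmod z)\<^sup>2) ^ 1 * poly (geo n) ((cmod z)\<^sup>2) ^ 3 \<partial>\<nu>)"
    and "c = (\<integral>z. poly (geo n) ((cmod z)\<^sup>2) ^ 2 \<partial>\<nu>)"
  have "(K - 5) * a \<le> 2 * b"
    using geo_moment_step[of 2 4 n] by (simp add: a_def b_def K_def)
  moreover have "(K - 4) * b \<le> c"
    using geo_moment_step[of 1 3 n] by (simp add: b_def c_def K_def)
  moreover have "(K - 3) * c \<le> K - 1"
    using geo_moment_base[of 2 n] n by (simp add: c_def K_def)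
  ultimately have "a \<le> 2 * b / (K - 5)" "b \<le> c / (K - 4)" "c \<le> (K - 1) / (K - 3)"
    using K by (simp_all add: field_simps)
  have c: "c \<le> 5 / 3"
    using \<open>c \<le> (K - 1) / (K - 3)\<close> K by (elim order_trans) (simp add: field_simps)
  have "c / (K - 4) \<le> (5 / 3) / (K / 3)"
    using c K by (intro frac_le) auto
  then have b: "b \<le> 5 / K"
    using \<open>b \<le> c / (K - 4)\<close> by simp
  have "2 * b / (K - 5) \<le> (2 * (5 / K)) / (K / 6)"
    using b K by (intro frac_le) auto
  then have "a \<le> 60 / K\<^sup>2"
    using \<open>a \<le> 2 * b / (K - 5)\<close> K by (simp add: power2_eq_square)
  then show ?thesis by (simp add: a_def K_def)
qed

lemma geo_moment_2:
  assumes k: "6 \<le> k" and n: "0 < n"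
  shows "(\<integral>z. (cmod z)\<^sup>2 * poly (geo n) ((cmod z)\<^sup>2) ^ 2 \<partial>\<nu>) \<le> 5 / (2 * real k)"
proof -
  define K where "K = real k"
  have K: "6 \<le> K" using k by (simp add: K_def)
  define b c where "b = (\<integral>z. ((cmod z)\<^sup>2) ^ 1 * poly (geo n) ((cmod z)\<^sup>2) ^ 2 \<partial>\<nu>)"
    and "c = (\<integral>z. poly (geo n) ((cmod z)\<^sup>2) ^ 1 \<partial>\<nu>)"
  have "(K - 3) * b \<le> c"
    using geo_moment_step[of 1 2 n] by (simp add: b_def c_def K_def)
  moreover have "(K - 2) * c \<le> K - 1"
    using geo_moment_base[of 1 n] n by (simp add: c_def K_def)
  ultimately have "b \<le> c / (K - 3)" "c \<le> (K - 1) / (K - 2)"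
    using K by (simp_all add: field_simps)
  have c: "c \<le> 5 / 4"
    using \<open>c \<le> (K - 1) / (K - 2)\<close> K by (elim order_trans) (simp add: field_simps)
  have "c / (K - 3) \<le> (5 / 4) / (K / 2)"
    using c K by (intro frac_le) auto
  then have "b \<le> 5 / (2 * K)"
    using \<open>b \<le> c / (K - 3)\<close> by simp
  then show ?thesis by (simp add: b_def K_def)
qed

end

section \<open>From truncated series to the moments of the logarithm\<close>

lemma integrable_Fatou:
  fixes f :: "'a \<Rightarrow> real"
  assumes int: "\<And>n. integrable M (s n)" and f [measurable]: "f \<in> borel_measurable M"
    and nn: "\<And>n. AE x in M. 0 \<le> s n x"
    and lim: "AE x in M. (\<lambda>n. s n x) \<longlonglongrightarrow> f x"
    and le: "\<And>n. (\<integral>x. s n x \<partial>M) \<le> C"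
  shows "integrable M f" "(\<integral>x. f x \<partial>M) \<le> C"
proof -
  have [measurable]: "s n \<in> borel_measurable M" for n using int by auto
  have C: "0 \<le> C" using integral_nonneg_AE[OF nn] le order_trans by blast
  have "AE x in M. \<forall>n. 0 \<le> s n x"
    using nn by (simp add: AE_all_countable)
  with lim have nf: "AE x in M. 0 \<le> f x"
    by eventually_elim (auto intro: LIMSEQ_le_const)
  have "(\<integral>\<^sup>+x. ennreal (f x) \<partial>M) = (\<integral>\<^sup>+x. liminf (\<lambda>n. ennreal (s n x)) \<partial>M)"
    using lim by (intro nn_integral_cong_AE, eventually_elim)
      (auto intro!: lim_imp_Liminf[symmetric] tendsto_ennrealI)
  also have "\<dots> \<le> liminf (\<lambda>n. \<integral>\<^sup>+x. ennreal (s n x) \<partial>M)"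
    by (rule nn_integral_liminf) measurable
  also have "\<dots> \<le> ennreal C"
  proof -
    have "(\<integral>\<^sup>+x. ennreal (s n x) \<partial>M) \<le> ennreal C" for n
      using le[of n] by (subst nn_integral_eq_integral[OF int nn]) (auto intro: ennreal_leI)
    then have "liminf (\<lambda>n. \<integral>\<^sup>+x. ennreal (s n x) \<partial>M) \<le> liminf (\<lambda>n. ennreal C)"
      by (intro Liminf_mono) auto
    then show ?thesis by (simp add: Liminf_const)
  qed
  finally have *: "(\<integral>\<^sup>+x. ennreal (f x) \<partial>M) \<le> ennreal C" .
  moreover have "(\<integral>\<^sup>+x. ennreal (norm (f x)) \<partial>M) = (\<integral>\<^sup>+x. ennreal (f x) \<partial>M)"
    using nf by (intro nn_integral_cong_AE) auto
  ultimately have "(\<integral>\<^sup>+x. ennreal (norm (f x)) \<partial>M) \<le> ennreal C"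
    by simp
  then show i: "integrable M f"
    by (intro integrableI_bounded) (auto intro: le_less_trans)
  show "(\<integral>x. f x \<partial>M) \<le> C"
    using * C nn_integral_eq_integral[OF i nf] by (simp add: ennreal_le_iff)
qed

lemma norm_Ln_one_minus_le:
  assumes "cmod z < 1"
  shows "cmod (Ln (1 - z)) \<le> cmod z / (1 - cmod z)"
proof -
  have "cmod (Ln (1 - z)) \<le> cmod (Ln (1 + (- z)) - (- z)) + cmod (- z)"
    using norm_triangle_ineq[of "Ln (1 + (- z)) - (- z)" "- z"] by simp
  also have "\<dots> \<le> (cmod z)\<^sup>2 / (1 - cmod z) + cmod z"
    using Ln_approx_linear[of "- z"] assms by simp
  also have "\<dots> = cmod z / (1 - cmod z)"
    using assms by (simp add: field_simps power2_eq_square)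
  finally show ?thesis .
qed

text \<open>Replaces \<open>1 - r\<close> by \<open>1 - r^2\<close> at the cost of a factor 2,
  because only even powers of the modulus have known moments.\<close>

lemma geometric_ratio_le:
  assumes "0 \<le> r" "r < (1::real)"
  shows "r / (1 - r) \<le> 2 * r / (1 - r\<^sup>2)"
proof -
  have "1 - r\<^sup>2 = (1 - r) * (1 + r)" by (simp add: power2_eq_square algebra_simps)
  then have "2 * r / (1 - r\<^sup>2) = (r / (1 - r)) * (2 / (1 + r))"
    by simp
  moreover have "(r / (1 - r)) * 1 \<le> (r / (1 - r)) * (2 / (1 + r))"
    using assms by (intro mult_left_mono) auto
  ultimately show ?thesis by simp
qed

lemma le_one_plus_square: "x \<le> 1 + x\<^sup>2" for x :: real
  using zero_le_power2[of "x - 1 / 2"] by (simp add: power2_eq_square algebra_simps)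

lemma norm_exp_minus_1_le: "cmod (exp w - 1) \<le> exp (cmod w) * cmod w"
proof -
  have "cmod (exp w - 1) \<le> exp \<bar>Re w\<bar> * cmod w"
    using Taylor_exp[of w 0] by simp
  also have "\<dots> \<le> exp (cmod w) * cmod w"
    using abs_Re_le_cmod[of w] by (intro mult_right_mono) auto
  finally show ?thesis .
qed

text \<open>With \<open>w = Ln (1 - z)\<close> one has \<open>|z| = |exp w - 1|\<close>, which is at
  most \<open>2 |w|\<close> for small \<open>w\<close>. This feeds the lower bound for the
  variance.\<close>

lemma norm_le_norm_Ln_one_minus:
  assumes "cmod z < 1"
  shows "cmod z / 4 \<le> cmod (Ln (1 - z))"
proof (rule ccontr)
  define w where "w = Ln (1 - z)"
  assume "\<not> cmod z / 4 \<le> cmod (Ln (1 - z))"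
  then have w: "cmod w < cmod z / 4" by (simp add: w_def)
  have "1 - z \<noteq> 0" using assms by auto
  then have "exp w - 1 = - z" by (simp add: w_def)
  then have "cmod z \<le> exp (cmod w) * cmod w"
    using norm_exp_minus_1_le[of w] by simp
  also have "\<dots> \<le> 2 * cmod w"
  proof (intro mult_right_mono)
    have "exp (cmod w) \<le> 1 + cmod w + (cmod w)\<^sup>2"
      using w assms by (intro exp_bound) auto
    also have "\<dots> \<le> 1 + 1 / 4 + (1 / 4)\<^sup>2"
      using w assms by (intro add_mono power_mono) auto
    finally show "exp (cmod w) \<le> 2" by (simp add: power2_eq_square)
  qed simp
  finally show False using w norm_ge_zero[of w] by linarith
qed

definition lg :: "complex \<Rightarrow> complex" where
  "lg z = Ln (1 - z)"

lemma lg_measurable [measurable]: "lg \<in> borel_measurable borel"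
  unfolding lg_def by measurable

context corner_law
begin

context
  assumes k: "6 \<le> k"
begin

lemma AE_norm_less: "AE z in \<nu>. cmod z < 1"
  using norm_less_1 k by simp

lemma geo_tendsto:
  assumes "cmod z < 1"
  shows "(\<lambda>n. poly (geo (Suc n)) ((cmod z)\<^sup>2)) \<longlonglongrightarrow> 1 / (1 - (cmod z)\<^sup>2)"
proof -
  have "(cmod z)\<^sup>2 < 1"
    using assms by (simp add: power_less_one_iff)
  then have "(\<lambda>i. ((cmod z)\<^sup>2) ^ i) sums (1 / (1 - (cmod z)\<^sup>2))"
    by (intro geometric_sums) simp
  then show ?thesis
    unfolding sums_def poly_geo by (rule LIMSEQ_Suc)
qed

text \<open>The truncations converge pointwise where \<open>|z| < 1\<close>, so Fatou carries a
  bound uniform in the truncation length to the limit and yields integrability at the same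
  time.\<close>

lemma ratio_moment:
  assumes "\<And>n. (\<integral>z. ((cmod z)\<^sup>2) ^ r * poly (geo (Suc n)) ((cmod z)\<^sup>2) ^ (2 * r) \<partial>\<nu>) \<le> C"
  shows "integrable \<nu> (\<lambda>z. (cmod z / (1 - (cmod z)\<^sup>2)) ^ (2 * r))"
    and "(\<integral>z. (cmod z / (1 - (cmod z)\<^sup>2)) ^ (2 * r) \<partial>\<nu>) \<le> C"
proof -
  let ?s = "\<lambda>n z. ((cmod z)\<^sup>2) ^ r * poly (geo (Suc n)) ((cmod z)\<^sup>2) ^ (2 * r)"
  have lim: "AE z in \<nu>. (\<lambda>n. ?s n z) \<longlonglongrightarrow> (cmod z / (1 - (cmod z)\<^sup>2)) ^ (2 * r)"
    using AE_norm_less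
  proof (elim eventually_mono)
    fix z assume z: "cmod z < 1"
    have "(\<lambda>n. ?s n z) \<longlonglongrightarrow> ((cmod z)\<^sup>2) ^ r * (1 / (1 - (cmod z)\<^sup>2)) ^ (2 * r)"
      by (intro tendsto_intros geo_tendsto z)
    then show "(\<lambda>n. ?s n z) \<longlonglongrightarrow> (cmod z / (1 - (cmod z)\<^sup>2)) ^ (2 * r)"
      by (simp add: power_divide flip: power_mult)
  qed
  have nn: "AE z in \<nu>. 0 \<le> ?s n z" for n
    by (simp add: poly_geo_nonneg)
  note F = integrable_Fatou[of \<nu> ?s, OF integrable_geo _ nn lim assms]
  show "integrable \<nu> (\<lambda>z. (cmod z / (1 - (cmod z)\<^sup>2)) ^ (2 * r))"
    by (rule F(1)) auto
  show "(\<integral>z. (cmod z / (1 - (cmod z)\<^sup>2)) ^ (2 * r) \<partial>\<nu>) \<le> C"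
    by (rule F(2)) auto
qed

lemma ratio_square_integrable: "integrable \<nu> (\<lambda>z. (cmod z / (1 - (cmod z)\<^sup>2)) ^ 2)"
  using ratio_moment(1)[of 1 "5 / (2 * real k)"] geo_moment_2[OF k] by simp

lemma norm_lg_le:
  assumes "cmod z < 1"
  shows "cmod (lg z) \<le> 2 * (cmod z / (1 - (cmod z)\<^sup>2))"
  using norm_Ln_one_minus_le[OF assms] geometric_ratio_le[of "cmod z"] assms
  by (simp add: lg_def)

lemma lg_moment:
  assumes C: "\<And>n. (\<integral>z. ((cmod z)\<^sup>2) ^ r * poly (geo (Suc n)) ((cmod z)\<^sup>2) ^ (2 * r) \<partial>\<nu>) \<le> C"
  shows "integrable \<nu> (\<lambda>z. cmod (lg z) ^ (2 * r))" "(\<integral>z. cmod (lg z) ^ (2 * r) \<partial>\<nu>) \<le> 2 ^ (2 * r) * C"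
proof -
  let ?f = "\<lambda>z. 2 ^ (2 * r) * (cmod z / (1 - (cmod z)\<^sup>2)) ^ (2 * r)"
  have f: "integrable \<nu> ?f"
    by (intro integrable_mult_right ratio_moment(1)[OF C])
  have le: "AE z in \<nu>. cmod (lg z) ^ (2 * r) \<le> ?f z"
    using AE_norm_less
  proof (elim eventually_mono)
    fix z assume "cmod z < 1"
    from power_mono[OF norm_lg_le[OF this] norm_ge_zero, of "2 * r"]
    show "cmod (lg z) ^ (2 * r) \<le> ?f z"
      by (simp only: power_mult_distrib)
  qed
  show i: "integrable \<nu> (\<lambda>z. cmod (lg z) ^ (2 * r))"
    by (rule Bochner_Integration.integrable_bound[OF f]) (use le in \<open>auto elim!: eventually_mono\<close>)
  have "(\<integral>z. cmod (lg z) ^ (2 * r) \<partial>\<nu>) \<le> (\<integral>z. ?f z \<partial>\<nu>)"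
    by (rule integral_mono_AE[OF i f le])
  also have "\<dots> \<le> 2 ^ (2 * r) * C"
    unfolding integral_mult_right_zero by (intro mult_left_mono ratio_moment(2)[OF C]) simp
  finally show "(\<integral>z. cmod (lg z) ^ (2 * r) \<partial>\<nu>) \<le> 2 ^ (2 * r) * C" .
qed

lemma lg_moment_4: "integrable \<nu> (\<lambda>z. cmod (lg z) ^ 4)" "(\<integral>z. cmod (lg z) ^ 4 \<partial>\<nu>) \<le> 960 / (real k)\<^sup>2"
  using lg_moment[of 2 "60 / (real k)\<^sup>2"] geo_moment_4[OF k] by simp_all

lemma lg_moment_2: "integrable \<nu> (\<lambda>z. cmod (lg z) ^ 2)" "(\<integral>z. cmod (lg z) ^ 2 \<partial>\<nu>) \<le> 10 / real k"
  using lg_moment[of 1 "5 / (2 * real k)"] geo_moment_2[OF k] by simp_all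

lemma lg_moment_2_ge: "1 / (16 * real k) \<le> (\<integral>z. cmod (lg z) ^ 2 \<partial>\<nu>)"
proof -
  have i: "integrable \<nu> (\<lambda>z. (cmod z)\<^sup>2 / 16)"
    by (intro integrable_continuous_law continuous_intros) auto
  have "real k * (\<integral>z. (cmod z)\<^sup>2 \<partial>\<nu>) = 1"
    using moment[of 0] prob_space by simp
  then have "1 / (16 * real k) = (\<integral>z. (cmod z)\<^sup>2 / 16 \<partial>\<nu>)"
    using k by (simp add: field_simps)
  also have "\<dots> \<le> (\<integral>z. cmod (lg z) ^ 2 \<partial>\<nu>)"
  proof (rule integral_mono_AE[OF i lg_moment_2(1)])
    show "AE z in \<nu>. (cmod z)\<^sup>2 / 16 \<le> cmod (lg z) ^ 2"
      using AE_norm_less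
    proof (elim eventually_mono)
      fix z assume "cmod z < 1"
      from power_mono[OF norm_le_norm_Ln_one_minus[OF this], of 2]
      show "(cmod z)\<^sup>2 / 16 \<le> cmod (lg z) ^ 2"
        by (simp add: lg_def power_divide)
    qed
  qed
  finally show ?thesis .
qed

text \<open>Interpolation: \<open>x^3 <= (r/2) x^4 + x^2 / (2 r)\<close> by completing the square.
  The choice \<open>r = sqrt k\<close> makes both terms of order \<open>k^(-3/2)\<close>, with
  constant \<open>960 / 2 + 10 / 2 = 485\<close>.\<close>

lemma lg_moment_3: "integrable \<nu> (\<lambda>z. cmod (lg z) ^ 3)" "(\<integral>z. cmod (lg z) ^ 3 \<partial>\<nu>) \<le> 485 / (real k * sqrt (real k))"
proof -
  define r where "r = sqrt (real k)"
  have r: "0 < r" "r * r = real k" using k by (simp_all add: r_def)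
  let ?f = "\<lambda>z. r / 2 * cmod (lg z) ^ 4 + 1 / (2 * r) * cmod (lg z) ^ 2"
  have f: "integrable \<nu> ?f"
    using lg_moment_4(1) lg_moment_2(1) by simp
  have le: "cmod (lg z) ^ 3 \<le> ?f z" for z
  proof -
    define x where "x = cmod (lg z)"
    have "0 \<le> x\<^sup>2 * (r * x - 1)\<^sup>2 / (2 * r)"
      using r by simp
    also have "\<dots> = r / 2 * x ^ 4 + 1 / (2 * r) * x ^ 2 - x ^ 3"
      using r by (simp add: field_simps power2_eq_square power3_eq_cube power4_eq_xxxx)
    finally show ?thesis by (simp add: x_def)
  qed
  show i: "integrable \<nu> (\<lambda>z. cmod (lg z) ^ 3)"
    by (rule Bochner_Integration.integrable_bound[OF f])
      (auto intro!: AE_I2 order_trans[OF le] abs_ge_self)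
  have "(\<integral>z. cmod (lg z) ^ 3 \<partial>\<nu>) \<le> (\<integral>z. ?f z \<partial>\<nu>)"
    by (rule integral_mono[OF i f le])
  also have "\<dots> = r / 2 * (\<integral>z. cmod (lg z) ^ 4 \<partial>\<nu>) + 1 / (2 * r) * (\<integral>z. cmod (lg z) ^ 2 \<partial>\<nu>)"
    using lg_moment_4(1) lg_moment_2(1) by simp
  also have "\<dots> \<le> r / 2 * (960 / (real k)\<^sup>2) + 1 / (2 * r) * (10 / real k)"
    using r by (intro add_mono mult_left_mono lg_moment_4 lg_moment_2) auto
  also have "\<dots> = 485 / (real k * r)"
    using r by (simp add: field_simps power2_eq_square flip: r(2))
  finally show "(\<integral>z. cmod (lg z) ^ 3 \<partial>\<nu>) \<le> 485 / (real k * sqrt (real k))" by (simp add: r_def)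
qed

lemma lg_integrable: "integrable \<nu> lg"
proof -
  have i: "integrable \<nu> (\<lambda>z. 1 + cmod (lg z) ^ 2)"
    using lg_moment_2(1) by simp
  show ?thesis
    by (rule Bochner_Integration.integrable_bound[OF i])
      (auto intro!: AE_I2 le_one_plus_square)
qed

text \<open>The partial sums and their squares contain only positive powers of \<open>z\<close>,
  each of which has mean zero by rotation invariance.\<close>

lemma lg_partial_sums:
  defines "P \<equiv> \<lambda>n z. \<Sum>i<n. - (z ^ i / of_nat i) :: complex"
  shows "cmod z < 1 \<Longrightarrow> (\<lambda>n. P n z) \<longlonglongrightarrow> lg z"
    and "cmod z < 1 \<Longrightarrow> cmod (P n z) \<le> 2 * (cmod z / (1 - (cmod z)\<^sup>2))"
    and "(\<integral>z. P n z \<partial>\<nu>) = 0" "(\<integral>z. (P n z)\<^sup>2 \<partial>\<nu>) = 0"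
proof -
  \<comment> \<open>The term \<open>i = 0\<close> is \<open>1 / 0 = 0\<close>, so the sum really
    starts at 1.\<close>
  have P: "P n z = (\<Sum>i\<in>{1..<n}. - (z ^ i / of_nat i))" for n z
    unfolding P_def by (rule sum.mono_neutral_right) (auto simp: not_le)
  have int: "integrable \<nu> (\<lambda>z. z ^ i)" for i
    by (intro integrable_continuous_law continuous_intros)
  show "(\<lambda>n. P n z) \<longlonglongrightarrow> lg z" if "cmod z < 1"
    using Ln_series'[of "- z"] that by (simp add: sums_def P_def lg_def)
  show "cmod (P n z) \<le> 2 * (cmod z / (1 - (cmod z)\<^sup>2))" if z: "cmod z < 1"
  proof -
    have "cmod (P n z) \<le> (\<Sum>i\<in>{1..<n}. cmod z ^ i)"
      unfolding P
    proof (rule order_trans[OF norm_sum sum_mono])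
      fix i assume "i \<in> {1..<n}"
      then show "cmod (- (z ^ i / of_nat i)) \<le> cmod z ^ i"
        using mult_left_mono[of 1 "real i" "cmod z ^ i"]
        by (simp add: norm_divide norm_power divide_le_eq)
    qed
    also have "\<dots> \<le> (\<Sum>i\<in>{1..<Suc n}. cmod z ^ i)"
      by (intro sum_mono2) auto
    also have "\<dots> = cmod z * (\<Sum>i<n. cmod z ^ i)"
      unfolding One_nat_def sum.shift_bounds_Suc_ivl by (simp add: sum_distrib_left lessThan_atLeast0)
    also have "\<dots> \<le> cmod z * (1 / (1 - cmod z))"
    proof (intro mult_left_mono)
      have "(\<Sum>i<n. cmod z ^ i) * (1 - cmod z) = 1 - cmod z ^ n"
        by (simp add: one_diff_power_eq mult.commute)
      also have "\<dots> \<le> 1" by simp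
      finally show "(\<Sum>i<n. cmod z ^ i) \<le> 1 / (1 - cmod z)"
        using z by (simp add: field_simps)
    qed simp
    also have "\<dots> \<le> 2 * (cmod z / (1 - (cmod z)\<^sup>2))"
      using geometric_ratio_le[of "cmod z"] z by simp
    finally show ?thesis .
  qed
  show "(\<integral>z. P n z \<partial>\<nu>) = 0"
    unfolding P using int
    by (subst Bochner_Integration.integral_sum) (auto simp: integral_power_eq_0)
  have "(P n z)\<^sup>2 = (\<Sum>i\<in>{1..<n}. \<Sum>j\<in>{1..<n}. z ^ (i + j) / (of_nat i * of_nat j))" for z
    unfolding P power2_eq_square by (simp add: sum_product power_add)
  then show "(\<integral>z. (P n z)\<^sup>2 \<partial>\<nu>) = 0"
    using int by (simp add: Bochner_Integration.integral_sum integral_power_eq_0)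
qed

lemma lg_mean: "(\<integral>z. lg z \<partial>\<nu>) = 0"
proof -
  let ?P = "\<lambda>n z. \<Sum>i<n. - (z ^ i / of_nat i) :: complex"
  \<comment> \<open>The second moment of the ratio is known to be finite, hence the detour through
    \<open>x <= 1 + x^2\<close> for the dominating function.\<close>
  let ?w = "\<lambda>z. 2 * (1 + (cmod z / (1 - (cmod z)\<^sup>2)) ^ 2)"
  have w: "integrable \<nu> ?w"
    using ratio_square_integrable by simp
  have "(\<lambda>n. (\<integral>z. ?P n z \<partial>\<nu>)) \<longlonglongrightarrow> (\<integral>z. lg z \<partial>\<nu>)"
  proof (rule integral_dominated_convergence[where w = ?w])
    show "AE z in \<nu>. (\<lambda>n. ?P n z) \<longlonglongrightarrow> lg z"
      using AE_norm_less by (elim eventually_mono) (auto intro: lg_partial_sums(1))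
    show "AE z in \<nu>. cmod (?P n z) \<le> ?w z" for n
      using AE_norm_less
    proof (elim eventually_mono)
      fix z assume "cmod z < 1"
      then have "cmod (?P n z) \<le> 2 * (cmod z / (1 - (cmod z)\<^sup>2))"
        by (rule lg_partial_sums(2))
      also have "\<dots> \<le> ?w z"
        by (intro mult_left_mono le_one_plus_square) simp
      finally show "cmod (?P n z) \<le> ?w z" .
    qed
  qed (use w in auto)
  then have "(\<lambda>n. 0) \<longlonglongrightarrow> (\<integral>z. lg z \<partial>\<nu>)"
    by (simp only: lg_partial_sums(3))
  then show ?thesis
    by (simp add: LIMSEQ_const_iff)
qed

text \<open>Real and imaginary part of \<open>lg\<close> thus have equal variance and are
  uncorrelated, which removes the dependence on the direction of \<open>t\<close> in
  \<open>chf_taylor\<close>.\<close>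

lemma lg_square_mean: "integrable \<nu> (\<lambda>z. (lg z)\<^sup>2)" "(\<integral>z. (lg z)\<^sup>2 \<partial>\<nu>) = 0"
proof -
  let ?P = "\<lambda>n z. \<Sum>i<n. - (z ^ i / of_nat i) :: complex"
  let ?w = "\<lambda>z. 4 * ((cmod z / (1 - (cmod z)\<^sup>2)) ^ 2)"
  have w: "integrable \<nu> ?w"
    using ratio_square_integrable by simp
  have "(\<lambda>n. (\<integral>z. (?P n z)\<^sup>2 \<partial>\<nu>)) \<longlonglongrightarrow> (\<integral>z. (lg z)\<^sup>2 \<partial>\<nu>)"
  proof (rule integral_dominated_convergence[where w = ?w])
    show "AE z in \<nu>. (\<lambda>n. (?P n z)\<^sup>2) \<longlonglongrightarrow> (lg z)\<^sup>2"
      using AE_norm_less by (elim eventually_mono) (auto intro!: tendsto_power lg_partial_sums(1))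
    show "AE z in \<nu>. cmod ((?P n z)\<^sup>2) \<le> ?w z" for n
      using AE_norm_less
    proof (elim eventually_mono)
      fix z assume "cmod z < 1"
      from power_mono[OF lg_partial_sums(2)[OF this, of n] norm_ge_zero, of 2]
      show "cmod ((?P n z)\<^sup>2) \<le> ?w z"
        by (simp only: power_mult_distrib norm_ge_zero norm_power) simp
    qed
  qed (use w in auto)
  then have "(\<lambda>n. 0) \<longlonglongrightarrow> (\<integral>z. (lg z)\<^sup>2 \<partial>\<nu>)"
    by (simp only: lg_partial_sums(4))
  then show "(\<integral>z. (lg z)\<^sup>2 \<partial>\<nu>) = 0"
    by (simp add: LIMSEQ_const_iff)
  show "integrable \<nu> (\<lambda>z. (lg z)\<^sup>2)"
    by (rule Bochner_Integration.integrable_bound[OF lg_moment_2(1)]) (auto simp: norm_power)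
qed

section \<open>Characteristic function of a single factor\<close>

definition chf :: "complex \<Rightarrow> complex" where
  "chf t = (\<integral>z. iexp (Re (cnj t * lg z)) \<partial>\<nu>)"

lemma integrable_iexp_lg: "integrable \<nu> (\<lambda>z. iexp (Re (cnj t * lg z)))"
  by (intro integrable_const_bound[of _ 1]) auto

lemma norm_chf_le_1: "cmod (chf t) \<le> 1"
proof -
  have "cmod (chf t) \<le> (\<integral>z. cmod (iexp (Re (cnj t * lg z))) \<partial>\<nu>)"
    unfolding chf_def by (rule integral_norm_bound)
  then show ?thesis using prob_space by simp
qed

text \<open>With \<open>a = cnj t * lg z\<close>,
  \<open>(Re a)^2 = |a|^2 / 2 + Re (a^2) / 2\<close>, and the last term has mean zero. So the
  quadratic term is \<open>v |t|^2 / 4\<close>, and the cubic remainder is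
  \<open>485 / 6 <= 81\<close> in size.\<close>

lemma chf_taylor:
  defines "v \<equiv> (\<integral>z. cmod (lg z) ^ 2 \<partial>\<nu>)"
  shows "cmod (chf t - of_real (1 - v * (cmod t)\<^sup>2 / 4)) \<le> 81 * (cmod t) ^ 3 / (real k * sqrt (real k))"
proof -
  define y where "y = (\<lambda>z. Re (cnj t * lg z))"
  have [measurable]: "y \<in> borel_measurable borel" unfolding y_def by measurable
  have i1: "integrable \<nu> y"
    unfolding y_def using lg_integrable by simp
  have e1: "(\<integral>z. y z \<partial>\<nu>) = 0"
    unfolding y_def using lg_integrable lg_mean by (simp add: integral_Re[symmetric] del: Re_complex_div_eq_0)
  have y2: "(y z)\<^sup>2 = (cmod t)\<^sup>2 / 2 * cmod (lg z) ^ 2 + Re ((cnj t)\<^sup>2 * (lg z)\<^sup>2) / 2" for z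
  proof -
    define a where "a = cnj t * lg z"
    have "(Re a)\<^sup>2 = (cmod a)\<^sup>2 / 2 + Re (a\<^sup>2) / 2"
      unfolding cmod_power2 by (simp add: power2_eq_square field_simps)
    then show ?thesis
      by (simp add: a_def y_def norm_mult power_mult_distrib)
  qed
  have i2: "integrable \<nu> (\<lambda>z. (y z)\<^sup>2)"
    unfolding y2 using lg_moment_2(1) lg_square_mean(1) by simp
  have e2: "(\<integral>z. (y z)\<^sup>2 \<partial>\<nu>) = v * (cmod t)\<^sup>2 / 2"
  proof -
    have "(\<integral>z. (y z)\<^sup>2 \<partial>\<nu>) = (cmod t)\<^sup>2 / 2 * v + (\<integral>z. Re ((cnj t)\<^sup>2 * (lg z)\<^sup>2) \<partial>\<nu>) / 2"
      unfolding y2 v_def using lg_moment_2(1) lg_square_mean(1) by simp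
    also have "(\<integral>z. Re ((cnj t)\<^sup>2 * (lg z)\<^sup>2) \<partial>\<nu>) = Re (\<integral>z. (cnj t)\<^sup>2 * (lg z)\<^sup>2 \<partial>\<nu>)"
      using lg_square_mean(1) by (intro integral_Re) simp
    also have "\<dots> = 0"
      using lg_square_mean by simp
    finally show ?thesis by simp
  qed
  have i3: "integrable \<nu> (\<lambda>z. (cmod t ^ 3 / 6) * cmod (lg z) ^ 3)"
    using lg_moment_3(1) by simp
  have ie: "integrable \<nu> (\<lambda>z. iexp (y z))"
    unfolding y_def by (rule integrable_iexp_lg)
  have ic: "integrable \<nu> (\<lambda>z. \<i> * complex_of_real (y z))" "integrable \<nu> (\<lambda>z. complex_of_real ((y z)\<^sup>2 / 2))"
    using i1 i2 by (intro integrable_mult_right integrable_of_real integrable_divide; simp)+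
  have ip: "integrable \<nu> (\<lambda>z. 1 + \<i> * of_real (y z) - of_real ((y z)\<^sup>2 / 2))"
    by (intro Bochner_Integration.integrable_diff Bochner_Integration.integrable_add ic) simp
  have "(\<integral>z. 1 + \<i> * of_real (y z) - of_real ((y z)\<^sup>2 / 2) \<partial>\<nu>) = 1 + \<i> * of_real (\<integral>z. y z \<partial>\<nu>) - of_real ((\<integral>z. (y z)\<^sup>2 \<partial>\<nu>) / 2)"
    using i1 i2 prob_space ic by (simp add: Bochner_Integration.integral_diff Bochner_Integration.integral_add del: of_real_divide of_real_power)
  also have "\<dots> = of_real (1 - v * (cmod t)\<^sup>2 / 4)"
    by (simp add: e1 e2)
  finally have "chf t - of_real (1 - v * (cmod t)\<^sup>2 / 4) = (\<integral>z. iexp (y z) - (1 + \<i> * of_real (y z) - of_real ((y z)\<^sup>2 / 2)) \<partial>\<nu>)"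
    using ie ip by (simp add: chf_def y_def)
  also have "cmod \<dots> \<le> (\<integral>z. (cmod t ^ 3 / 6) * cmod (lg z) ^ 3 \<partial>\<nu>)"
  proof (rule order_trans[OF integral_norm_bound integral_mono])
    fix z
    have "cmod (iexp (y z) - (1 + \<i> * of_real (y z) - of_real ((y z)\<^sup>2 / 2))) \<le> \<bar>y z\<bar> ^ 3 / 6"
      using iexp_approx1[of "y z" 2] by (simp add: numeral_eq_Suc power2_eq_square mult_ac)
    also have "\<dots> \<le> (cmod t * cmod (lg z)) ^ 3 / 6"
      using abs_Re_le_cmod[of "cnj t * lg z"] by (intro divide_right_mono power_mono) (auto simp: y_def norm_mult)
    finally show "cmod (iexp (y z) - (1 + \<i> * of_real (y z) - of_real ((y z)\<^sup>2 / 2))) \<le> (cmod t ^ 3 / 6) * cmod (lg z) ^ 3"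
      by (simp add: power_mult_distrib)
  qed (use ie ip i3 in auto)
  also have "\<dots> = (cmod t ^ 3 / 6) * (\<integral>z. cmod (lg z) ^ 3 \<partial>\<nu>)"
    by simp
  also have "\<dots> \<le> (cmod t ^ 3 / 6) * (485 / (real k * sqrt (real k)))"
    by (intro mult_left_mono lg_moment_3) simp
  also have "\<dots> \<le> 81 * (cmod t) ^ 3 / (real k * sqrt (real k))"
    using k by (simp add: field_simps)
  finally show ?thesis .
qed

end

end

section \<open>Products of almost Gaussian characteristic functions\<close>

lemma sum_inverse_ge_ln:
  assumes "0 < m" "m \<le> n"
  shows "ln (real (Suc n) / real m) \<le> (\<Sum>k\<in>{m..n}. 1 / real k)"
  using assms(2)
proof (induction n rule: dec_induct)
  case base
  have "ln (real (Suc m) / real m) = ln (1 + 1 / real m)"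
    using assms by (simp add: field_simps)
  also have "\<dots> \<le> 1 / real m"
    by (rule ln_add_one_self_le_self) simp
  finally show ?case by simp
next
  case (step n)
  have "ln (real (Suc (Suc n)) / real m) = ln (real (Suc n) / real m) + ln (1 + 1 / real (Suc n))"
  proof -
    have n: "0 < real (Suc n) / real m" using assms by simp
    have "real (Suc n) * (1 + 1 / real (Suc n)) = real (Suc n) + 1"
      by (simp add: distrib_left del: of_nat_Suc)
    then have "real (Suc (Suc n)) / real m = real (Suc n) / real m * (1 + 1 / real (Suc n))"
      by (simp only: times_divide_eq_left of_nat_Suc[of "Suc n"] add.commute)
    then show ?thesis
      using n ln_mult_pos[OF n, of "1 + 1 / real (Suc n)"] by (simp only:) (simp add: add_pos_nonneg)
  qed
  also have "ln (1 + 1 / real (Suc n)) \<le> 1 / real (Suc n)"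
    by (rule ln_add_one_self_le_self) simp
  finally show ?case using step by (simp add: atLeastAtMostSuc_conv)
qed

lemma sum_inverse_le_ln:
  assumes "2 \<le> m" "m \<le> n"
  shows "(\<Sum>k\<in>{m..n}. 1 / real k) \<le> ln (real n)"
  using assms(2)
proof (induction n rule: dec_induct)
  case base
  have "1 / real m \<le> 1 / 2" using assms by (simp add: field_simps)
  also have "\<dots> \<le> ln 2"
    using ln2_ge_two_thirds by simp
  also have "\<dots> \<le> ln (real m)" using assms by simp
  finally show ?case by simp
next
  case (step n)
  have n: "0 < real n" using assms step by simp
  have "ln (real n / real (Suc n)) \<le> real n / real (Suc n) - 1"
    using n by (intro ln_le_minus_one) simp
  then have "1 / real (Suc n) \<le> ln (real (Suc n)) - ln (real n)"
    using n by (simp add: ln_div field_simps)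
  then show ?case using step by (simp add: atLeastAtMostSuc_conv)
qed

text \<open>Telescoping against \<open>2 / sqrt n\<close>: each new summand is at most
  \<open>2 / sqrt n - 2 / sqrt (n + 1)\<close>. Starting at 6 leaves room for the total bound
  1.\<close>

lemma sum_inverse_three_halves_le:
  "(\<Sum>k\<in>{6..n}. 1 / (real k * sqrt (real k))) \<le> 1"
proof -
  have "(\<Sum>k\<in>{6..n}. 1 / (real k * sqrt (real k))) \<le> 1 - 2 / sqrt (real n)" if "6 \<le> n"
    using that
  proof (induction n rule: dec_induct)
    case base
    have s: "2 \<le> sqrt (6::real)" by (rule real_le_rsqrt) simp
    have "1 / (6 * sqrt 6) + 2 / sqrt 6 = (13 / 6) / sqrt (6::real)"
      by (simp add: field_simps)
    also have "\<dots> \<le> 1"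
    proof -
      have "13 / 6 \<le> sqrt (6::real)" by (rule real_le_rsqrt) (simp add: power2_eq_square)
      then show ?thesis using s by (simp add: divide_le_eq)
    qed
    finally have "1 / (6 * sqrt 6) \<le> 1 - 2 / sqrt (6::real)" by linarith
    then show ?case by simp
  next
    case (step n)
    define a b where "a = sqrt (real n)" and "b = sqrt (real (Suc n))"
    have ab: "0 < a" "a \<le> b" "b * b = real (Suc n)" "b * b = a * a + 1"
      using step by (auto simp: a_def b_def)
    have b: "0 < b" using ab by linarith
    have "2 / a - 2 / b = 2 * (b - a) / (a * b)"
      using ab b by (simp add: field_simps)
    also have "b - a = 1 / (a + b)"
      using ab b by (simp add: field_simps)
    also have "2 * (1 / (a + b)) / (a * b) = 2 / ((a + b) * (a * b))"
      by simp
    also have "\<dots> \<ge> 2 / ((b + b) * (b * b))"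
      using ab b by (intro divide_left_mono mult_mono mult_pos_pos) auto
    also have "2 / ((b + b) * (b * b)) = 1 / (real (Suc n) * b)"
      unfolding ab(3) using b by (simp add: field_simps del: of_nat_Suc)
    finally have "1 / (real (Suc n) * b) \<le> 2 / a - 2 / b" .
    then show ?case
      using step by (simp add: atLeastAtMostSuc_conv a_def b_def)
  qed
  moreover have "0 \<le> 2 / sqrt (real n)" by simp
  ultimately show ?thesis by (cases "6 \<le> n") (auto intro: order_trans)
qed

lemma exp_minus_le_quadratic:
  assumes "0 \<le> (y::real)"
  shows "exp (- y) \<le> 1 - y + y\<^sup>2 / 2"
proof -
  have "(1 - y + y\<^sup>2 / 2) - exp (- y) \<ge> (1 - 0 + 0\<^sup>2 / 2) - exp (- 0)"
  proof (rule DERIV_nonneg_imp_nondecreasing[OF assms])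
    fix x assume "0 \<le> x" "x \<le> y"
    have "((\<lambda>y. (1 - y + y\<^sup>2 / 2) - exp (- y)) has_real_derivative (x - 1 + exp (- x))) (at x)"
      by (auto intro!: derivative_eq_intros)
    moreover have "0 \<le> x - 1 + exp (- x)"
      using exp_ge_add_one_self[of "- x"] by simp
    ultimately show "\<exists>d. ((\<lambda>y. (1 - y + y\<^sup>2 / 2) - exp (- y)) has_real_derivative d) (at x) \<and> 0 \<le> d"
      by blast
  qed
  then show ?thesis by simp
qed

text \<open>\<open>36 <= N\<close> ensures \<open>6 <= sqrt N\<close>, so all indices from
  \<open>sqrt N\<close> on belong to the controlled range.\<close>

locale almost_gaussian_factors =
  fixes \<phi> :: "nat \<Rightarrow> complex \<Rightarrow> complex" and v :: "nat \<Rightarrow> real" and N :: nat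
  assumes N: "36 \<le> N"
    and norm_le_1: "\<And>k t. k \<in> {6..N} \<Longrightarrow> cmod (\<phi> k t) \<le> 1"
    and v_bounds: "\<And>k. k \<in> {6..N} \<Longrightarrow> 1 / (16 * real k) \<le> v k" "\<And>k. k \<in> {6..N} \<Longrightarrow> v k \<le> 10 / real k"
    and taylor: "\<And>k t. k \<in> {6..N} \<Longrightarrow>
      cmod (\<phi> k t - of_real (1 - v k * (cmod t)\<^sup>2 / 4)) \<le> 81 * (cmod t) ^ 3 / (real k * sqrt (real k))"
begin

text \<open>The variance of each real coordinate of the sum: half of the second absolute
  moment.\<close>

definition V :: real where "V = (\<Sum>k\<in>{6..N}. v k) / 2"

definition L :: real where "L = ln (real N)"

lemma sqrt_N: "6 \<le> sqrt (real N)"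
  using N by (intro real_le_rsqrt) simp

text \<open>With \<open>s = N^(1/4)\<close> the sum starts at \<open>m <= s^2 + 1\<close>, and
  \<open>s (s^2 + 1) <= s^4 = N\<close>. It is therefore at least
  \<open>ln (N / m) >= ln s = L / 4\<close>.\<close>

lemma sum_inverse_tail: "L / 4 \<le> (\<Sum>k\<in>{nat \<lceil>sqrt (real N)\<rceil>..N}. 1 / real k)"
proof -
  define s where "s = sqrt (sqrt (real N))"
  have s2: "s * s = sqrt (real N)" and s4: "s * s * (s * s) = real N"
    by (simp_all add: s_def)
  have s: "2 \<le> s"
    unfolding s_def using N by (intro real_le_rsqrt) auto
  define m where "m = nat \<lceil>sqrt (real N)\<rceil>"
  have m: "real m \<le> s * s + 1" "s * s \<le> real m"
    unfolding s2 m_def using sqrt_N by linarith+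
  have m0: "0 < m" using m sqrt_N unfolding s2 by (cases m) auto
  have mN: "m \<le> N"
  proof -
    have "s * s * 2 \<le> s * s * (s * s)"
      using s by (intro mult_left_mono) (auto intro: order_trans[OF _ mult_mono[of 2 s 1 s]])
    then have "s * s + 1 \<le> real N"
      using s4 s mult_mono[of 2 s 2 s] by simp
    then show ?thesis using m by simp
  qed
  have "L / 4 = ln s"
  proof -
    have "L = ln (s ^ 4)" by (simp add: L_def s4[symmetric] numeral_eq_Suc mult_ac)
    then show ?thesis using s by (simp add: ln_realpow)
  qed
  also have "ln s \<le> ln (real (Suc N) / real m)"
  proof -
    have "s * real m \<le> s * (s * s + 1)"
      using s m by (intro mult_left_mono) auto
    also have "\<dots> \<le> real N"
    proof -
      have "s * (s * s + 1) \<le> s * (s * s + s * s)"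
        using s mult_mono[of 1 s 1 s] by (intro mult_left_mono add_left_mono) auto
      also have "\<dots> = 2 * (s * s * s)" by simp
      also have "\<dots> \<le> s * (s * s * s)"
        using s by (intro mult_right_mono) auto
      finally show ?thesis using s4 by (simp add: mult_ac)
    qed
    finally have "s \<le> real (Suc N) / real m"
      using m0 by (simp add: field_simps)
    then show ?thesis using s by simp
  qed
  also have "\<dots> \<le> (\<Sum>k\<in>{m..N}. 1 / real k)"
    using m0 mN by (rule sum_inverse_ge_ln)
  finally show ?thesis by (simp add: m_def)
qed

lemma tail_subset: "{nat \<lceil>sqrt (real N)\<rceil>..N} \<subseteq> {6..N}"
proof -
  have "6 \<le> nat \<lceil>sqrt (real N)\<rceil>" using sqrt_N by linarith
  then show ?thesis by auto
qed

text \<open>The lower constant is \<open>1/2\<close> times \<open>1/16\<close> times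
  \<open>1/4\<close>, the last factor coming from the tail sum alone; the upper one is
  \<open>10 / 2\<close>.\<close>

lemma V_bounds: "L / 128 \<le> V" "V \<le> 5 * L"
proof -
  have "L / 4 \<le> (\<Sum>k\<in>{6..N}. 1 / real k)"
    using sum_inverse_tail by (rule order_trans) (intro sum_mono2 tail_subset, auto)
  also have "\<dots> = 16 * (\<Sum>k\<in>{6..N}. 1 / (16 * real k))"
    by (simp add: sum_distrib_left)
  also have "(\<Sum>k\<in>{6..N}. 1 / (16 * real k)) \<le> (\<Sum>k\<in>{6..N}. v k)"
    by (intro sum_mono v_bounds)
  finally show "L / 128 \<le> V" by (simp add: V_def)
  have "(\<Sum>k\<in>{6..N}. v k) \<le> (\<Sum>k\<in>{6..N}. 10 / real k)"
    by (intro sum_mono v_bounds)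
  also have "\<dots> = 10 * (\<Sum>k\<in>{6..N}. 1 / real k)"
    by (simp add: sum_distrib_left)
  also have "\<dots> \<le> 10 * L"
    using sum_inverse_le_ln[of 6 N] N by (simp add: L_def)
  finally show "V \<le> 5 * L" by (simp add: V_def)
qed

text \<open>Put \<open>x = |t| / sqrt k\<close>. The quadratic term removes at least
  \<open>x^2 / 64\<close>, the Taylor error returns at most \<open>81 x^3\<close>, and
  \<open>81 / 10400 <= 1 / 128\<close>; this is the origin of 10400.\<close>

lemma factor_decay:
  assumes k: "k \<in> {6..N}" and t: "cmod t \<le> sqrt (real k) / 10400"
  shows "cmod (\<phi> k t) \<le> exp (- (cmod t)\<^sup>2 / (128 * real k))"
proof -
  define s where "s = sqrt (real k)"
  define x where "x = cmod t / s"
  have s: "0 < s" "s * s = real k" using k by (auto simp: s_def)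
  have x: "0 \<le> x" "x \<le> 1 / 10400" using t s by (auto simp: x_def s_def[symmetric] field_simps)
  have tx: "cmod t = x * s" using s by (simp add: x_def)
  have x2: "x\<^sup>2 \<le> 1 / 10400"
    using x mult_mono[of x "1/10400" x 1] by (simp add: power2_eq_square)
  define y where "y = v k * (cmod t)\<^sup>2 / 4"
  have "y \<le> (10 / real k) * (cmod t)\<^sup>2 / 4"
    unfolding y_def using v_bounds[OF k] by (intro divide_right_mono mult_right_mono) auto
  also have "\<dots> = 10 * x\<^sup>2 / 4"
    using s by (simp add: tx power2_eq_square flip: s(2))
  also have "\<dots> \<le> 1" using x2 by simp
  finally have y1: "y \<le> 1" .
  have "(1 / (16 * real k)) * (cmod t)\<^sup>2 / 4 \<le> y"
    unfolding y_def using v_bounds[OF k] by (intro divide_right_mono mult_right_mono) auto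
  moreover have "(1 / (16 * real k)) * (cmod t)\<^sup>2 / 4 = x\<^sup>2 / 64"
    using s by (simp add: tx power2_eq_square flip: s(2))
  ultimately have y2: "x\<^sup>2 / 64 \<le> y" by simp
  have "81 * (cmod t) ^ 3 / (real k * sqrt (real k)) = 81 * x\<^sup>2 * x"
    using s by (simp add: tx power2_eq_square power3_eq_cube s_def[symmetric] flip: s(2))
  also have "\<dots> \<le> 81 * x\<^sup>2 * (1 / 10400)"
    using x by (intro mult_left_mono) auto
  also have "\<dots> \<le> x\<^sup>2 / 128" by simp
  finally have "cmod (\<phi> k t - of_real (1 - y)) \<le> x\<^sup>2 / 128"
    using taylor[OF k, of t] unfolding y_def by linarith
  moreover have "cmod (\<phi> k t) \<le> cmod (\<phi> k t - of_real (1 - y)) + cmod (of_real (1 - y))"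
    using norm_triangle_ineq[of "\<phi> k t - of_real (1 - y)" "of_real (1 - y)"] by simp
  moreover have "cmod (of_real (1 - y)) = 1 - y"
    unfolding norm_of_real using y1 by simp
  ultimately have "cmod (\<phi> k t) \<le> 1 + (- (x\<^sup>2 / 128))"
    using y2 by linarith
  also have "\<dots> \<le> exp (- (x\<^sup>2 / 128))" by (rule exp_ge_add_one_self)
  also have "x\<^sup>2 / 128 = (cmod t)\<^sup>2 / (128 * real k)"
    using s by (simp add: tx power2_eq_square flip: s(2))
  finally show ?thesis by simp
qed

lemma prod_decay:
  assumes t: "cmod t \<le> sqrt (sqrt (real N)) / 10400"
  shows "cmod (\<Prod>k\<in>{6..N}. \<phi> k t) \<le> exp (- (cmod t)\<^sup>2 * L / 512)"
proof -
  define m where "m = nat \<lceil>sqrt (real N)\<rceil>"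
  have sub: "{m..N} \<subseteq> {6..N}" unfolding m_def by (rule tail_subset)
  have "cmod (\<Prod>k\<in>{6..N}. \<phi> k t) = (\<Prod>k\<in>{6..N}. cmod (\<phi> k t))"
    by (simp add: prod_norm)
  also have "\<dots> = (\<Prod>k\<in>{6..N} - {m..N}. cmod (\<phi> k t)) * (\<Prod>k\<in>{m..N}. cmod (\<phi> k t))"
    by (rule prod.subset_diff[OF sub]) simp
  also have "\<dots> \<le> 1 * (\<Prod>k\<in>{m..N}. exp (- (cmod t)\<^sup>2 / (128 * real k)))"
  proof (intro mult_mono prod_mono prod_le_1 conjI)
    fix k assume k: "k \<in> {m..N}"
    have "sqrt (sqrt (real N)) \<le> sqrt (real k)"
      using k sqrt_N unfolding m_def by simp
    then have "cmod t \<le> sqrt (real k) / 10400"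
      using t by linarith
    then show "cmod (\<phi> k t) \<le> exp (- (cmod t)\<^sup>2 / (128 * real k))"
      using k sub by (intro factor_decay) auto
  qed (auto intro: norm_le_1 prod_nonneg)
  also have "\<dots> = exp (\<Sum>k\<in>{m..N}. - (cmod t)\<^sup>2 / (128 * real k))"
    by (simp add: exp_sum)
  also have "(\<Sum>k\<in>{m..N}. - (cmod t)\<^sup>2 / (128 * real k)) = - ((cmod t)\<^sup>2 / 128) * (\<Sum>k\<in>{m..N}. 1 / real k)"
    by (simp add: sum_distrib_left)
  also have "\<dots> \<le> - ((cmod t)\<^sup>2 / 128) * (L / 4)"
    using sum_inverse_tail by (intro mult_left_mono_neg) (auto simp: m_def)
  finally show ?thesis by simp
qed

text \<open>All factors lie in the unit disc, so the difference of the products is at most the sum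
  of the differences. Each costs 81 from Taylor and at most 4 from replacing \<open>1 - y\<close> by
  \<open>exp (- y)\<close>, times \<open>|t|^3 k^(-3/2)\<close>.\<close>

lemma prod_approx:
  assumes t: "cmod t \<le> 1"
  shows "cmod ((\<Prod>k\<in>{6..N}. \<phi> k t) - of_real (exp (- V * (cmod t)\<^sup>2 / 2))) \<le> 85 * (cmod t) ^ 3"
proof -
  define e where "e = (\<lambda>k. complex_of_real (exp (- (v k * (cmod t)\<^sup>2 / 4))))"
  have v0: "0 \<le> v k" if "k \<in> {6..N}" for k
    using v_bounds(1)[OF that] order_trans[of 0 "1 / (16 * real k)" "v k"] by simp
  have "complex_of_real (exp (- V * (cmod t)\<^sup>2 / 2)) = (\<Prod>k\<in>{6..N}. e k)"
  proof -
    have "- V * (cmod t)\<^sup>2 / 2 = (\<Sum>k\<in>{6..N}. - (v k * (cmod t)\<^sup>2 / 4))"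
      by (simp add: V_def sum_distrib_right sum_divide_distrib sum_negf)
    then show ?thesis by (simp add: e_def exp_sum)
  qed
  then have "cmod ((\<Prod>k\<in>{6..N}. \<phi> k t) - of_real (exp (- V * (cmod t)\<^sup>2 / 2))) = cmod ((\<Prod>k\<in>{6..N}. \<phi> k t) - (\<Prod>k\<in>{6..N}. e k))"
    by simp
  also have "\<dots> \<le> (\<Sum>k\<in>{6..N}. cmod (\<phi> k t - e k))"
    by (intro norm_prod_diff norm_le_1) (auto simp: e_def v0)
  also have "\<dots> \<le> (\<Sum>k\<in>{6..N}. 85 * (cmod t) ^ 3 * (1 / (real k * sqrt (real k))))"
  proof (rule sum_mono)
    fix k assume k: "k \<in> {6..N}"
    define y where "y = v k * (cmod t)\<^sup>2 / 4"
    have y: "0 \<le> y" using v0[OF k] by (simp add: y_def)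
    have "cmod (of_real (1 - y) - e k) = \<bar>1 - y - exp (- y)\<bar>"
      unfolding e_def y_def[symmetric] by (metis norm_of_real of_real_diff)
    also have "\<dots> \<le> y\<^sup>2 / 2"
    proof -
      have "1 - y \<le> exp (- y)" using exp_ge_add_one_self[of "- y"] by simp
      moreover have "exp (- y) \<le> 1 - y + y\<^sup>2 / 2"
        using y by (rule exp_minus_le_quadratic)
      ultimately show ?thesis by (simp add: abs_le_iff)
    qed
    also have "\<dots> \<le> ((10 / real k) * (cmod t)\<^sup>2 / 4)\<^sup>2 / 2"
      using y v_bounds(2)[OF k] unfolding y_def by (intro divide_right_mono power_mono mult_right_mono) auto
    also have "\<dots> = (25 / 8) * ((cmod t) ^ 4 * (1 / (real k * real k)))"
      by (simp add: power2_eq_square power4_eq_xxxx field_simps)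
    also have "\<dots> \<le> (25 / 8) * ((cmod t) ^ 3 * (1 / (real k * sqrt (real k))))"
    proof (intro mult_left_mono mult_mono divide_left_mono)
      show "cmod t ^ 4 \<le> cmod t ^ 3" using t by (intro power_decreasing) auto
      show "sqrt (real k) \<le> real k"
        using k real_sqrt_le_mono[of "real k" "(real k)\<^sup>2"] by (simp add: power2_eq_square del: real_sqrt_le_iff)
    qed (use k in auto)
    also have "\<dots> \<le> 4 * ((cmod t) ^ 3 * (1 / (real k * sqrt (real k))))"
      by (intro mult_right_mono) auto
    finally have "cmod (of_real (1 - y) - e k) \<le> 4 * cmod t ^ 3 * (1 / (real k * sqrt (real k)))"
      by (simp only: mult.assoc)
    moreover have "cmod (\<phi> k t - of_real (1 - y)) \<le> 81 * (cmod t) ^ 3 * (1 / (real k * sqrt (real k)))"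
      using taylor[OF k, of t] by (simp add: y_def)
    moreover have "cmod (\<phi> k t - e k) \<le> cmod (\<phi> k t - of_real (1 - y)) + cmod (of_real (1 - y) - e k)"
      using norm_triangle_ineq[of "\<phi> k t - of_real (1 - y)" "of_real (1 - y) - e k"] by simp
    ultimately have "cmod (\<phi> k t - e k) \<le> 81 * (cmod t) ^ 3 * (1 / (real k * sqrt (real k))) + 4 * cmod t ^ 3 * (1 / (real k * sqrt (real k)))"
      by linarith
    also have "\<dots> = 85 * (cmod t) ^ 3 * (1 / (real k * sqrt (real k)))"
      by simp
    finally show "cmod (\<phi> k t - e k) \<le> 85 * (cmod t) ^ 3 * (1 / (real k * sqrt (real k)))" .
  qed
  also have "\<dots> = 85 * (cmod t) ^ 3 * (\<Sum>k\<in>{6..N}. 1 / (real k * sqrt (real k)))"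
    by (rule sum_distrib_left[symmetric])
  also have "\<dots> \<le> 85 * (cmod t) ^ 3 * 1"
    by (intro mult_left_mono sum_inverse_three_halves_le) auto
  finally show ?thesis by simp
qed

text \<open>Near the origin the third order Taylor error wins, further out both sides are tiny.\<close>

lemma prod_gaussian:
  assumes \<eta>: "0 < \<eta>" and A: "1 \<le> A" "2 * exp (- A / 1024) \<le> \<eta>"
    and L: "A \<le> L" "85 * A * exp (A / 1024) / \<eta> \<le> L"
    and t: "cmod t \<le> sqrt (sqrt (real N)) / 10400"
  shows "cmod ((\<Prod>k\<in>{6..N}. \<phi> k t) - of_real (exp (- V * (cmod t)\<^sup>2 / 2))) \<le> \<eta> * exp (- (cmod t)\<^sup>2 * L / 1024)"
proof (cases "(cmod t)\<^sup>2 * L \<le> A")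
  case True
  have Lpos: "0 < L" using A L by linarith
  have t2: "(cmod t)\<^sup>2 \<le> A / L"
    using True Lpos by (simp add: field_simps)
  also have "\<dots> \<le> 1" using L Lpos by simp
  finally have t1: "cmod t \<le> 1" by (simp add: power_le_one_iff)
  have "cmod ((\<Prod>k\<in>{6..N}. \<phi> k t) - of_real (exp (- V * (cmod t)\<^sup>2 / 2))) \<le> 85 * (cmod t) ^ 3"
    by (rule prod_approx[OF t1])
  also have "\<dots> \<le> 85 * (cmod t)\<^sup>2"
    using t1 by (intro mult_left_mono power_decreasing) auto
  also have "\<dots> \<le> 85 * (A / L)"
    using t2 by simp
  also have "\<dots> \<le> \<eta> * exp (- A / 1024)"
    using L(2) Lpos \<eta> by (simp add: exp_minus field_simps)
  also have "\<dots> \<le> \<eta> * exp (- (cmod t)\<^sup>2 * L / 1024)"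
    using True \<eta> by simp
  finally show ?thesis .
next
  case False
  have Lpos: "0 < L" using A L by linarith
  have "V * (cmod t)\<^sup>2 / 2 \<ge> (L / 128) * (cmod t)\<^sup>2 / 2"
    using V_bounds by (intro divide_right_mono mult_right_mono) auto
  moreover have "(L / 128) * (cmod t)\<^sup>2 / 2 \<ge> (cmod t)\<^sup>2 * L / 512"
    using Lpos by (simp add: field_simps)
  ultimately have "exp (- V * (cmod t)\<^sup>2 / 2) \<le> exp (- (cmod t)\<^sup>2 * L / 512)"
    by simp
  then have "cmod ((\<Prod>k\<in>{6..N}. \<phi> k t) - of_real (exp (- V * (cmod t)\<^sup>2 / 2))) \<le> 2 * exp (- (cmod t)\<^sup>2 * L / 512)"
    using prod_decay[OF t] norm_triangle_ineq4[of "\<Prod>k\<in>{6..N}. \<phi> k t" "of_real (exp (- V * (cmod t)\<^sup>2 / 2))"]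
    unfolding norm_of_real abs_exp_cancel by linarith
  \<comment> \<open>Half of the exponent, at least \<open>A / 1024\<close> here, pays for the small
    factor \<open>\<eta>\<close>; the other half is kept as decay.\<close>
  also have "\<dots> = 2 * exp (- ((cmod t)\<^sup>2 * L) / 1024) * exp (- (cmod t)\<^sup>2 * L / 1024)"
    by (simp add: exp_add[symmetric])
  also have "\<dots> \<le> 2 * exp (- A / 1024) * exp (- (cmod t)\<^sup>2 * L / 1024)"
    using False by (intro mult_right_mono) auto
  also have "\<dots> \<le> \<eta> * exp (- (cmod t)\<^sup>2 * L / 1024)"
    using A by (intro mult_right_mono) auto
  finally show ?thesis .
qed

end

section \<open>Gaussian smoothing\<close>

lemma (in pair_sigma_finite) integral_product:
  fixes f :: "'a \<Rightarrow> complex" and g :: "'b \<Rightarrow> complex"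
  assumes f: "integrable M1 f" and g: "integrable M2 g"
  shows "integrable (M1 \<Otimes>\<^sub>M M2) (\<lambda>(x, y). f x * g y)"
    and "(\<integral>p. (case p of (x, y) \<Rightarrow> f x * g y) \<partial>(M1 \<Otimes>\<^sub>M M2)) = (\<integral>x. f x \<partial>M1) * (\<integral>y. g y \<partial>M2)"
proof -
  have [measurable]: "f \<in> borel_measurable M1" "g \<in> borel_measurable M2"
    using f g by auto
  show i: "integrable (M1 \<Otimes>\<^sub>M M2) (\<lambda>(x, y). f x * g y)"
  proof (rule Fubini_integrable)
    show "integrable M1 (\<lambda>x. \<integral>y. norm (case (x, y) of (x, y) \<Rightarrow> f x * g y) \<partial>M2)"
      using f by (simp add: norm_mult)
    show "AE x in M1. integrable M2 (\<lambda>y. case (x, y) of (x, y) \<Rightarrow> f x * g y)"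
      using g by simp
  qed measurable
  show "(\<integral>p. (case p of (x, y) \<Rightarrow> f x * g y) \<partial>(M1 \<Otimes>\<^sub>M M2)) = (\<integral>x. f x \<partial>M1) * (\<integral>y. g y \<partial>M2)"
    using integral_fst'[OF i] by simp
qed

abbreviation \<gamma> :: "real measure" where "\<gamma> \<equiv> std_normal_distribution"

lemma std_normal_fourier:
  fixes a s :: real
  assumes a: "-1 < a"
  shows "integrable \<gamma> (\<lambda>x. iexp (s * x) * of_real (exp (- a * x\<^sup>2 / 2)))"
    and "(\<integral>x. iexp (s * x) * of_real (exp (- a * x\<^sup>2 / 2)) \<partial>\<gamma>) = of_real (exp (- s\<^sup>2 / (2 * (1 + a))) / sqrt (1 + a))"
proof -
  interpret G: prob_space \<gamma>
    by (rule prob_space_normal_density) simp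
  define r where "r = 1 / sqrt (1 + a)"
  have r: "0 < r" "r\<^sup>2 * (1 + a) = 1" using a by (simp_all add: r_def power_divide)
  define h where "h = (\<lambda>x. std_normal_density x *\<^sub>R (iexp (s * x) * complex_of_real (exp (- a * x\<^sup>2 / 2))))"
  have hr: "h (0 + r * x) = std_normal_density x *\<^sub>R iexp (s * r * x)" for x
  proof -
    have "- ((r * x)\<^sup>2) / 2 + (- a * (r * x)\<^sup>2 / 2) = - (r\<^sup>2 * (1 + a)) * x\<^sup>2 / 2"
      by (simp add: power_mult_distrib field_simps)
    then have "exp (- ((r * x)\<^sup>2) / 2) * exp (- a * (r * x)\<^sup>2 / 2) = exp (- x\<^sup>2 / 2)"
      using r by (simp flip: exp_add)
    then have "std_normal_density (r * x) * exp (- a * (r * x)\<^sup>2 / 2) = std_normal_density x"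
      by (simp add: std_normal_density_def)
    moreover have "h (0 + r * x) = (std_normal_density (r * x) * exp (- a * (r * x)\<^sup>2 / 2)) *\<^sub>R iexp (s * r * x)"
      unfolding h_def by (simp add: scaleR_conv_of_real mult_ac del: of_real_exp)
    ultimately show ?thesis by simp
  qed
  have "integrable \<gamma> (\<lambda>x. iexp (s * r * x))"
    by (intro G.integrable_const_bound[of _ 1]) auto
  then have "integrable lborel (\<lambda>x. std_normal_density x *\<^sub>R iexp (s * r * x))"
    by (subst (asm) integrable_density) auto
  then have "integrable lborel (\<lambda>x. h (0 + r * x))"
    by (simp only: hr)
  then have ih: "integrable lborel h"
    using r lborel_integrable_real_affine_iff[of r h 0] by simp
  then show "integrable \<gamma> (\<lambda>x. iexp (s * x) * of_real (exp (- a * x\<^sup>2 / 2)))"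
    by (subst integrable_density) (auto simp: h_def)
  have "(\<integral>x. iexp (s * x) * of_real (exp (- a * x\<^sup>2 / 2)) \<partial>\<gamma>) = (\<integral>x. h x \<partial>lborel)"
    by (subst integral_density) (auto simp: h_def)
  also have "\<dots> = r *\<^sub>R (\<integral>x. std_normal_density x *\<^sub>R iexp (s * r * x) \<partial>lborel)"
    using r lborel_integral_real_affine[of r h 0] by (simp only: hr) simp
  also have "(\<integral>x. std_normal_density x *\<^sub>R iexp (s * r * x) \<partial>lborel) = (\<integral>x. iexp (s * r * x) \<partial>\<gamma>)"
    by (subst integral_density) auto
  also have "\<dots> = of_real (exp (- (s * r)\<^sup>2 / 2))"
    using fun_cong[OF char_std_normal_distribution, of "s * r"] by (simp add: char_def)
  also have "(s * r)\<^sup>2 = s\<^sup>2 / (1 + a)"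
    using a by (simp add: r_def power_mult_distrib power_divide)
  finally show "(\<integral>x. iexp (s * x) * of_real (exp (- a * x\<^sup>2 / 2)) \<partial>\<gamma>) = of_real (exp (- s\<^sup>2 / (2 * (1 + a))) / sqrt (1 + a))"
    by (simp add: r_def scaleR_conv_of_real mult_ac)
qed

section \<open>Gaussian frequencies in the complex plane\<close>

definition cgauss :: "complex measure" where
  "cgauss = distr (\<gamma> \<Otimes>\<^sub>M \<gamma>) borel (\<lambda>(x, y). Complex x y)"

lemma measurable_Complex_pair: "(\<lambda>(x, y). Complex x y) \<in> borel_measurable (\<gamma> \<Otimes>\<^sub>M \<gamma>)"
proof -
  have "(\<lambda>p :: real \<times> real. complex_of_real (fst p) + \<i> * complex_of_real (snd p)) \<in> borel_measurable (\<gamma> \<Otimes>\<^sub>M \<gamma>)"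
    by measurable
  then show ?thesis
    by (simp add: Complex_eq split_beta')
qed

lemma sets_cgauss [simp, measurable_cong]: "sets cgauss = sets borel"
  by (simp add: cgauss_def)

lemma prob_space_cgauss: "prob_space cgauss"
proof -
  interpret G: prob_space \<gamma>
    by (rule prob_space_normal_density) simp
  interpret GG: pair_prob_space \<gamma> \<gamma> ..
  show ?thesis
    unfolding cgauss_def by (rule GG.prob_space_distr[OF measurable_Complex_pair])
qed

lemma cgauss_fourier:
  fixes a :: real and u :: complex
  assumes a: "-1 < a"
  shows "integrable cgauss (\<lambda>g. iexp (Re (cnj g * u)) * of_real (exp (- a * (cmod g)\<^sup>2 / 2)))"
    and "(\<integral>g. iexp (Re (cnj g * u)) * of_real (exp (- a * (cmod g)\<^sup>2 / 2)) \<partial>cgauss) = of_real (exp (- (cmod u)\<^sup>2 / (2 * (1 + a))) / (1 + a))"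
proof -
  interpret G: prob_space \<gamma>
    by (rule prob_space_normal_density) simp
  interpret GG: pair_prob_space \<gamma> \<gamma> ..
  let ?F = "\<lambda>g. iexp (Re (cnj g * u)) * complex_of_real (exp (- a * (cmod g)\<^sup>2 / 2))"
  let ?f = "\<lambda>s x. iexp (s * x) * complex_of_real (exp (- a * x\<^sup>2 / 2))"
  have mF: "?F \<in> borel_measurable borel"
    by measurable
  have eq: "?F (case p of (x, y) \<Rightarrow> Complex x y) = (case p of (x, y) \<Rightarrow> ?f (Re u) x * ?f (Im u) y)" for p
  proof (cases p)
    case (Pair x y)
    have "iexp (Re (cnj (Complex x y) * u)) = iexp (Re u * x) * iexp (Im u * y)"
      by (simp add: exp_add[symmetric] algebra_simps)
    moreover have "complex_of_real (exp (- a * (cmod (Complex x y))\<^sup>2 / 2)) = complex_of_real (exp (- a * x\<^sup>2 / 2)) * complex_of_real (exp (- a * y\<^sup>2 / 2))"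
      by (simp add: cmod_power2 algebra_simps add_divide_distrib diff_divide_distrib flip: exp_add of_real_mult)
    ultimately show ?thesis by (simp add: Pair)
  qed
  have "integrable (\<gamma> \<Otimes>\<^sub>M \<gamma>) (\<lambda>p. ?F (case p of (x, y) \<Rightarrow> Complex x y))"
    unfolding eq by (rule GG.integral_product(1)[OF std_normal_fourier(1)[OF a] std_normal_fourier(1)[OF a]])
  then show "integrable cgauss ?F"
    unfolding cgauss_def by (subst integrable_distr_eq[OF measurable_Complex_pair mF])
  have "(\<integral>g. ?F g \<partial>cgauss) = (\<integral>p. ?F (case p of (x, y) \<Rightarrow> Complex x y) \<partial>(\<gamma> \<Otimes>\<^sub>M \<gamma>))"
    unfolding cgauss_def by (rule integral_distr[OF measurable_Complex_pair mF])
  also have "\<dots> = (\<integral>x. ?f (Re u) x \<partial>\<gamma>) * (\<integral>x. ?f (Im u) x \<partial>\<gamma>)"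
    unfolding eq by (rule GG.integral_product(2)[OF std_normal_fourier(1)[OF a] std_normal_fourier(1)[OF a]])
  also have "\<dots> = of_real ((exp (- (Re u)\<^sup>2 / (2 * (1 + a))) / sqrt (1 + a)) * (exp (- (Im u)\<^sup>2 / (2 * (1 + a))) / sqrt (1 + a)))"
    by (simp only: std_normal_fourier(2)[OF a], simp only: of_real_mult)
  also have "(exp (- (Re u)\<^sup>2 / (2 * (1 + a))) / sqrt (1 + a)) * (exp (- (Im u)\<^sup>2 / (2 * (1 + a))) / sqrt (1 + a))
    = exp (- (Re u)\<^sup>2 / (2 * (1 + a)) + - (Im u)\<^sup>2 / (2 * (1 + a))) / (1 + a)"
    unfolding exp_add using a by simp
  also have "- (Re u)\<^sup>2 / (2 * (1 + a)) + - (Im u)\<^sup>2 / (2 * (1 + a)) = - (cmod u)\<^sup>2 / (2 * (1 + a))"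
    by (simp only: cmod_power2 minus_add_distrib add_divide_distrib)
  finally show "(\<integral>g. ?F g \<partial>cgauss) = of_real (exp (- (cmod u)\<^sup>2 / (2 * (1 + a))) / (1 + a))" .
qed

lemma cgauss_exp:
  fixes a :: real
  assumes a: "-1 < a"
  shows "integrable cgauss (\<lambda>g. exp (- a * (cmod g)\<^sup>2 / 2))"
    and "(\<integral>g. exp (- a * (cmod g)\<^sup>2 / 2) \<partial>cgauss) = 1 / (1 + a)"
proof -
  have 1: "integrable cgauss (\<lambda>g. complex_of_real (exp (- a * (cmod g)\<^sup>2 / 2)))"
    using cgauss_fourier(1)[OF a, of 0] by simp
  then show "integrable cgauss (\<lambda>g. exp (- a * (cmod g)\<^sup>2 / 2))"
    using complex_of_real_integrable_eq by blast
  have "complex_of_real (\<integral>g. exp (- a * (cmod g)\<^sup>2 / 2) \<partial>cgauss) = of_real (1 / (1 + a))"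
    using cgauss_fourier(2)[OF a, of 0] by (simp flip: integral_complex_of_real)
  then show "(\<integral>g. exp (- a * (cmod g)\<^sup>2 / 2) \<partial>cgauss) = 1 / (1 + a)"
    using of_real_eq_iff by blast
qed

text \<open>A Gaussian is its own Fourier transform: here it is an average of characters over the
  random frequency \<open>g / \<sigma>\<close>.\<close>

lemma gaussian_as_fourier:
  assumes "0 < \<sigma>"
  shows "complex_of_real (exp (- (cmod u)\<^sup>2 / (2 * \<sigma>\<^sup>2))) = (\<integral>g. iexp (Re (cnj (g / of_real \<sigma>) * u)) \<partial>cgauss)"
proof -
  have "(\<integral>g. iexp (Re (cnj g * (u / of_real \<sigma>))) * of_real (exp (- 0 * (cmod g)\<^sup>2 / 2)) \<partial>cgauss) =
      of_real (exp (- (cmod (u / of_real \<sigma>))\<^sup>2 / (2 * (1 + 0))) / (1 + 0))"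
    by (rule cgauss_fourier) simp
  moreover have "cnj g * (u / of_real \<sigma>) = cnj (g / of_real \<sigma>) * u" for g
    by simp
  moreover have "- (cmod (u / of_real \<sigma>))\<^sup>2 / (2 * (1 + 0)) = - (cmod u)\<^sup>2 / (2 * \<sigma>\<^sup>2)"
    by (simp add: norm_divide power_divide)
  ultimately show ?thesis
    by simp
qed

text \<open>For a Gaussian test function, Fourier inversion is Fubini on two probability spaces; the
  integrand has modulus 1.\<close>

lemma smoothed_inversion:
  fixes S :: "'a \<Rightarrow> complex"
  assumes "prob_space P" and S [measurable]: "S \<in> borel_measurable P" and \<sigma>: "0 < \<sigma>"
  shows "complex_of_real (\<integral>x. exp (- (cmod (S x - w))\<^sup>2 / (2 * \<sigma>\<^sup>2)) \<partial>P) =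
    (\<integral>g. iexp (Re (cnj (g / of_real \<sigma>) * - w)) * (\<integral>x. iexp (Re (cnj (g / of_real \<sigma>) * S x)) \<partial>P) \<partial>cgauss)"
proof -
  interpret P: prob_space P by fact
  interpret G: prob_space cgauss by (rule prob_space_cgauss)
  interpret PG: pair_prob_space P cgauss ..
  have "integrable (P \<Otimes>\<^sub>M cgauss) (\<lambda>(x, g). iexp (Re (cnj (g / of_real \<sigma>) * (S x - w))))"
    by (intro PG.integrable_const_bound[of _ 1]) (auto simp: split_beta)
  note F = PG.Fubini_integral[OF this]
  have "complex_of_real (\<integral>x. exp (- (cmod (S x - w))\<^sup>2 / (2 * \<sigma>\<^sup>2)) \<partial>P) = (\<integral>x. complex_of_real (exp (- (cmod (S x - w))\<^sup>2 / (2 * \<sigma>\<^sup>2))) \<partial>P)"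
    by (rule integral_complex_of_real[symmetric])
  also have "\<dots> = (\<integral>x. (\<integral>g. iexp (Re (cnj (g / of_real \<sigma>) * (S x - w))) \<partial>cgauss) \<partial>P)"
    by (simp only: gaussian_as_fourier[OF \<sigma>])
  also have "\<dots> = (\<integral>g. (\<integral>x. iexp (Re (cnj (g / of_real \<sigma>) * (S x - w))) \<partial>P) \<partial>cgauss)"
    using F by simp
  also have "\<dots> = (\<integral>g. iexp (Re (cnj (g / of_real \<sigma>) * - w)) * (\<integral>x. iexp (Re (cnj (g / of_real \<sigma>) * S x)) \<partial>P) \<partial>cgauss)"
  proof (intro Bochner_Integration.integral_cong refl)
    fix g
    have "iexp (Re (cnj (g / of_real \<sigma>) * (S x - w))) = iexp (Re (cnj (g / of_real \<sigma>) * - w)) * iexp (Re (cnj (g / of_real \<sigma>) * S x))" for x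
      by (simp only: exp_add[symmetric] diff_conv_add_uminus distrib_left plus_complex.simps of_real_add add.commute)
    then show "(\<integral>x. iexp (Re (cnj (g / of_real \<sigma>) * (S x - w))) \<partial>P) = iexp (Re (cnj (g / of_real \<sigma>) * - w)) * (\<integral>x. iexp (Re (cnj (g / of_real \<sigma>) * S x)) \<partial>P)"
      by (simp only: integral_mult_right_zero)
  qed
  finally show ?thesis .
qed

text \<open>Up to \<open>\<rho>\<close> the hypothesis \<open>near\<close> applies. Beyond, the
  difference is at most 2, hence at most \<open>2 exp (\<sigma>^2 (|t|^2 - \<rho>^2) / 4)\<close>;
  in \<open>g = \<sigma> t\<close> this grows like \<open>exp (|g|^2 / 4)\<close>, which the
  Gaussian weight still integrates, to 2. That explains the constant 4.\<close>

lemma smoothed_compare: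
  fixes \<phi> :: "complex \<Rightarrow> complex" and V \<eta> b \<rho> \<sigma> :: real
  assumes \<phi> [measurable]: "\<phi> \<in> borel_measurable borel" and \<phi>1: "\<And>t. cmod (\<phi> t) \<le> 1"
    and V: "0 \<le> V" and \<eta>: "0 \<le> \<eta>" and b: "0 < b" and \<rho>: "0 \<le> \<rho>" and \<sigma>: "0 < \<sigma>"
    and near: "\<And>t. cmod t \<le> \<rho> \<Longrightarrow> cmod (\<phi> t - of_real (exp (- V * (cmod t)\<^sup>2 / 2))) \<le> \<eta> * exp (- b * (cmod t)\<^sup>2)"
  shows "cmod ((\<integral>g. iexp (Re (cnj (g / of_real \<sigma>) * - w)) * \<phi> (g / of_real \<sigma>) \<partial>cgauss)
      - of_real (\<sigma>\<^sup>2 / (\<sigma>\<^sup>2 + V) * exp (- (cmod w)\<^sup>2 / (2 * (\<sigma>\<^sup>2 + V))))) \<le> \<eta> * \<sigma>\<^sup>2 / (2 * b) + 4 * exp (- \<sigma>\<^sup>2 * \<rho>\<^sup>2 / 4)"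
proof -
  interpret G: prob_space cgauss by (rule prob_space_cgauss)
  define e where "e = (\<lambda>g. iexp (Re (cnj (g / of_real \<sigma>) * - w)))"
  define k where "k = (\<lambda>g. complex_of_real (exp (- V * (cmod (g / of_real \<sigma>))\<^sup>2 / 2)))"
  have [measurable]: "e \<in> borel_measurable borel" "k \<in> borel_measurable borel"
    unfolding e_def k_def by measurable
  have e1: "cmod (e g) = 1" for g by (simp add: e_def)
  have k1: "cmod (k g) \<le> 1" for g
    unfolding k_def norm_of_real using V by simp
  have "0 \<le> 2 * b / \<sigma>\<^sup>2" using b by simp
  then have *: "-1 < 2 * b / \<sigma>\<^sup>2" "-1 < (-1/2 :: real)" by linarith+
  have j1: "integrable cgauss (\<lambda>g. \<eta> * exp (- (2 * b / \<sigma>\<^sup>2) * (cmod g)\<^sup>2 / 2))"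
    by (rule integrable_mult_right, rule cgauss_exp(1)[OF *(1)])
  have j2: "integrable cgauss (\<lambda>g. 2 * exp (- \<sigma>\<^sup>2 * \<rho>\<^sup>2 / 4) * exp (- (-1/2) * (cmod g)\<^sup>2 / 2))"
    by (rule integrable_mult_right, rule cgauss_exp(1)[OF *(2)])
  have i1: "integrable cgauss (\<lambda>g. e g * \<phi> (g / of_real \<sigma>))"
    by (intro G.integrable_const_bound[of _ 1]) (auto simp: norm_mult e1 \<phi>1)
  have i2: "integrable cgauss (\<lambda>g. e g * k g)"
    by (intro G.integrable_const_bound[of _ 1]) (auto simp: norm_mult e1 k1)
  have "(\<integral>g. e g * k g \<partial>cgauss) = of_real (\<sigma>\<^sup>2 / (\<sigma>\<^sup>2 + V) * exp (- (cmod w)\<^sup>2 / (2 * (\<sigma>\<^sup>2 + V))))"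
  proof -
    have a: "-1 < V / \<sigma>\<^sup>2" using divide_nonneg_nonneg[OF V zero_le_power2[of \<sigma>]] by linarith
    have "e g * k g = iexp (Re (cnj g * (- w / of_real \<sigma>))) * of_real (exp (- (V / \<sigma>\<^sup>2) * (cmod g)\<^sup>2 / 2))" for g
      using \<sigma> by (simp add: e_def k_def norm_divide power_divide del: of_real_exp)
    then have "(\<integral>g. e g * k g \<partial>cgauss) = of_real (exp (- (cmod (- w / of_real \<sigma>))\<^sup>2 / (2 * (1 + V / \<sigma>\<^sup>2))) / (1 + V / \<sigma>\<^sup>2))"
      by (simp only: cgauss_fourier(2)[OF a])
    also have "(cmod (- w / of_real \<sigma>))\<^sup>2 = (cmod w)\<^sup>2 / \<sigma>\<^sup>2"
      using \<sigma> by (simp add: norm_divide power_divide)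
    also have "- ((cmod w)\<^sup>2 / \<sigma>\<^sup>2) / (2 * (1 + V / \<sigma>\<^sup>2)) = - (cmod w)\<^sup>2 / (2 * (\<sigma>\<^sup>2 + V))"
      using \<sigma> V by (simp add: field_simps add_pos_nonneg)
    also have "exp (- (cmod w)\<^sup>2 / (2 * (\<sigma>\<^sup>2 + V))) / (1 + V / \<sigma>\<^sup>2) = \<sigma>\<^sup>2 / (\<sigma>\<^sup>2 + V) * exp (- (cmod w)\<^sup>2 / (2 * (\<sigma>\<^sup>2 + V)))"
    proof -
      have "1 + V / \<sigma>\<^sup>2 = (\<sigma>\<^sup>2 + V) / \<sigma>\<^sup>2" using \<sigma> by (simp add: field_simps)
      then show ?thesis by simp
    qed
    finally show ?thesis .
  qed
  then have eqn: "(\<integral>g. e g * \<phi> (g / of_real \<sigma>) \<partial>cgauss) - of_real (\<sigma>\<^sup>2 / (\<sigma>\<^sup>2 + V) * exp (- (cmod w)\<^sup>2 / (2 * (\<sigma>\<^sup>2 + V))))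
    = (\<integral>g. e g * (\<phi> (g / of_real \<sigma>) - k g) \<partial>cgauss)"
    using i1 i2 by (simp add: right_diff_distrib)
  have "cmod (\<integral>g. e g * (\<phi> (g / of_real \<sigma>) - k g) \<partial>cgauss) \<le> (\<integral>g. \<eta> * exp (- (2 * b / \<sigma>\<^sup>2) * (cmod g)\<^sup>2 / 2) + 2 * exp (- \<sigma>\<^sup>2 * \<rho>\<^sup>2 / 4) * exp (- (-1/2) * (cmod g)\<^sup>2 / 2) \<partial>cgauss)"
  proof (rule order_trans[OF integral_norm_bound integral_mono])
    show "integrable cgauss (\<lambda>g. cmod (e g * (\<phi> (g / of_real \<sigma>) - k g)))"
      using i1 i2 by (intro integrable_norm) (simp add: right_diff_distrib)
    show "integrable cgauss (\<lambda>g. \<eta> * exp (- (2 * b / \<sigma>\<^sup>2) * (cmod g)\<^sup>2 / 2) + 2 * exp (- \<sigma>\<^sup>2 * \<rho>\<^sup>2 / 4) * exp (- (-1/2) * (cmod g)\<^sup>2 / 2))"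
      by (rule Bochner_Integration.integrable_add[OF j1 j2])
  next
    fix g :: complex
    define t where "t = g / of_real \<sigma>"
    have g: "(cmod g)\<^sup>2 = \<sigma>\<^sup>2 * (cmod t)\<^sup>2"
      using \<sigma> by (simp add: t_def norm_divide power_divide)
    have "cmod (e g * (\<phi> (g / of_real \<sigma>) - k g)) = cmod (\<phi> t - k g)"
      by (simp add: norm_mult e1 t_def)
    also have "\<dots> \<le> \<eta> * exp (- b * (cmod t)\<^sup>2) + 2 * exp (\<sigma>\<^sup>2 * (cmod t)\<^sup>2 / 4 - \<sigma>\<^sup>2 * \<rho>\<^sup>2 / 4)"
    proof (cases "cmod t \<le> \<rho>")
      case True
      then have "cmod (\<phi> t - k g) \<le> \<eta> * exp (- b * (cmod t)\<^sup>2)"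
        unfolding k_def t_def[symmetric] by (rule near)
      moreover have "0 \<le> 2 * exp (\<sigma>\<^sup>2 * (cmod t)\<^sup>2 / 4 - \<sigma>\<^sup>2 * \<rho>\<^sup>2 / 4)"
        by simp
      ultimately show ?thesis by linarith
    next
      case False
      then have "\<sigma>\<^sup>2 * \<rho>\<^sup>2 \<le> \<sigma>\<^sup>2 * (cmod t)\<^sup>2"
        using \<rho> by (intro mult_left_mono power_mono) auto
      then have "1 \<le> exp (\<sigma>\<^sup>2 * (cmod t)\<^sup>2 / 4 - \<sigma>\<^sup>2 * \<rho>\<^sup>2 / 4)" by simp
      moreover have "cmod (\<phi> t - k g) \<le> 2"
        using norm_triangle_ineq4[of "\<phi> t" "k g"] \<phi>1[of t] k1[of g] by linarith
      moreover have "0 \<le> \<eta> * exp (- b * (cmod t)\<^sup>2)" using \<eta> by simp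
      ultimately show ?thesis by linarith
    qed
    also have "- b * (cmod t)\<^sup>2 = - (2 * b / \<sigma>\<^sup>2) * (cmod g)\<^sup>2 / 2"
      using \<sigma> by (simp add: g)
    also have "exp (\<sigma>\<^sup>2 * (cmod t)\<^sup>2 / 4 - \<sigma>\<^sup>2 * \<rho>\<^sup>2 / 4) = exp (- \<sigma>\<^sup>2 * \<rho>\<^sup>2 / 4) * exp (- (-1/2) * (cmod g)\<^sup>2 / 2)"
      by (simp add: g flip: exp_add)
    finally show "cmod (e g * (\<phi> (g / of_real \<sigma>) - k g)) \<le> \<eta> * exp (- (2 * b / \<sigma>\<^sup>2) * (cmod g)\<^sup>2 / 2) + 2 * exp (- \<sigma>\<^sup>2 * \<rho>\<^sup>2 / 4) * exp (- (-1/2) * (cmod g)\<^sup>2 / 2)"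
      by (simp only: mult.assoc)
  qed
  also have "\<dots> = \<eta> * (1 / (1 + 2 * b / \<sigma>\<^sup>2)) + 2 * exp (- \<sigma>\<^sup>2 * \<rho>\<^sup>2 / 4) * (1 / (1 + (-1/2)))"
  proof -
    show ?thesis
      unfolding Bochner_Integration.integral_add[OF j1 j2] integral_mult_right_zero
        cgauss_exp(2)[OF *(1)] cgauss_exp(2)[OF *(2)] ..
  qed
  also have "\<dots> \<le> \<eta> * \<sigma>\<^sup>2 / (2 * b) + 4 * exp (- \<sigma>\<^sup>2 * \<rho>\<^sup>2 / 4)"
  proof -
    have "1 / (1 + 2 * b / \<sigma>\<^sup>2) \<le> 1 / (2 * b / \<sigma>\<^sup>2)"
      using b \<sigma> by (intro frac_le divide_pos_pos) simp_all
    also have "\<dots> = \<sigma>\<^sup>2 / (2 * b)" by simp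
    finally have "\<eta> * (1 / (1 + 2 * b / \<sigma>\<^sup>2)) \<le> \<eta> * (\<sigma>\<^sup>2 / (2 * b))"
      using \<eta> by (intro mult_left_mono)
    then show ?thesis by simp
  qed
  finally show ?thesis
    unfolding eqn[symmetric] by (simp only: e_def)
qed

text \<open>A test function below an indicator function whose Fourier transform is a combination of
  Gaussians, and which still has a positive integral.\<close>

lemma gaussian_difference_le_indicator:
  assumes \<sigma>: "0 < \<sigma>"
  shows "exp (- (cmod u)\<^sup>2 / (2 * \<sigma>\<^sup>2)) - exp (- (cmod u)\<^sup>2 / (2 * (2 * \<sigma>)\<^sup>2)) / 8 \<le> indicator {u. cmod u < 3 * \<sigma>} u"
proof -
  define x where "x = (cmod u)\<^sup>2 / (8 * \<sigma>\<^sup>2)"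
  have x0: "0 \<le> x" by (simp add: x_def)
  have 1: "- (cmod u)\<^sup>2 / (2 * \<sigma>\<^sup>2) = - 4 * x" "- (cmod u)\<^sup>2 / (2 * (2 * \<sigma>)\<^sup>2) = - x"
    using \<sigma> by (simp_all add: x_def power_mult_distrib)
  show ?thesis
  proof (cases "cmod u < 3 * \<sigma>")
    case True
    have "exp (- 4 * x) \<le> 1" using x0 by simp
    moreover have "0 < exp (- x) / 8" by simp
    ultimately have "exp (- 4 * x) - exp (- x) / 8 \<le> 1" by linarith
    then show ?thesis using True unfolding 1 by simp
  next
    case False
    then have "(3 * \<sigma>)\<^sup>2 \<le> (cmod u)\<^sup>2"
      using \<sigma> by (intro power_mono) auto
    \<comment> \<open>Outside radius \<open>3 \<sigma>\<close> one has
      \<open>3 x >= 27 / 8 > 3\<close>, so \<open>exp (3 x) >= exp 3 >= 8\<close> and the wide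
      Gaussian over 8 outweighs the narrow one.\<close>
    then have x: "9 / 8 \<le> x"
      using \<sigma> by (simp add: x_def field_simps)
    have "8 = (2::real) ^ 3" by simp
    also have "\<dots> \<le> exp 1 ^ 3"
      using exp_ge_add_one_self[of 1] by (intro power_mono) auto
    also have "\<dots> = exp (3::real)" by (simp flip: exp_of_nat_mult)
    also have "\<dots> \<le> exp (3 * x)" using x by simp
    finally have "8 * exp (- 4 * x) \<le> exp (3 * x) * exp (- 4 * x)"
      by (intro mult_right_mono) auto
    also have "\<dots> = exp (- x)" by (simp flip: exp_add)
    finally show ?thesis using False unfolding 1 by simp
  qed
qed

text \<open>\<open>H\<close> is the smoothed probability, \<open>R\<close> its value for an exact
  Gaussian. The wide Gaussian has four times the mass of the narrow one, so with weight
  \<open>1 / 8\<close> it removes about half of the main term.\<close>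

lemma local_probability_lower_bound:
  fixes S :: "'a \<Rightarrow> complex" and V L \<rho> \<sigma> :: real
  assumes P: "prob_space P" and S [measurable]: "S \<in> borel_measurable P"
    and \<sigma>: "0 < \<sigma>" "\<sigma> \<le> 1" and L: "0 < L" and V: "V \<le> 5 * L" "10 \<le> V" and w: "(cmod w)\<^sup>2 \<le> V / 5" and \<rho>: "0 \<le> \<rho>"
    and near: "\<And>t. cmod t \<le> \<rho> \<Longrightarrow> cmod ((\<integral>x. iexp (Re (cnj t * S x)) \<partial>P) - of_real (exp (- V * (cmod t)\<^sup>2 / 2))) \<le> 1 / 40000 * exp (- (L / 1024) * (cmod t)\<^sup>2)"
    and tail: "225 * exp (- \<sigma>\<^sup>2 * \<rho>\<^sup>2 / 4) \<le> \<sigma>\<^sup>2 / L"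
  shows "measure P {x \<in> space P. cmod (S x - w) < 3 * \<sigma>} \<ge> \<sigma>\<^sup>2 / (50 * L)"
proof -
  interpret P: prob_space P by fact
  define \<phi> where "\<phi> = (\<lambda>t. \<integral>x. iexp (Re (cnj t * S x)) \<partial>P)"
  have \<phi>1: "cmod (\<phi> t) \<le> 1" for t
  proof -
    have "cmod (\<phi> t) \<le> (\<integral>x. cmod (iexp (Re (cnj t * S x))) \<partial>P)"
      unfolding \<phi>_def by (rule integral_norm_bound)
    then show ?thesis by (simp add: P.prob_space)
  qed
  have [measurable]: "\<phi> \<in> borel_measurable borel"
    unfolding \<phi>_def by measurable
  define H where "H = (\<lambda>s. \<integral>x. exp (- (cmod (S x - w))\<^sup>2 / (2 * s\<^sup>2)) \<partial>P)"
  define R where "R = (\<lambda>s. s\<^sup>2 / (s\<^sup>2 + V) * exp (- (cmod w)\<^sup>2 / (2 * (s\<^sup>2 + V))))"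
  have HR: "\<bar>H s - R s\<bar> \<le> 512 / 40000 * (s\<^sup>2 / L) + 4 * exp (- s\<^sup>2 * \<rho>\<^sup>2 / 4)" if s: "0 < s" for s
  proof -
    have Hs: "complex_of_real (H s) = (\<integral>g. iexp (Re (cnj (g / of_real s) * - w)) * \<phi> (g / of_real s) \<partial>cgauss)"
      unfolding H_def \<phi>_def by (rule smoothed_inversion[OF P S s])
    have "\<bar>H s - R s\<bar> = cmod (complex_of_real (H s) - of_real (R s))"
      by (metis norm_of_real of_real_diff)
    also have "\<dots> \<le> (1 / 40000) * s\<^sup>2 / (2 * (L / 1024)) + 4 * exp (- s\<^sup>2 * \<rho>\<^sup>2 / 4)"
      unfolding Hs R_def
    proof (rule smoothed_compare)
      show "cmod (\<phi> t - of_real (exp (- V * (cmod t)\<^sup>2 / 2))) \<le> 1 / 40000 * exp (- (L / 1024) * (cmod t)\<^sup>2)" if "cmod t \<le> \<rho>" for t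
        using near[OF that] by (simp only: \<phi>_def)
    qed (use V L \<phi>1 \<rho> s in auto)
    finally show ?thesis by simp
  qed
  have int: "integrable P (\<lambda>x. exp (- (cmod (S x - w))\<^sup>2 / (2 * s\<^sup>2)))" for s
    by (intro P.integrable_const_bound[of _ 1]) auto
  have "H \<sigma> - H (2 * \<sigma>) / 8 = (\<integral>x. exp (- (cmod (S x - w))\<^sup>2 / (2 * \<sigma>\<^sup>2)) - exp (- (cmod (S x - w))\<^sup>2 / (2 * (2 * \<sigma>)\<^sup>2)) / 8 \<partial>P)"
    unfolding H_def using int[of \<sigma>] int[of "2 * \<sigma>"] by simp
  also have "\<dots> \<le> (\<integral>x. indicator {x \<in> space P. cmod (S x - w) < 3 * \<sigma>} x \<partial>P)"
  proof (rule integral_mono)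
    show "integrable P (\<lambda>x. exp (- (cmod (S x - w))\<^sup>2 / (2 * \<sigma>\<^sup>2)) - exp (- (cmod (S x - w))\<^sup>2 / (2 * (2 * \<sigma>)\<^sup>2)) / 8)"
      using int[of \<sigma>] int[of "2 * \<sigma>"] by simp
    show "integrable P (indicator {x \<in> space P. cmod (S x - w) < 3 * \<sigma>} :: 'a \<Rightarrow> real)"
      by (intro P.integrable_const_bound[of _ 1]) (auto simp: indicator_def)
    fix x assume "x \<in> space P"
    then show "exp (- (cmod (S x - w))\<^sup>2 / (2 * \<sigma>\<^sup>2)) - exp (- (cmod (S x - w))\<^sup>2 / (2 * (2 * \<sigma>)\<^sup>2)) / 8 \<le> indicator {x \<in> space P. cmod (S x - w) < 3 * \<sigma>} x"
      using gaussian_difference_le_indicator[OF \<sigma>(1), of "S x - w"] by (simp add: indicator_def)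
  qed
  also have "\<dots> = measure P {x \<in> space P. cmod (S x - w) < 3 * \<sigma>}"
    by (simp add: Int_absorb2 Collect_restrict)
  finally have up: "H \<sigma> - H (2 * \<sigma>) / 8 \<le> measure P {x \<in> space P. cmod (S x - w) < 3 * \<sigma>}" .
  define q where "q = \<sigma>\<^sup>2 / V"
  have s1: "\<sigma>\<^sup>2 \<le> 1" using \<sigma> by (simp add: power_le_one)
  \<comment> \<open>In units of \<open>p\<close> the main term is at least
    \<open>(9/11 - 1/2) / 5 > 0.063\<close>. The errors add up to at most
    \<open>0.0128 + 0.0064 + 4.5 / 225 < 0.04\<close>, so more than \<open>1 / 50\<close> is
    left.\<close>
  have arith: "p / 50 \<le> h1 - h2 / 8"
    if "q * (10 / 11) * (9 / 10) \<le> r1" "r2 \<le> 4 * q" "p / 5 \<le> q" "e2 \<le> e1"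
      "r1 - h1 \<le> 512 / 40000 * p + 4 * e1" "h2 - r2 \<le> 512 / 40000 * p' + 4 * e2" "p' = 4 * p" "0 \<le> e1" "225 * e1 \<le> p"
    for h1 h2 r1 r2 e1 e2 p p' :: real
    using that by linarith
  have "R \<sigma> \<ge> (q * (10 / 11)) * (9 / 10)"
    unfolding R_def
  proof (rule mult_mono)
    have "\<sigma>\<^sup>2 + V \<le> 11 / 10 * V" using s1 V by linarith
    then have "\<sigma>\<^sup>2 / (11 / 10 * V) \<le> \<sigma>\<^sup>2 / (\<sigma>\<^sup>2 + V)"
      using V by (intro divide_left_mono) (auto intro!: mult_pos_pos add_nonneg_pos)
    then show "q * (10 / 11) \<le> \<sigma>\<^sup>2 / (\<sigma>\<^sup>2 + V)" by (simp add: q_def)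
    have "(cmod w)\<^sup>2 / (2 * (\<sigma>\<^sup>2 + V)) \<le> (V / 5) / (2 * V)"
      using V w by (intro frac_le) auto
    also have "\<dots> = 1 / 10" using V by simp
    finally have "9 / 10 \<le> 1 + (- (cmod w)\<^sup>2 / (2 * (\<sigma>\<^sup>2 + V)))" by simp
    also have "\<dots> \<le> exp (- (cmod w)\<^sup>2 / (2 * (\<sigma>\<^sup>2 + V)))" by (rule exp_ge_add_one_self)
    finally show "9 / 10 \<le> exp (- (cmod w)\<^sup>2 / (2 * (\<sigma>\<^sup>2 + V)))" .
  qed (use V in \<open>auto simp: q_def\<close>)
  moreover have "R (2 * \<sigma>) \<le> 4 * q"
  proof -
    have "R (2 * \<sigma>) \<le> (2 * \<sigma>)\<^sup>2 / V * 1"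
      unfolding R_def using V by (intro mult_mono divide_left_mono) (auto intro!: mult_pos_pos add_nonneg_pos)
    then show ?thesis by (simp add: q_def power_mult_distrib)
  qed
  moreover have "\<sigma>\<^sup>2 / L / 5 \<le> q"
  proof -
    have "\<sigma>\<^sup>2 / (5 * L) \<le> \<sigma>\<^sup>2 / V" using V L by (intro divide_left_mono) auto
    then show ?thesis by (simp add: q_def)
  qed
  moreover have "exp (- (2 * \<sigma>)\<^sup>2 * \<rho>\<^sup>2 / 4) \<le> exp (- \<sigma>\<^sup>2 * \<rho>\<^sup>2 / 4)"
    by (simp add: power_mult_distrib)
  moreover have "R \<sigma> - H \<sigma> \<le> 512 / 40000 * (\<sigma>\<^sup>2 / L) + 4 * exp (- \<sigma>\<^sup>2 * \<rho>\<^sup>2 / 4)"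
    using HR[OF \<sigma>(1)] by linarith
  moreover have "H (2 * \<sigma>) - R (2 * \<sigma>) \<le> 512 / 40000 * ((2 * \<sigma>)\<^sup>2 / L) + 4 * exp (- (2 * \<sigma>)\<^sup>2 * \<rho>\<^sup>2 / 4)"
    using HR[of "2 * \<sigma>"] \<sigma> by linarith
  moreover have "(2 * \<sigma>)\<^sup>2 / L = 4 * (\<sigma>\<^sup>2 / L)" by (simp add: power_mult_distrib)
  moreover have "0 \<le> exp (- \<sigma>\<^sup>2 * \<rho>\<^sup>2 / 4)" by simp
  ultimately have "H \<sigma> - H (2 * \<sigma>) / 8 \<ge> (\<sigma>\<^sup>2 / L) / 50"
    using tail by (rule arith)
  with up show ?thesis by simp
qed

section \<open>Assembly of the factors\<close>

lemma corner_law_haar: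
  assumes H: "haar_probability k \<mu>" and k: "0 < k"
  shows "corner_law (corner_distr \<mu>) k"
proof -
  interpret prob_space \<mu> using haar_probabilityD[OF H] by simp
  have m [measurable]: "(\<lambda>g. g $$ (0, 0)) \<in> borel_measurable \<mu>"
    using k by (intro haar_measurable[OF H] measurable_unitary_group_entry)
  interpret D: prob_space "corner_distr \<mu> :: complex measure"
    by (rule prob_space_distr[OF m])
  show ?thesis
  proof
    show "AE z in corner_distr \<mu>. cmod z \<le> 1"
      using k unitary_group_entry_le[of _ k 0 0] haar_probabilityD(2)[OF H]
      by (subst AE_distr_iff) auto
    show "distr (corner_distr \<mu>) borel (\<lambda>z. c * z) = corner_distr \<mu>" if "cmod c = 1" for c
      by (rule haar_corner_rotation[OF H k that])
    show "real (m + k) * (\<integral>z. cmod z ^ (2 * Suc m) \<partial>corner_distr \<mu>)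
        = real (Suc m) * (\<integral>z. cmod z ^ (2 * m) \<partial>corner_distr \<mu>)" for m
      using haar_corner_moment[OF H k, of m] by (simp add: integral_distr del: of_nat_Suc mult_Suc_right)
  qed simp
qed

locale corner_laws =
  fixes \<nu> :: "nat \<Rightarrow> complex measure" and N :: nat
  assumes prob: "\<And>k. prob_space (\<nu> k)" and sets_law [measurable_cong, simp]: "\<And>k. sets (\<nu> k) = sets borel"
    and law: "\<And>k. k \<in> {1..N} \<Longrightarrow> corner_law (\<nu> k) k" and N: "36 \<le> N"
begin

sublocale product_sigma_finite \<nu>
  by (intro product_sigma_finite.intro prob_space_imp_sigma_finite prob)

lemma space_law [simp]: "space (\<nu> k) = UNIV"
  using sets_eq_imp_space_eq[OF sets_law] by simp

lemma measurable_comp: "k \<in> I \<Longrightarrow> (\<lambda>a. a k) \<in> borel_measurable (Pi\<^sub>M I \<nu>)"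
  using measurable_component_singleton[of k I \<nu>] measurable_cong_sets[OF refl sets_law] by blast

abbreviation tail_law :: "(nat \<Rightarrow> complex) measure" where
  "tail_law \<equiv> Pi\<^sub>M {6..N} \<nu>"

text \<open>Principal logarithms are added without reduction modulo \<open>2 pi i\<close>, so that
  \<open>S\<close> is a sum of independent variables; only \<open>exp S\<close> matters for the
  determinant.\<close>

definition S :: "(nat \<Rightarrow> complex) \<Rightarrow> complex" where
  "S y = (\<Sum>k\<in>{6..N}. lg (y k))"

lemma measurable_S [measurable]: "S \<in> borel_measurable tail_law"
  unfolding S_def by (intro borel_measurable_sum measurable_compose[OF measurable_comp lg_measurable])

lemma char_S: "(\<integral>y. iexp (Re (cnj t * S y)) \<partial>tail_law) = (\<Prod>k\<in>{6..N}. corner_law.chf (\<nu> k) t)"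
proof -
  have "iexp (Re (cnj t * S y)) = (\<Prod>k\<in>{6..N}. iexp (Re (cnj t * lg (y k))))" for y
  proof -
    have "\<i> * complex_of_real (Re (cnj t * S y)) = (\<Sum>k\<in>{6..N}. \<i> * complex_of_real (Re (cnj t * lg (y k))))"
      by (simp only: S_def sum_distrib_left Re_sum of_real_sum)
    then show ?thesis by (simp only: exp_sum finite_atLeastAtMost)
  qed
  then have "(\<integral>y. iexp (Re (cnj t * S y)) \<partial>tail_law) = (\<integral>y. (\<Prod>k\<in>{6..N}. iexp (Re (cnj t * lg (y k)))) \<partial>tail_law)"
    by simp
  also have "\<dots> = (\<Prod>k\<in>{6..N}. \<integral>z. iexp (Re (cnj t * lg z)) \<partial>\<nu> k)"
  proof (rule product_integral_prod)
    fix k assume "k \<in> {6..N}"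
    then interpret corner_law "\<nu> k" k by (intro law) auto
    show "integrable (\<nu> k) (\<lambda>z. iexp (Re (cnj t * lg z)))"
      using \<open>k \<in> {6..N}\<close> by (intro integrable_iexp_lg) auto
  qed simp
  also have "\<dots> = (\<Prod>k\<in>{6..N}. corner_law.chf (\<nu> k) t)"
  proof (intro prod.cong refl corner_law.chf_def[symmetric])
    fix k assume "k \<in> {6..N}"
    then have "k \<in> {1..N}" by simp
    then show "corner_law (\<nu> k) k" by (rule law)
    show "6 \<le> k" using \<open>k \<in> {6..N}\<close> by simp
  qed
  finally show ?thesis .
qed

definition v :: "nat \<Rightarrow> real" where
  "v k = (\<integral>z. cmod (lg z) ^ 2 \<partial>\<nu> k)"

sublocale almost_gaussian_factors "\<lambda>k. corner_law.chf (\<nu> k)" v N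
proof
  fix k t assume k: "k \<in> {6..N}"
  then interpret corner_law "\<nu> k" k by (intro law) auto
  have k6: "6 \<le> k" using k by simp
  show "cmod (chf t) \<le> 1" by (rule norm_chf_le_1[OF k6])
  show "1 / (16 * real k) \<le> v k" unfolding v_def by (rule lg_moment_2_ge[OF k6])
  show "v k \<le> 10 / real k" unfolding v_def by (rule lg_moment_2(2)[OF k6])
  show "cmod (chf t - of_real (1 - v k * (cmod t)\<^sup>2 / 4)) \<le> 81 * (cmod t) ^ 3 / (real k * sqrt (real k))"
    unfolding v_def by (rule chf_taylor[OF k6])
qed (rule N)

lemma exp_S: "AE y in tail_law. exp (S y) = (\<Prod>k\<in>{6..N}. 1 - y k)"
proof -
  have "AE y in tail_law. \<forall>k\<in>{6..N}. cmod (y k) < 1"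
  proof (rule AE_finite_allI)
    fix k assume k: "k \<in> {6..N}"
    then interpret corner_law "\<nu> k" k by (intro law) auto
    show "AE y in tail_law. cmod (y k) < 1"
      using k by (intro AE_PiM_component prob norm_less_1) auto
  qed simp
  then show ?thesis
  proof eventually_elim
    case (elim y)
    have "exp (S y) = (\<Prod>k\<in>{6..N}. exp (lg (y k)))"
      by (simp add: S_def exp_sum)
    also have "\<dots> = (\<Prod>k\<in>{6..N}. 1 - y k)"
    proof (intro prod.cong refl)
      fix k assume "k \<in> {6..N}"
      then have "1 - y k \<noteq> 0" using elim by force
      then show "exp (lg (y k)) = 1 - y k" by (simp add: lg_def)
    qed
    finally show ?case .
  qed
qed

text \<open>The first five factors, whose logarithms lack the moments needed above, are merely kept
  away from \<open>0\<close> and \<open>\<infinity>\<close>.\<close>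

lemma head_probability:
  "ennreal (1 / 32) \<le> emeasure (Pi\<^sub>M {1..5} \<nu>) (Pi\<^sub>E {1..5} (\<lambda>_. {z. Re z \<le> 0 \<and> cmod z \<le> 1}))"
proof -
  have [measurable]: "{z. Re z \<le> 0 \<and> cmod z \<le> 1} \<in> sets borel" by measurable
  have half: "ennreal (1 / 2) \<le> emeasure (\<nu> k) {z. Re z \<le> 0 \<and> cmod z \<le> 1}" if "k \<in> {1..5}" for k
  proof -
    have "k \<in> {1..N}" using that N by simp
    then interpret corner_law "\<nu> k" k by (rule law)
    have "1 / 2 \<le> prob {z. Re z \<le> 0}" by (rule prob_Re_le_0)
    also have "\<dots> \<le> prob {z. Re z \<le> 0 \<and> cmod z \<le> 1}"
      using norm_le_1 by (intro finite_measure_mono_AE) (auto elim!: eventually_mono)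
    finally show ?thesis unfolding emeasure_eq_measure by (rule ennreal_leI)
  qed
  have "emeasure (Pi\<^sub>M {1..5} \<nu>) (Pi\<^sub>E {1..5} (\<lambda>_. {z. Re z \<le> 0 \<and> cmod z \<le> 1})) = (\<Prod>k\<in>{1..5}. emeasure (\<nu> k) {z. Re z \<le> 0 \<and> cmod z \<le> 1})"
    by (rule emeasure_PiM) auto
  also have "\<dots> \<ge> (\<Prod>k\<in>{1..5::nat}. ennreal (1 / 2))"
    by (intro prod_mono_ennreal half)
  also have "(\<Prod>k\<in>{1..5::nat}. ennreal (1 / 2)) = ennreal ((1 / 2) ^ 5)"
    by (subst prod_ennreal) auto
  finally show ?thesis by (simp add: power_divide)
qed

section \<open>Combining the first five factors with the Gaussian tail\<close>

context
  fixes \<rho> \<delta> :: real and z0 :: complex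
  assumes near: "\<And>t. cmod t \<le> \<rho> \<Longrightarrow> cmod ((\<Prod>k\<in>{6..N}. corner_law.chf (\<nu> k) t) - of_real (exp (- V * (cmod t)\<^sup>2 / 2)))
      \<le> 1 / 40000 * exp (- (cmod t)\<^sup>2 * L / 1024)"
    and \<delta>: "0 < \<delta>" "\<delta> \<le> 1" and \<rho>: "0 \<le> \<rho>" and tail: "225 * exp (- (\<delta> / 6)\<^sup>2 * \<rho>\<^sup>2 / 4) \<le> (\<delta> / 6)\<^sup>2 / L"
    and L: "1280 * (ln (cmod z0))\<^sup>2 + 30720 \<le> L" and z: "z0 \<noteq> 0"
begin

text \<open>\<open>c\<close> stands for the product of the first five factors and the target is
  \<open>w = Ln (z0 / c)\<close>. From \<open>0 <= ln |c| <= 4\<close> and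
  \<open>|Im w| <= 4\<close> one gets \<open>|w|^2 <= 2 (ln |z0|)^2 + 48\<close>, and the hypothesis
  on \<open>L\<close> is 640 times this, where \<open>V / 5 >= L / 640\<close>. As
  \<open>|exp u - 1| <= 2 |u|\<close> for \<open>|u| < 1/2\<close>, radius
  \<open>\<delta> / 2 = 3 \<sigma>\<close> suffices, and \<open>50 * 36 = 1800\<close>.\<close>

lemma tail_product_probability:
  assumes c: "1 \<le> cmod c" "cmod c \<le> 32"
  shows "\<delta>\<^sup>2 / (1800 * L) \<le> measure tail_law {y \<in> space tail_law. cmod (c * (\<Prod>k\<in>{6..N}. 1 - y k) - z0) < \<delta> * cmod z0}"
proof -
  interpret P: prob_space "tail_law" by (rule prob_space_PiM) (rule prob)
  have Lp: "30720 \<le> L" using L zero_le_power2[of "ln (cmod z0)"] by linarith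
  define w where "w = Ln (z0 / c)"
  have c0: "c \<noteq> 0" using c by auto
  have ew: "c * exp w = z0" using c0 z by (simp add: w_def)
  have "(cmod w)\<^sup>2 \<le> 2 * (ln (cmod z0))\<^sup>2 + 48"
  proof -
    have "Re w = ln (cmod z0) - ln (cmod c)"
      using c0 z by (simp add: w_def norm_divide ln_div)
    moreover have "0 \<le> ln (cmod c)" using c by simp
    moreover have "ln (cmod c) \<le> 4"
    proof -
      have "ln (cmod c) \<le> ln (2 ^ 5)" using c by (subst ln_le_cancel_iff) auto
      also have "\<dots> = 5 * ln 2" by (subst ln_realpow) auto
      also have "\<dots> \<le> 4" using ln2_le_25_over_36 by simp
      finally show ?thesis .
    qed
    moreover have "(a - b)\<^sup>2 \<le> 2 * a\<^sup>2 + 32" if "0 \<le> b" "b \<le> 4" for a b :: real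
    proof -
      have "(a - b)\<^sup>2 \<le> 2 * a\<^sup>2 + 2 * b\<^sup>2"
        using zero_le_power2[of "a + b"] by (simp add: power2_eq_square algebra_simps)
      moreover have "b\<^sup>2 \<le> 4\<^sup>2" using that by (intro power_mono) auto
      ultimately show ?thesis by simp
    qed
    ultimately have "(Re w)\<^sup>2 \<le> 2 * (ln (cmod z0))\<^sup>2 + 32" by simp
    moreover have "(Im w)\<^sup>2 \<le> 16"
    proof -
      have "\<bar>Im w\<bar> \<le> pi"
        using mpi_less_Im_Ln[of "z0 / c"] Im_Ln_le_pi[of "z0 / c"] c0 z by (simp add: w_def abs_le_iff)
      then have "\<bar>Im w\<bar> \<le> 4" using pi_less_4 by linarith
      then have "\<bar>Im w\<bar>\<^sup>2 \<le> 4\<^sup>2" by (intro power_mono) auto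
      then show ?thesis by simp
    qed
    ultimately show ?thesis by (simp add: cmod_power2)
  qed
  also have "\<dots> \<le> V / 5" using V_bounds(1) L by linarith
  finally have w: "(cmod w)\<^sup>2 \<le> V / 5" .
  define \<sigma> where "\<sigma> = \<delta> / 6"
  have "\<sigma>\<^sup>2 / (50 * L) \<le> measure tail_law {y \<in> space tail_law. cmod (S y - w) < 3 * \<sigma>}"
  proof (rule local_probability_lower_bound[OF P.prob_space_axioms measurable_S])
    show "cmod ((\<integral>y. iexp (Re (cnj t * S y)) \<partial>tail_law) - of_real (exp (- V * (cmod t)\<^sup>2 / 2)))
      \<le> 1 / 40000 * exp (- (L / 1024) * (cmod t)\<^sup>2)" if "cmod t \<le> \<rho>" for t
      using near[OF that] unfolding char_S by (simp add: mult.commute)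
  qed (use \<delta> \<rho> tail w Lp V_bounds in \<open>auto simp: \<sigma>_def\<close>)
  also have "\<dots> \<le> measure tail_law {y \<in> space tail_law. cmod (c * (\<Prod>k\<in>{6..N}. 1 - y k) - z0) < \<delta> * cmod z0}"
  proof (rule P.finite_measure_mono_AE)
    show "AE y in tail_law. y \<in> {y \<in> space tail_law. cmod (S y - w) < 3 * \<sigma>} \<longrightarrow>
        y \<in> {y \<in> space tail_law. cmod (c * (\<Prod>k\<in>{6..N}. 1 - y k) - z0) < \<delta> * cmod z0}"
      using exp_S
    proof eventually_elim
      case (elim y)
      show ?case
      proof safe
        assume "cmod (S y - w) < 3 * \<sigma>"
        then have s: "cmod (S y - w) < \<delta> / 2" by (simp add: \<sigma>_def)
        have "c * (\<Prod>k\<in>{6..N}. 1 - y k) - z0 = z0 * (exp (S y - w) - 1)"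
          unfolding elim[symmetric] by (simp add: exp_diff ew[symmetric] algebra_simps)
        then have "cmod (c * (\<Prod>k\<in>{6..N}. 1 - y k) - z0) = cmod z0 * cmod (exp (S y - w) - 1)"
          by (simp add: norm_mult)
        also have "\<dots> < cmod z0 * \<delta>"
        proof (rule mult_strict_left_mono)
          have "exp (cmod (S y - w)) \<le> exp (1 / 2)" using s \<delta> by simp
          also have "\<dots> \<le> 1 + 1 / 2 + (1 / 2)\<^sup>2" by (rule exp_bound) auto
          finally have "exp (cmod (S y - w)) \<le> 2" by (simp add: power2_eq_square)
          then have "exp (cmod (S y - w)) * cmod (S y - w) \<le> 2 * cmod (S y - w)"
            by (intro mult_right_mono) auto
          then show "cmod (exp (S y - w) - 1) < \<delta>"
            using norm_exp_minus_1_le[of "S y - w"] s by linarith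
        qed (use z in simp)
        finally show "cmod (c * (\<Prod>k\<in>{6..N}. 1 - y k) - z0) < \<delta> * cmod z0"
          by (simp add: mult.commute)
      qed
    qed
    have "(\<lambda>y. c * (\<Prod>k\<in>{6..N}. 1 - y k) - z0) \<in> borel_measurable tail_law"
      by (intro borel_measurable_diff borel_measurable_times borel_measurable_prod measurable_comp borel_measurable_const)
    then show "{y \<in> space tail_law. cmod (c * (\<Prod>k\<in>{6..N}. 1 - y k) - z0) < \<delta> * cmod z0} \<in> sets tail_law"
      by measurable
  qed
  finally show ?thesis by (simp add: \<sigma>_def power_divide)
qed

text \<open>For every head in the set \<open>A\<close> the product \<open>c\<close> has modulus
  between 1 and 32, so the tail bound is uniform over \<open>A\<close>. Fubini multiplies it by the
  probability \<open>1 / 32\<close> of \<open>A\<close>: \<open>32 * 1800 = 57600\<close>.\<close>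

lemma product_probability:
  shows "\<delta>\<^sup>2 / (57600 * L) \<le> measure (Pi\<^sub>M {1..N} \<nu>) {a \<in> space (Pi\<^sub>M {1..N} \<nu>). cmod ((\<Prod>k\<in>{1..N}. 1 - a k) - z0) < \<delta> * cmod z0}"
proof -
  note One_nat_def [simp del]
  interpret PN: prob_space "Pi\<^sub>M {1..N} \<nu>" by (rule prob_space_PiM) (rule prob)
  interpret P: prob_space "tail_law" by (rule prob_space_PiM) (rule prob)
  have un: "{1..5} \<union> {6..N} = {1..N}" using N by auto
  have Lp: "30720 \<le> L" using L zero_le_power2[of "ln (cmod z0)"] by linarith
  define p where "p = \<delta>\<^sup>2 / (1800 * L)"
  have p: "0 \<le> p" using Lp by (simp add: p_def)
  define B where "B = {a \<in> space (Pi\<^sub>M {1..N} \<nu>). cmod ((\<Prod>k\<in>{1..N}. 1 - a k) - z0) < \<delta> * cmod z0}"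
  have mB [measurable]: "B \<in> sets (Pi\<^sub>M {1..N} \<nu>)"
  proof -
    have "(\<lambda>a. (\<Prod>k\<in>{1..N}. 1 - a k) - z0) \<in> borel_measurable (Pi\<^sub>M {1..N} \<nu>)"
      by (intro borel_measurable_diff borel_measurable_prod measurable_comp borel_measurable_const)
    then show ?thesis unfolding B_def by measurable
  qed
  define A where "A = Pi\<^sub>E {1..5::nat} (\<lambda>_. {z. Re z \<le> 0 \<and> cmod z \<le> 1})"
  have mA [measurable]: "A \<in> sets (Pi\<^sub>M {1..5} \<nu>)"
    unfolding A_def by (intro sets_PiM_I_finite) auto
  have "ennreal (p / 32) = ennreal p * ennreal (1 / 32)"
    using p by (simp flip: ennreal_mult)
  also have "\<dots> \<le> ennreal p * emeasure (Pi\<^sub>M {1..5} \<nu>) A"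
    unfolding A_def using head_probability by (intro mult_left_mono) auto
  also have "\<dots> = (\<integral>\<^sup>+x. ennreal p * indicator A x \<partial>Pi\<^sub>M {1..5} \<nu>)"
    by (rule nn_integral_cmult_indicator[symmetric]) (rule mA)
  also have "\<dots> \<le> (\<integral>\<^sup>+x. (\<integral>\<^sup>+y. indicator B (merge {1..5} {6..N} (x, y)) \<partial>tail_law) \<partial>Pi\<^sub>M {1..5} \<nu>)"
  proof (rule nn_integral_mono)
    fix x assume x: "x \<in> space (Pi\<^sub>M {1..5} \<nu>)"
    show "ennreal p * indicator A x \<le> (\<integral>\<^sup>+y. indicator B (merge {1..5} {6..N} (x, y)) \<partial>tail_law)"
    proof (cases "x \<in> A")
      case True
      define c where "c = (\<Prod>k\<in>{1..5}. 1 - x k)"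
      have "1 \<le> cmod (1 - x k)" "cmod (1 - x k) \<le> 2" if "k \<in> {1..5}" for k
      proof -
        have xk: "Re (x k) \<le> 0" "cmod (x k) \<le> 1" using True that by (auto simp: A_def PiE_def)
        show "1 \<le> cmod (1 - x k)" using xk complex_Re_le_cmod[of "1 - x k"] by simp
        show "cmod (1 - x k) \<le> 2" using xk norm_triangle_ineq4[of 1 "x k"] by simp
      qed
      then have "(\<Prod>k\<in>{1..5::nat}. 1) \<le> (\<Prod>k\<in>{1..5}. cmod (1 - x k))" "(\<Prod>k\<in>{1..5}. cmod (1 - x k)) \<le> (\<Prod>k\<in>{1..5::nat}. 2)"
        by (intro prod_mono; force)+
      then have c: "1 \<le> cmod c" "cmod c \<le> 32"
        by (simp_all add: c_def prod_norm[symmetric])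
      define T where "T = {y \<in> space tail_law. cmod (c * (\<Prod>k\<in>{6..N}. 1 - y k) - z0) < \<delta> * cmod z0}"
      have "p \<le> measure tail_law T"
        unfolding p_def T_def by (rule tail_product_probability[OF c])
      then have "ennreal p \<le> emeasure tail_law T"
        by (simp add: P.emeasure_eq_measure)
      also have "\<dots> = (\<integral>\<^sup>+y. indicator T y \<partial>tail_law)"
      proof -
        have "(\<lambda>y. c * (\<Prod>k\<in>{6..N}. 1 - y k) - z0) \<in> borel_measurable tail_law"
          by (intro borel_measurable_diff borel_measurable_times borel_measurable_prod measurable_comp borel_measurable_const)
        then have "T \<in> sets tail_law"
          unfolding T_def by measurable
        then show ?thesis by simp
      qed
      also have "\<dots> = (\<integral>\<^sup>+y. indicator B (merge {1..5} {6..N} (x, y)) \<partial>tail_law)"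
      proof (rule nn_integral_cong)
        fix y assume y: "y \<in> space tail_law"
        have sp: "merge {1..5} {6..N} (x, y) \<in> space (Pi\<^sub>M {1..N} \<nu>)"
          unfolding un[symmetric] using x y by (auto simp: space_PiM)
        have "(\<Prod>k\<in>{1..N}. 1 - merge {1..5} {6..N} (x, y) k) = (\<Prod>k\<in>{1..5}. 1 - merge {1..5} {6..N} (x, y) k) * (\<Prod>k\<in>{6..N}. 1 - merge {1..5} {6..N} (x, y) k)"
          unfolding un[symmetric] by (rule prod.union_disjoint) auto
        also have "\<dots> = c * (\<Prod>k\<in>{6..N}. 1 - y k)"
          unfolding c_def by (intro arg_cong2[where f = "(*)"] prod.cong) (auto simp: merge_def)
        finally show "indicator T y = (indicator B (merge {1..5} {6..N} (x, y)) :: ennreal)"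
          using sp y by (simp add: T_def B_def indicator_def)
      qed
      finally show ?thesis using True by simp
    qed simp
  qed
  also have "\<dots> = (\<integral>\<^sup>+a. indicator B a \<partial>Pi\<^sub>M ({1..5} \<union> {6..N}) \<nu>)"
    by (rule product_nn_integral_fold[symmetric]) (auto simp: un)
  also have "\<dots> = emeasure (Pi\<^sub>M {1..N} \<nu>) B"
    unfolding un by simp
  also have "\<dots> = ennreal (measure (Pi\<^sub>M {1..N} \<nu>) B)"
    by (rule PN.emeasure_eq_measure)
  finally have "p / 32 \<le> measure (Pi\<^sub>M {1..N} \<nu>) B"
    by (simp add: ennreal_le_iff)
  then show ?thesis by (simp add: p_def B_def)
qed

end

end

section \<open>Choice of the threshold for the matrix size\<close>

lemma tail_eventually:
  "\<exists>n. \<forall>N\<ge>n. 225 * exp (- (real N powr (1 / 4)) / 432640000) \<le> real N powr (- 1 / 4) / ln (real N)"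
proof -
  have "eventually (\<lambda>x::real. 225 * exp (- (x powr (1 / 4)) / 432640000) \<le> x powr (- 1 / 4) / ln x) at_top"
    by real_asymp
  then have "eventually (\<lambda>N. 225 * exp (- (real N powr (1 / 4)) / 432640000) \<le> real N powr (- 1 / 4) / ln (real N)) sequentially"
    by (rule eventually_compose_filterlim) (rule filterlim_real_sequentially)
  then show ?thesis by (simp add: eventually_sequentially)
qed

text \<open>\<open>n\<close> is absolute. The dependence on \<open>z0\<close> and
  \<open>\<epsilon>\<close> is confined to two explicit inequalities: the one with \<open>ln\<close>
  keeps the target \<open>w\<close> within the bulk of the Gaussian, the one with the eighth power
  makes the frequency cutoff harmless.\<close>

theorem haar_det_lower_bound:
  "\<exists>n. \<forall>N\<ge>n. \<forall>\<mu> z0 \<epsilon>. haar_probability N \<mu> \<longrightarrow> z0 \<noteq> 0 \<longrightarrow> 0 < \<epsilon> \<longrightarrow> \<epsilon> \<le> cmod z0 \<longrightarrow>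
     1280 * (ln (cmod z0))\<^sup>2 + 30720 \<le> ln (real N) \<longrightarrow> (6 * cmod z0 / \<epsilon>) ^ 8 \<le> real N \<longrightarrow>
     (\<epsilon> / cmod z0)\<^sup>2 / (57600 * ln (real N)) \<le> measure \<mu> {g \<in> unitary_group N. cmod (Determinant.det (1\<^sub>m N - g) - z0) < \<epsilon>}"
proof -
  \<comment> \<open>The crossover of \<open>prod_gaussian\<close>, large enough for
    \<open>\<eta> = 1 / 40000\<close>, the accuracy that
    \<open>local_probability_lower_bound\<close> requires.\<close>
  define A :: real where "A = max 1 (1024 * ln 80000)"
  have A: "1 \<le> A" "2 * exp (- A / 1024) \<le> 1 / 40000"
  proof -
    have "- A / 1024 \<le> - ln 80000" by (simp add: A_def)
    then have "exp (- A / 1024) \<le> exp (- ln 80000)" by simp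
    then show "2 * exp (- A / 1024) \<le> 1 / 40000" by (simp add: exp_minus)
  qed (simp add: A_def)
  define L0 where "L0 = max A (85 * A * exp (A / 1024) / (1 / 40000))"
  obtain n1 where n1: "\<And>N. n1 \<le> N \<Longrightarrow> 225 * exp (- (real N powr (1 / 4)) / 432640000) \<le> real N powr (- 1 / 4) / ln (real N)"
    using tail_eventually by blast
  define n where "n = Max {36, n1, nat \<lceil>exp L0\<rceil>}"
  show ?thesis
  proof (intro exI[of _ n] allI impI)
    fix N \<mu> z0 \<epsilon>
    assume n: "n \<le> N" and H: "haar_probability N \<mu>" and z: "z0 \<noteq> 0" and \<epsilon>: "0 < \<epsilon>" "\<epsilon> \<le> cmod z0"
      and L: "1280 * (ln (cmod z0))\<^sup>2 + 30720 \<le> ln (real N)" and N8: "(6 * cmod z0 / \<epsilon>) ^ 8 \<le> real N"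
    have NN: "36 \<le> N" "n1 \<le> N" "exp L0 \<le> real N"
      using n by (auto simp: n_def)
    from distr_det_one_minus[OF H] obtain \<nu> where \<nu>: "\<forall>k. prob_space (\<nu> k) \<and> sets (\<nu> k) = sets (borel :: complex measure)"
      and law: "\<forall>k\<in>{1..N}. \<exists>\<mu>'. haar_probability k \<mu>' \<and> \<nu> k = corner_distr \<mu>'"
      and distr: "distr \<mu> borel (\<lambda>g. Determinant.det (1\<^sub>m N - g)) = distr (Pi\<^sub>M {1..N} \<nu>) borel (\<lambda>a. \<Prod>k\<in>{1..N}. 1 - a k)"
      by blast
    interpret corner_laws \<nu> N
    proof (rule corner_laws.intro)
      fix k assume "k \<in> {1..N}"
      then show "corner_law (\<nu> k) k"
        using law corner_law_haar[of k] by force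
    qed (use \<nu> NN in auto)
    have "L0 \<le> L"
      unfolding L_def using NN by (subst ln_ge_iff) auto
    then have AL: "A \<le> L" "85 * A * exp (A / 1024) / (1 / 40000) \<le> L"
      by (simp_all add: L0_def)
    define \<delta> where "\<delta> = \<epsilon> / cmod z0"
    have \<delta>: "0 < \<delta>" "\<delta> \<le> 1" using \<epsilon> z by (auto simp: \<delta>_def)
    define \<rho> where "\<rho> = sqrt (sqrt (real N)) / 10400"
    define s where "s = real N powr (1 / 4)"
    have s0: "0 < s" using NN by (simp add: s_def)
    have sN: "sqrt (real N) = s\<^sup>2" "real N = s ^ 4"
    proof -
      have "s ^ 4 = real N" using NN by (simp add: s_def powr_power)
      then show "real N = s ^ 4" by simp
      then have "real N = (s\<^sup>2)\<^sup>2" by simp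
      then show "sqrt (real N) = s\<^sup>2" by (metis real_sqrt_unique zero_le_power2)
    qed
    have "225 * exp (- (\<delta> / 6)\<^sup>2 * \<rho>\<^sup>2 / 4) \<le> (\<delta> / 6)\<^sup>2 / L"
    proof -
      \<comment> \<open>The eighth power is chosen to give \<open>(\<delta> / 6)^2 >= 1 / s\<close>
        with \<open>s = N^(1/4)\<close>. Then the exponent is at least
        \<open>s / (4 * 10400^2) = s / 432640000\<close>, and the claim reduces to an inequality in
        \<open>N\<close> alone, supplied by \<open>tail_eventually\<close>.\<close>
      have "(6 / \<delta>) ^ 8 \<le> s ^ 4" using N8 by (simp add: \<delta>_def sN)
      then have "((6 / \<delta>)\<^sup>2) ^ 4 \<le> s ^ 4" by (simp flip: power_mult)
      then have "(6 / \<delta>)\<^sup>2 \<le> s"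
        using s0 by (subst (asm) power_mono_iff) auto
      then have d: "1 / s \<le> (\<delta> / 6)\<^sup>2"
        using \<delta> s0 by (simp add: power_divide divide_le_eq le_divide_eq mult.commute)
      have Lp: "0 < L" using AL A by linarith
      have r2: "\<rho>\<^sup>2 = s\<^sup>2 / 108160000" by (simp add: \<rho>_def power_divide sN(1))
      have "s / 432640000 = (1 / s) * \<rho>\<^sup>2 / 4"
        unfolding r2 using s0 by (simp add: power2_eq_square)
      also have "\<dots> \<le> (\<delta> / 6)\<^sup>2 * \<rho>\<^sup>2 / 4"
        using d by (intro divide_right_mono mult_right_mono) auto
      finally have "225 * exp (- (\<delta> / 6)\<^sup>2 * \<rho>\<^sup>2 / 4) \<le> 225 * exp (- s / 432640000)" by simp
      also have "\<dots> \<le> real N powr (- 1 / 4) / ln (real N)"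
        unfolding s_def by (rule n1[OF NN(2)])
      also have "\<dots> = (1 / s) / L"
        by (simp add: s_def L_def powr_minus_divide)
      also have "\<dots> \<le> (\<delta> / 6)\<^sup>2 / L"
        using d Lp by (intro divide_right_mono) auto
      finally show ?thesis .
    qed
    note tail = this
    have "\<delta>\<^sup>2 / (57600 * L) \<le> measure (Pi\<^sub>M {1..N} \<nu>) {a \<in> space (Pi\<^sub>M {1..N} \<nu>). cmod ((\<Prod>k\<in>{1..N}. 1 - a k) - z0) < \<delta> * cmod z0}"
    proof (rule product_probability[OF _ \<delta> _ tail _ z])
      show "cmod ((\<Prod>k\<in>{6..N}. corner_law.chf (\<nu> k) t) - of_real (exp (- V * (cmod t)\<^sup>2 / 2)))
          \<le> 1 / 40000 * exp (- (cmod t)\<^sup>2 * L / 1024)" if "cmod t \<le> \<rho>" for t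
        using that by (intro prod_gaussian[OF _ A AL]) (auto simp: \<rho>_def)
    qed (use L in \<open>auto simp: \<rho>_def L_def\<close>)
    also have "\<dots> = measure (distr (Pi\<^sub>M {1..N} \<nu>) borel (\<lambda>a. \<Prod>k\<in>{1..N}. 1 - a k)) {x. cmod (x - z0) < \<epsilon>}"
    proof -
      have "(\<lambda>a. \<Prod>k\<in>{1..N}. 1 - a k) \<in> borel_measurable (Pi\<^sub>M {1..N} \<nu>)"
        by (intro borel_measurable_diff borel_measurable_prod measurable_comp borel_measurable_const)
      then show ?thesis
        using z by (subst measure_distr) (auto simp: \<delta>_def intro!: arg_cong2[where f = measure])
    qed
    also have "\<dots> = measure \<mu> {g \<in> unitary_group N. cmod (Determinant.det (1\<^sub>m N - g) - z0) < \<epsilon>}"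
      unfolding distr[symmetric] using haar_measurable[OF H measurable_det_one_minus] haar_probabilityD(2)[OF H]
      by (subst measure_distr) (auto intro!: arg_cong2[where f = measure])
    finally show "(\<epsilon> / cmod z0)\<^sup>2 / (57600 * ln (real N)) \<le> measure \<mu> {g \<in> unitary_group N. cmod (Determinant.det (1\<^sub>m N - g) - z0) < \<epsilon>}"
      by (simp add: \<delta>_def L_def)
  qed
qed

lemma closed_formula_square: "closed_formula f \<Longrightarrow> closed_formula (\<lambda>z e. (f z e)\<^sup>2)"
  unfolding power2_eq_square by (rule closed_formula.mult)

theorem theorem1:
  shows "\<exists>c::real. c > 0 \<and>
    (\<exists>N0 :: complex \<Rightarrow> real \<Rightarrow> nat. explicitly_bounded N0 \<and>
      (\<forall>z0 \<epsilon>. z0 \<noteq> 0 \<and> 0 < \<epsilon> \<and> \<epsilon> \<le> cmod z0 \<longrightarrow>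
        (\<forall>N \<ge> N0 z0 \<epsilon>. \<forall>\<mu>. haar_probability N \<mu> \<longrightarrow>
          measure \<mu> {g \<in> unitary_group N. cmod (Determinant.det (1\<^sub>m N - g) - z0) < \<epsilon>}
            \<ge> c * ((\<epsilon> / cmod z0)\<^sup>2 * (1 / ln (real N))))))"
proof -
  obtain n where n: "\<And>N \<mu> z0 \<epsilon>. n \<le> N \<Longrightarrow> haar_probability N \<mu> \<Longrightarrow> z0 \<noteq> 0 \<Longrightarrow> 0 < \<epsilon> \<Longrightarrow> \<epsilon> \<le> cmod z0 \<Longrightarrow>
     1280 * (ln (cmod z0))\<^sup>2 + 30720 \<le> ln (real N) \<Longrightarrow> (6 * cmod z0 / \<epsilon>) ^ 8 \<le> real N \<Longrightarrow>
     (\<epsilon> / cmod z0)\<^sup>2 / (57600 * ln (real N)) \<le> measure \<mu> {g \<in> unitary_group N. cmod (Determinant.det (1\<^sub>m N - g) - z0) < \<epsilon>}"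
    using haar_det_lower_bound by blast
  \<comment> \<open>The sum of both thresholds: the summands are nonnegative, so
    \<open>N >= r\<close> satisfies each condition.\<close>
  define r where "r = (\<lambda>z e. exp (1280 * (ln (cmod z))\<^sup>2 + 30720) + (6 * cmod z / e) ^ 8 :: real)"
  define N0 where "N0 = (\<lambda>z e. n + nat \<lceil>r z e\<rceil>)"
  \<comment> \<open>The modulus enters through \<open>(Re z)^2 + (Im z)^2\<close>, hence the halved
    logarithm and the fourth power of \<open>36 |z|^2 / e^2\<close>. The absolute number
    \<open>n\<close> is a rational constant, and the extra 1 pays for the ceiling.\<close>
  define F where "F = (\<lambda>z e. (real n + 1) + (exp (1280 * (ln ((Re z)\<^sup>2 + (Im z)\<^sup>2) / 2)\<^sup>2 + 30720)
      + (((36 * ((Re z)\<^sup>2 + (Im z)\<^sup>2) / e\<^sup>2)\<^sup>2)\<^sup>2) :: real))"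
  have rF: "r z e = F z e - (real n + 1)" if "z \<noteq> 0" for z e
  proof -
    have "ln ((Re z)\<^sup>2 + (Im z)\<^sup>2) / 2 = ln (cmod z)"
      using that by (simp add: cmod_power2[symmetric] ln_realpow)
    moreover have "((36 * ((Re z)\<^sup>2 + (Im z)\<^sup>2) / e\<^sup>2)\<^sup>2)\<^sup>2 = (6 * cmod z / e) ^ 8"
      by (simp add: cmod_power2[symmetric] power_divide power_mult_distrib flip: power_mult)
    ultimately show ?thesis by (simp add: r_def F_def)
  qed
  have r0: "0 \<le> r z e" for z e
    by (simp add: r_def add_nonneg_nonneg zero_le_even_power)
  have "closed_formula F"
    unfolding F_def
    by (intro closed_formula.add closed_formula.mult closed_formula.divide closed_formula.exp closed_formula.ln
        closed_formula.re closed_formula.im closed_formula.eps closed_formula_square closed_formula.const)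
      auto
  moreover have "real (N0 z e) \<le> F z e" if "z \<noteq> 0" for z e
    using rF[OF that, of e] r0[of z e] unfolding N0_def by simp linarith
  ultimately have "explicitly_bounded N0"
    unfolding explicitly_bounded_def by blast
  moreover have "1 / 57600 * ((\<epsilon> / cmod z0)\<^sup>2 * (1 / ln (real N))) \<le> measure \<mu> {g \<in> unitary_group N. cmod (Determinant.det (1\<^sub>m N - g) - z0) < \<epsilon>}"
    if z: "z0 \<noteq> 0 \<and> 0 < \<epsilon> \<and> \<epsilon> \<le> cmod z0" and N: "N0 z0 \<epsilon> \<le> N" and H: "haar_probability N \<mu>" for z0 \<epsilon> N \<mu>
  proof -
    have nN: "n \<le> N" and "r z0 \<epsilon> \<le> real N"
      using N unfolding N0_def by linarith+
    moreover have "0 \<le> (6 * cmod z0 / \<epsilon>) ^ 8" by (simp add: zero_le_even_power)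
    ultimately have e: "exp (1280 * (ln (cmod z0))\<^sup>2 + 30720) \<le> real N" and p: "(6 * cmod z0 / \<epsilon>) ^ 8 \<le> real N"
      unfolding r_def using exp_gt_zero[of "1280 * (ln (cmod z0))\<^sup>2 + 30720"] by linarith+
    have "0 < real N" using e exp_gt_zero less_le_trans by blast
    then have "1280 * (ln (cmod z0))\<^sup>2 + 30720 \<le> ln (real N)"
      using e by (simp add: ln_ge_iff)
    then have "(\<epsilon> / cmod z0)\<^sup>2 / (57600 * ln (real N)) \<le> measure \<mu> {g \<in> unitary_group N. cmod (Determinant.det (1\<^sub>m N - g) - z0) < \<epsilon>}"
      using z by (intro n nN H p) auto
    then show ?thesis by simp
  qed
  ultimately show ?thesis
    by (intro exI[of _ "1 / 57600"]) auto
qed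

end
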